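(* Let $L/K$ be a finite extension of number fields. A Witt vector $\xi\in W_{O_K}(O_L)$ is integral over $O_K$ if and only if it is automatic.
   Context: For a number field $K$, $O_K$ is its ring of integers, $P_K$ the set of nonzero prime ideals, $I_K$ the monoid of nonzero ideals of $O_K$, $k_\mathfrak{p}=O_K/\mathfrak{p}$ with cardinality $\#k_\mathfrak{p}$. For a flat $O_K$-algebra $A$, $A^{I_K}$ is the product ring with componentwise $O_K$-algebra structure (so $O_K$ sits inside as constant vectors, and integrality over $O_K$ refers to this structure), and $\psi_\mathfrak{p}$ is the shift $(\xi_\mathfrak{a})_\mathfrak{a}\mapsto(\xi_{\mathfrak{p}\mathfrak{a}})_\mathfrak{a}$. Witt vectors: $U_0(A)=A^{I_K}$, $U_{n+1}(A)=\{\xi\in U_n(A)\mid\psi_\mathfrak{p}\xi-\xi^{\#k_\mathfrak{p}}\in\mathfrak{p}U_n(A)\ \forall\mathfrak{p}\in P_K\}$ ($\mathfrak{p}U_n(A)$ the $O_K$-submodule generated by $r\zeta$, $r\in\mathfrak{p}$, $\zeta\in U_n(A)$), and $W_{O_K}(A)=\bigcap_nU_n(A)$. Automatic: a DFAO over input alphabet $P_K$ and output set $A$ is $(S,\delta,s_0,\tau)$ with $S$ finite, $\delta:S\times P_K\to S$ (extended to finite words by $\delta(s,\varepsilon)=s$, $\delta(s,u\mathfrak{p})=\delta(\delta(s,u),\mathfrak{p})$), $s_0\in S$, $\tau:S\to A$; $\xi\in W_{O_K}(A)$ is automatic if some DFAO satisfies $\xi_\mathfrak{a}=\tau(\delta(s_0,\mathfrak{p}_1\cdots\mathfrak{p}_r))$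 for every finite word $\mathfrak{p}_1\cdots\mathfrak{p}_r$ over $P_K$ with $\mathfrak{a}=\mathfrak{p}_1\cdots\mathfrak{p}_r$. *)

theory Defs
  imports "HOL-Algebra.Algebra"
begin

section \<open>Number fields and integral elements\<close>

text \<open>The prime field is the subfield generated by the empty set; injectivity of
  \<open>n \<mapsto> n \<cdot> 1\<close> says that the characteristic is zero.\<close>

definition number_field :: "('a, 'm) ring_scheme \<Rightarrow> bool" where
  "number_field F \<longleftrightarrow> field F \<and> inj (\<lambda>n::nat. [n] \<cdot>\<^bsub>F\<^esub> \<one>\<^bsub>F\<^esub>) \<and>
     ring.finite_dimension F (generate_field F {}) (carrier F)"

text \<open>Polynomials are coefficient lists with the leading coefficient first, as in HOL-Algebra.
  Membership in \<open>univ_poly\<close> is not required, because it would exclude all monic polynomials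
  over the zero ring.\<close>

definition integral_over :: "('a, 'm) ring_scheme \<Rightarrow> 'a set \<Rightarrow> 'a \<Rightarrow> bool" where
  "integral_over S B x \<longleftrightarrow> x \<in> carrier S \<and>
     (\<exists>p. p \<in> lists B \<and> p \<noteq> [] \<and> lead_coeff p = \<one>\<^bsub>S\<^esub> \<and> ring.eval S p x = \<zero>\<^bsub>S\<^esub>)"

definition ring_of_integers :: "('a, 'm) ring_scheme \<Rightarrow> ('a, 'm) ring_scheme" where
  "ring_of_integers F =
     F \<lparr> carrier := {x \<in> carrier F. integral_over F (range (\<lambda>k::int. [k] \<cdot>\<^bsub>F\<^esub> \<one>\<^bsub>F\<^esub>)) x} \<rparr>"

definition integral_element ::
    "('a, 'm) ring_scheme \<Rightarrow> ('a, 'b, 'n) module_scheme \<Rightarrow> 'b \<Rightarrow> bool" where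
  "integral_element R A x \<longleftrightarrow>
     integral_over A ((\<lambda>r. r \<odot>\<^bsub>A\<^esub> \<one>\<^bsub>A\<^esub>) ` carrier R) x"

text \<open>\<open>S\<close>, regarded as an algebra over any of its subrings.\<close>

definition overring_algebra :: "('a, 'm) ring_scheme \<Rightarrow> ('a, 'a) module" where
  "overring_algebra S =
     \<lparr> carrier = carrier S, monoid.mult = monoid.mult S, monoid.one = monoid.one S, ring.zero = ring.zero S, ring.add = ring.add S,
       smult = monoid.mult S \<rparr>"

section \<open>Witt vectors\<close>

definition nonzero_ideals :: "('a, 'm) ring_scheme \<Rightarrow> 'a set set" where
  "nonzero_ideals R = {I. ideal I R \<and> I \<noteq> {\<zero>\<^bsub>R\<^esub>}}"

definition nonzero_primes :: "('a, 'm) ring_scheme \<Rightarrow> 'a set set" where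
  "nonzero_primes R = {P. primeideal P R \<and> P \<noteq> {\<zero>\<^bsub>R\<^esub>}}"

definition power_algebra :: "('a, 'b, 'n) module_scheme \<Rightarrow> 'i set \<Rightarrow> ('a, 'i \<Rightarrow> 'b) module" where
  "power_algebra A I =
     \<lparr> carrier = I \<rightarrow>\<^sub>E carrier A,
       monoid.mult = (\<lambda>x y. \<lambda>i\<in>I. x i \<otimes>\<^bsub>A\<^esub> y i),
       monoid.one = (\<lambda>i\<in>I. \<one>\<^bsub>A\<^esub>),
       ring.zero = (\<lambda>i\<in>I. \<zero>\<^bsub>A\<^esub>),
       ring.add = (\<lambda>x y. \<lambda>i\<in>I. x i \<oplus>\<^bsub>A\<^esub> y i),
       smult = (\<lambda>r x. \<lambda>i\<in>I. r \<odot>\<^bsub>A\<^esub> x i) \<rparr>"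

definition ghost_algebra ::
    "('a, 'm) ring_scheme \<Rightarrow> ('a, 'b, 'n) module_scheme \<Rightarrow> ('a, 'a set \<Rightarrow> 'b) module" where
  "ghost_algebra R A = power_algebra A (nonzero_ideals R)"

definition shift :: "('a, 'm) ring_scheme \<Rightarrow> 'a set \<Rightarrow> ('a set \<Rightarrow> 'b) \<Rightarrow> ('a set \<Rightarrow> 'b)" where
  "shift R P \<xi> = (\<lambda>I\<in>nonzero_ideals R. \<xi> (ideal_prod R P I))"

definition ideal_span ::
    "('a, 'm) ring_scheme \<Rightarrow> ('a, 'b, 'n) module_scheme \<Rightarrow> 'a set \<Rightarrow> 'b set \<Rightarrow> 'b set" where
  "ideal_span R M P N =
     \<Inter>{H. submodule H R M \<and> {r \<odot>\<^bsub>M\<^esub> \<zeta> | r \<zeta>. r \<in> P \<and> \<zeta> \<in> N} \<subseteq> H}"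

primrec witt_stage ::
    "('a, 'm) ring_scheme \<Rightarrow> ('a, 'b, 'n) module_scheme \<Rightarrow> nat \<Rightarrow> ('a set \<Rightarrow> 'b) set" where
  "witt_stage R A 0 = carrier (ghost_algebra R A)"
| "witt_stage R A (Suc n) =
     {\<xi> \<in> witt_stage R A n. \<forall>P\<in>nonzero_primes R.
        shift R P \<xi> \<ominus>\<^bsub>ghost_algebra R A\<^esub> \<xi> [^]\<^bsub>ghost_algebra R A\<^esub> card (carrier (R Quot P))
          \<in> ideal_span R (ghost_algebra R A) P (witt_stage R A n)}"

definition witt_vectors ::
    "('a, 'm) ring_scheme \<Rightarrow> ('a, 'b, 'n) module_scheme \<Rightarrow> ('a set \<Rightarrow> 'b) set" where
  "witt_vectors R A = (\<Inter>n. witt_stage R A n)"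

section \<open>Automatic Witt vectors\<close>

locale dfao =
  fixes alphabet :: "'i set" and outputs :: "'o set"
    and states :: "'s set" and trans :: "'s \<Rightarrow> 'i \<Rightarrow> 's" and init :: 's and out :: "'s \<Rightarrow> 'o"
  assumes finite_states: "finite states"
    and trans_closed: "\<lbrakk>s \<in> states; a \<in> alphabet\<rbrakk> \<Longrightarrow> trans s a \<in> states"
    and init_state: "init \<in> states"
    and out_closed: "s \<in> states \<Longrightarrow> out s \<in> outputs"

text \<open>The empty word stands for the unit ideal.\<close>

definition word_ideal :: "('a, 'm) ring_scheme \<Rightarrow> 'a set list \<Rightarrow> 'a set" where
  "word_ideal R w = foldr (ideal_prod R) w (carrier R)"

text \<open>State sets are finite, so taking the states to be natural numbers loses no generality.\<close>

definition automatic ::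
    "('a, 'm) ring_scheme \<Rightarrow> ('a, 'b, 'n) module_scheme \<Rightarrow> ('a set \<Rightarrow> 'b) \<Rightarrow> bool" where
  "automatic R A \<xi> \<longleftrightarrow>
     (\<exists>(S :: nat set) \<delta> s\<^sub>0 \<tau>. dfao (nonzero_primes R) (carrier A) S \<delta> s\<^sub>0 \<tau> \<and>
        (\<forall>w\<in>lists (nonzero_primes R). \<xi> (word_ideal R w) = \<tau> (foldl \<delta> s\<^sub>0 w)))"

end

(*
  Automatic vectors have finitely many values because every nonzero ideal is a product of primes;
  finitely many algebraic integers satisfy a common monic integral equation, and then so does the
  vector.

  Conversely, an integral xi takes values in a finite set V of roots, and it suffices that xi has
  finitely many shifts psi_a xi (Myhill-Nerode).  For all primes P but finitely many, distinct
  elements of V are incongruent modulo P O_L, so psi_P xi = xi^q (mod P) says that psi_P acts on the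
  values of xi through a self-map of V.  At a bad prime P one shows by induction on m that
  n |-> psi_P^n z is eventually periodic modulo P^m for z in U_m: writing psi_P z = z^q + d with d in
  P U_(m-1), the sequence psi_P^n d is eventually periodic modulo P^m by induction, and
  x_(n+1) = x_n^q + d_n is a recursion in a finite ring.  For large m the elements of V are
  incongruent modulo P^m, so psi_P^n xi itself is eventually periodic.
*)
theory Submission
  imports Defs
begin

section \<open>Noetherian additive subgroups and integral elements\<close>

text \<open>The alphabet is infinite, so finiteness of the orbit of each single psi_P would not
  suffice. The good primes contribute finitely many operations altogether, because each acts by
  composition with one of the finitely many self-maps of V. The bad primes are finite in number and
  their shifts commute, so it is enough that each has a finite orbit on xi. This requires equality
  of whole vectors, hence a preperiod and a period that do not depend on the index; both are
  therefore bounded through the number of residue classes alone. The arithmetic rests on one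
  finiteness fact: a nonzero element of O_K lies in only finitely many ideals. It supplies maximal
  elements and terminating inductions, bounds the set of bad primes, and shows that an element g of
  K all of whose powers have a common denominator is integral. The last point has two uses: it makes
  primes invertible, and it shows that the filtration of O_L by divisibility by powers of P,
  measured with some g in P^-1 outside O_K, has intersection zero.\<close>

context ring
begin

text \<open>Noetherian as a \<int>-module. The chain condition is imposed on subsets of the ring
  itself, because in this form it passes to M + yN without forming quotient modules.\<close>

definition noetherian_sg :: "'a set \<Rightarrow> bool" where
  "noetherian_sg M \<longleftrightarrow> additive_subgroup M R \<and>
     (\<forall>C. (\<forall>n::nat. additive_subgroup (C n) R \<and> C n \<subseteq> M \<and> C n \<subseteq> C (Suc n)) \<longrightarrow>
        (\<exists>n. \<forall>m\<ge>n. C m = C n))"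

text \<open>The span of \<open>1, ..., y^(n-1)\<close> over B. Lists of exact length n, with leading
  zeros allowed, make it closed under addition when B is; the empty list gives the zero module for n
  = 0.\<close>

definition evals :: "'a set \<Rightarrow> 'a \<Rightarrow> nat \<Rightarrow> 'a set" where
  "evals B y n = {eval p y | p. set p \<subseteq> B \<and> length p = n}"

lemma additive_subgroupI:
  assumes "H \<subseteq> carrier R" "\<zero> \<in> H" "\<And>x. x \<in> H \<Longrightarrow> \<ominus> x \<in> H"
    and "\<And>x y. \<lbrakk>x \<in> H; y \<in> H\<rbrakk> \<Longrightarrow> x \<oplus> y \<in> H"
  shows "additive_subgroup H R"
  using assms by (intro additive_subgroup.intro add.subgroupI) (auto simp: a_inv_def[symmetric])

lemma additive_subgroup_neg: "additive_subgroup H R \<Longrightarrow> x \<in> H \<Longrightarrow> \<ominus> x \<in> H"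
  using additive_subgroup.a_subgroup add.subgroupE(3) by (metis a_inv_def)

lemma additive_subgroup_minus:
  "additive_subgroup H R \<Longrightarrow> x \<in> H \<Longrightarrow> y \<in> H \<Longrightarrow> x \<ominus> y \<in> H"
  by (simp add: a_minus_def additive_subgroup.a_closed additive_subgroup_neg)

lemmas additive_subgroup_facts =
  additive_subgroup.zero_closed additive_subgroup.a_closed additive_subgroup_neg
  additive_subgroup_minus additive_subgroup.a_Hcarr

lemma subring_additive_subgroup: "subring B R \<Longrightarrow> additive_subgroup B R"
  by (intro additive_subgroup.intro subring.axioms(1))

lemma noetherian_sg_subgroup: "noetherian_sg M \<Longrightarrow> additive_subgroup M R"
  by (simp add: noetherian_sg_def)

lemma noetherian_sgD:
  assumes "noetherian_sg M" "\<And>n::nat. additive_subgroup (C n) R" "\<And>n. C n \<subseteq> M"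
    "\<And>n. C n \<subseteq> C (Suc n)"
  shows "\<exists>n. \<forall>m\<ge>n. C m = C n"
  using assms unfolding noetherian_sg_def by blast

lemma noetherian_sg_zero: "noetherian_sg {\<zero>}"
proof -
  have "C m = C 0" if C: "\<forall>n. additive_subgroup (C n) R \<and> C n \<subseteq> {\<zero>} \<and> C n \<subseteq> C (Suc n)" 
    for C and m :: nat
  proof -
    have "C n = {\<zero>}" for n
      using C[rule_format, of n] additive_subgroup.zero_closed by fastforce
    then show ?thesis by simp
  qed
  moreover have "additive_subgroup {\<zero>} R" by (rule additive_subgroupI) auto
  ultimately show ?thesis
    unfolding noetherian_sg_def by blast
qed

lemma chain_mono:
  assumes "\<And>n::nat. C n \<subseteq> C (Suc n)" "n \<le> m" shows "C n \<subseteq> C m"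
  using assms lift_Suc_mono_le by blast

end

context cring
begin

lemma additive_subgroup_add_image:
  assumes M: "additive_subgroup M R" and N: "additive_subgroup N R" and y: "y \<in> carrier R"
  shows "additive_subgroup {a \<oplus> y \<otimes> b | a b. a \<in> M \<and> b \<in> N} R" (is "additive_subgroup ?S R")
proof -
  note fM = additive_subgroup_facts[OF M] and fN = additive_subgroup_facts[OF N]
  show ?thesis
  proof (rule additive_subgroupI)
  show "?S \<subseteq> carrier R" using fM fN y by auto
  have "\<zero> = \<zero> \<oplus> y \<otimes> \<zero>" using y by simp
  then show "\<zero> \<in> ?S" using fM(1) fN(1) by blast
  next
  fix x assume "x \<in> ?S"
  then obtain a b where ab: "a \<in> M" "b \<in> N" "x = a \<oplus> y \<otimes> b" by blast
  then have "\<ominus> x = (\<ominus> a) \<oplus> y \<otimes> (\<ominus> b)"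
    using fM(5) fN(5) y by (simp add: minus_add r_minus)
  then show "\<ominus> x \<in> ?S" using ab fM(3) fN(3) by blast
  next
  fix x x' assume "x \<in> ?S" "x' \<in> ?S"
  then obtain a b a' b' where ab: "a \<in> M" "b \<in> N" "x = a \<oplus> y \<otimes> b"
    "a' \<in> M" "b' \<in> N" "x' = a' \<oplus> y \<otimes> b'" by blast
  then have "x \<oplus> x' = (a \<oplus> a') \<oplus> y \<otimes> (b \<oplus> b')"
    using fM(5) fN(5) y by (simp add: r_distr a_ac)
  then show "x \<oplus> x' \<in> ?S" using ab fM(2) fN(2) by blast
qed
qed

text \<open>The extension argument for Noetherian modules: a chain in M + yN is controlled by its
  traces on M and by the y-coefficients in N that occur in it, and both of these chains
  stabilise.\<close>

lemma noetherian_sg_add_image: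
  assumes M: "noetherian_sg M" and N: "noetherian_sg N" and y: "y \<in> carrier R"
  shows "noetherian_sg {a \<oplus> y \<otimes> b | a b. a \<in> M \<and> b \<in> N}" (is "noetherian_sg ?S")
proof -
  note sM = noetherian_sg_subgroup[OF M] and sN = noetherian_sg_subgroup[OF N]
  note fM = additive_subgroup_facts[OF sM] and fN = additive_subgroup_facts[OF sN]
  have sub: "additive_subgroup ?S R"
    using additive_subgroup_add_image[OF sM sN y] .
  have "\<exists>n. \<forall>m\<ge>n. C m = C n"
    if C: "\<forall>n::nat. additive_subgroup (C n) R \<and> C n \<subseteq> ?S \<and> C n \<subseteq> C (Suc n)" for C
  proof -
    define A where "A n = C n \<inter> M" for n
    define B where "B n = {b \<in> N. \<exists>a\<in>M. a \<oplus> y \<otimes> b \<in> C n}" for n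
    have sC: "additive_subgroup (C n) R" and CS: "C n \<subseteq> ?S" and CC: "C n \<subseteq> C (Suc n)" for n
      using C by auto
    note fC = additive_subgroup_facts[OF sC]
    have "additive_subgroup (A n) R" for n
      unfolding A_def by (rule additive_subgroupI) (use fM fC in auto)
    moreover have "A n \<subseteq> M" "A n \<subseteq> A (Suc n)" for n using CC unfolding A_def by auto
    ultimately have "\<exists>n. \<forall>m\<ge>n. A m = A n" by (rule noetherian_sgD[OF M])
    then obtain n1 where n1: "\<And>m. m \<ge> n1 \<Longrightarrow> A m = A n1" by blast
    have "additive_subgroup (B n) R" for n
    proof (rule additive_subgroupI)
      show "B n \<subseteq> carrier R" using fN unfolding B_def by auto
      have "\<zero> \<oplus> y \<otimes> \<zero> \<in> C n" using y fC(1) by simp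
      then show "\<zero> \<in> B n" using fM(1) fN(1) unfolding B_def by blast
    next
      fix b assume "b \<in> B n"
      then obtain a where ab: "b \<in> N" "a \<in> M" "a \<oplus> y \<otimes> b \<in> C n" unfolding B_def by blast
      then have "\<ominus> (a \<oplus> y \<otimes> b) = (\<ominus> a) \<oplus> y \<otimes> (\<ominus> b)"
        using fM(5) fN(5) y by (simp add: minus_add r_minus)
      then have "(\<ominus> a) \<oplus> y \<otimes> (\<ominus> b) \<in> C n" using fC(3)[OF ab(3)] by simp
      then show "\<ominus> b \<in> B n"
        using fM(3)[OF ab(2)] fN(3)[OF ab(1)] unfolding B_def by blast
    next
      fix b b' assume "b \<in> B n" "b' \<in> B n"
      then obtain a a' where ab: "b \<in> N" "a \<in> M" "a \<oplus> y \<otimes> b \<in> C n"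
        "b' \<in> N" "a' \<in> M" "a' \<oplus> y \<otimes> b' \<in> C n" unfolding B_def by blast
      then have "(a \<oplus> y \<otimes> b) \<oplus> (a' \<oplus> y \<otimes> b') = (a \<oplus> a') \<oplus> y \<otimes> (b \<oplus> b')"
        using fM(5) fN(5) y by (simp add: r_distr a_ac)
      then have "(a \<oplus> a') \<oplus> y \<otimes> (b \<oplus> b') \<in> C n" using fC(2)[OF ab(3) ab(6)] by simp
      then show "b \<oplus> b' \<in> B n"
        using fM(2)[OF ab(2,5)] fN(2)[OF ab(1,4)] unfolding B_def by blast
    qed
    moreover have "B n \<subseteq> N" "B n \<subseteq> B (Suc n)" for n using CC unfolding B_def by auto
    ultimately have "\<exists>n. \<forall>m\<ge>n. B m = B n" by (rule noetherian_sgD[OF N])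
    then obtain n2 where n2: "\<And>m. m \<ge> n2 \<Longrightarrow> B m = B n2" by blast
    define n where "n = max n1 n2"
    have "C m \<subseteq> C n" if "m \<ge> n" for m
    proof
      fix x assume x: "x \<in> C m"
      then obtain a b where ab: "a \<in> M" "b \<in> N" "x = a \<oplus> y \<otimes> b" using CS by blast
      then have "b \<in> B m" using x unfolding B_def by blast
      then have "b \<in> B n" using n2 that unfolding n_def by (metis max.cobounded2 max.boundedE)
      then obtain a' where a': "a' \<in> M" "a' \<oplus> y \<otimes> b \<in> C n" unfolding B_def by blast
      then have "a' \<oplus> y \<otimes> b \<in> C m" using chain_mono[of C, OF CC that] by blast
      \<comment> \<open>The two elements share the coefficient b, so their difference lies in M and
        is caught by the chain \<open>A\<close>.\<close>
      then have "x \<ominus> (a' \<oplus> y \<otimes> b) \<in> C m" using fC(4) x by blast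
      moreover have eq: "x \<ominus> (a' \<oplus> y \<otimes> b) = a \<ominus> a'"
      proof -
        have c: "a \<in> carrier R" "a' \<in> carrier R" "y \<otimes> b \<in> carrier R"
          using ab a' fM(5) fN(5) y by auto
        then show ?thesis unfolding ab(3) by algebra
      qed
      ultimately have "a \<ominus> a' \<in> A m" using fM(4) ab a' unfolding A_def by simp
      then have "a \<ominus> a' \<in> A n" using n1 that unfolding n_def by (metis max.cobounded1 max.boundedE)
      then have "x \<ominus> (a' \<oplus> y \<otimes> b) \<in> C n" using eq unfolding A_def by simp
      then have "(x \<ominus> (a' \<oplus> y \<otimes> b)) \<oplus> (a' \<oplus> y \<otimes> b) \<in> C n" using a' fC(2) by blast
      moreover have "(x \<ominus> (a' \<oplus> y \<otimes> b)) \<oplus> (a' \<oplus> y \<otimes> b) = x"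
        using fC(5)[OF x] fC(5)[OF a'(2)] by algebra
      ultimately show "x \<in> C n" by simp
    qed
    then show ?thesis using chain_mono[of C, OF CC] by (metis subset_antisym)
  qed
  with sub show ?thesis unfolding noetherian_sg_def by (rule conjI[OF _ allI[OF impI]])
qed

lemma evals_0: "evals B y 0 = {\<zero>}"
  unfolding evals_def by auto

lemma evals_Suc:
  assumes "B \<subseteq> carrier R" "y \<in> carrier R"
  shows "evals B y (Suc n) = {a \<oplus> y [^] n \<otimes> b | a b. a \<in> evals B y n \<and> b \<in> B}" (is "_ = ?r")
proof
  show "evals B y (Suc n) \<subseteq> ?r"
  proof
    fix x assume "x \<in> evals B y (Suc n)"
    then obtain p where p: "set p \<subseteq> B" "length p = Suc n" "x = eval p y"
      unfolding evals_def by blast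
    then obtain b q where q: "p = b # q" "length q = n" by (cases p) auto
    then have c: "set q \<subseteq> carrier R" "b \<in> carrier R" using p assms by auto
    then have "x = eval q y \<oplus> y [^] n \<otimes> b"
      using p q assms eval_in_carrier[of q y] by (auto simp: m_comm a_comm)
    then show "x \<in> ?r" using p q unfolding evals_def by auto
  qed
  show "?r \<subseteq> evals B y (Suc n)"
  proof
    fix x assume "x \<in> ?r"
    then obtain q b where q: "set q \<subseteq> B" "length q = n" "b \<in> B" "x = eval q y \<oplus> y [^] n \<otimes> b"
      unfolding evals_def by blast
    then have "b \<in> carrier R" "eval q y \<in> carrier R"
      using assms eval_in_carrier[of q y] by auto
    then have "x = eval (b # q) y" using q assms by (auto simp: m_comm a_comm)
    then show "x \<in> evals B y (Suc n)" using q unfolding evals_def by fastforce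
  qed
qed

lemma noetherian_sg_evals:
  assumes "noetherian_sg B" "y \<in> carrier R"
  shows "noetherian_sg (evals B y n)"
proof (induction n)
  case 0 show ?case by (simp add: evals_0 noetherian_sg_zero)
next
  case (Suc n)
  have "B \<subseteq> carrier R" using additive_subgroup_facts(5)[OF noetherian_sg_subgroup[OF assms(1)]] by blast
  then show ?case
    using noetherian_sg_add_image[OF Suc assms(1), of "y [^] n"] assms(2) by (simp add: evals_Suc)
qed

lemma additive_subgroup_evals:
  assumes B: "additive_subgroup B R" and y: "y \<in> carrier R"
  shows "additive_subgroup (evals B y n) R"
proof (induction n)
  case 0 show ?case by (auto simp: evals_0 intro: additive_subgroupI)
next
  case (Suc n)
  have "B \<subseteq> carrier R" using additive_subgroup_facts(5)[OF B] by blast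
  then show ?case
    using additive_subgroup_add_image[OF Suc B, of "y [^] n"] y by (simp add: evals_Suc)
qed

end

lemma ascending_chain_stabilises:
  fixes C :: "nat \<Rightarrow> 'a set"
  assumes "\<And>n. C n \<subseteq> C (Suc n)" "finite (range C)"
  shows "\<exists>n. \<forall>m\<ge>n. C m = C n"
proof -
  obtain V where V: "V \<in> range C" "\<And>Y. Y \<in> range C \<Longrightarrow> V \<subseteq> Y \<Longrightarrow> V = Y"
    using finite_has_maximal[OF assms(2)] by auto
  then obtain n where "V = C n" by blast
  moreover have "C n \<subseteq> C m" if "m \<ge> n" for m using lift_Suc_mono_le[of C, OF assms(1) that] .
  ultimately have "\<forall>m\<ge>n. C m = C n" using V(2) by (metis rangeI)
  then show ?thesis ..
qed

section \<open>The image of the integers in a ring\<close>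

context ring
begin

abbreviation int_img :: "'a set" where
  "int_img \<equiv> range (\<lambda>k::int. [k] \<cdot> \<one>)"

lemma int_img_add: "[(k + l::int)] \<cdot> \<one> = [k] \<cdot> \<one> \<oplus> [l] \<cdot> \<one>"
  by (simp add: add.int_pow_mult)

lemma int_img_neg: "[(- k::int)] \<cdot> \<one> = \<ominus> ([k] \<cdot> \<one>)"
  by (simp add: add.int_pow_neg a_inv_def)

lemma int_img_mult: "[(k * l::int)] \<cdot> \<one> = [k] \<cdot> \<one> \<otimes> [l] \<cdot> \<one>"
  by (simp add: add_pow_ldistr_int add.int_pow_pow mult.commute)

lemma int_img_1: "[(1::int)] \<cdot> \<one> = \<one>"
  by (simp add: add.int_pow_1)

lemma int_img_0: "[(0::int)] \<cdot> \<one> = \<zero>"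
  by (simp add: add_pow_def int_pow_def2)

lemma int_img_carrier: "[(k::int)] \<cdot> \<one> \<in> carrier R"
  by (simp add: add.int_pow_closed)

lemma subring_int_img: "subring int_img R"
proof (rule subringI)
  show "int_img \<subseteq> carrier R" using int_img_carrier by auto
  show "\<one> \<in> int_img" using int_img_1 by (metis rangeI)
  fix x assume "x \<in> int_img"
  then obtain k :: int where k: "x = [k] \<cdot> \<one>" by blast
  then show "\<ominus> x \<in> int_img" using int_img_neg[of k] by (metis rangeI)
  fix y assume "y \<in> int_img"
  then obtain l :: int where l: "y = [l] \<cdot> \<one>" by blast
  show "x \<otimes> y \<in> int_img" unfolding k l int_img_mult[symmetric] by blast
  show "x \<oplus> y \<in> int_img" unfolding k l int_img_add[symmetric] by blast
qed

lemma int_img_subset_subring: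
  assumes B: "subring B R"
  shows "int_img \<subseteq> B"
proof
  fix z assume "z \<in> int_img"
  then obtain k :: int where k: "z = [k] \<cdot> \<one>" by blast
  have nat: "[(int j)] \<cdot> \<one> \<in> B" for j
    by (induction j)
      (simp_all add: int_img_0 int_img_1 int_img_add add.int_pow_mult subringE(2,3,7)[OF B])
  show "z \<in> B"
    using nat[of "nat k"] subringE(5)[OF B nat[of "nat (- k)"]]
    unfolding k by (cases "k \<ge> 0") (auto simp: int_img_neg[symmetric])
qed

text \<open>Pulled back to \<int>, a chain is either zero throughout or eventually contains some m >
  0. From then on its members are unions of residue classes modulo m, so they are determined by
  subsets of the finite set \<open>{0..<m}\<close>.\<close>

lemma noetherian_sg_int_img: "noetherian_sg int_img"
proof -
  have "\<exists>n. \<forall>m\<ge>n. C m = C n"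
    if C: "\<forall>n::nat. additive_subgroup (C n) R \<and> C n \<subseteq> int_img \<and> C n \<subseteq> C (Suc n)" for C
  proof -
    define D where "D n = {k::int. [k] \<cdot> \<one> \<in> C n}" for n
    have sC: "additive_subgroup (C n) R" and CS: "C n \<subseteq> int_img" and CC: "C n \<subseteq> C (Suc n)" for n
      using C by auto
    note fC = additive_subgroup_facts[OF sC]
    have CD: "C n = (\<lambda>k::int. [k] \<cdot> \<one>) ` D n" for n
      using CS[of n] unfolding D_def by blast
    have D0: "0 \<in> D n" for n unfolding D_def by (simp add: int_img_0 fC(1))
    have Dadd: "k + l \<in> D n" if "k \<in> D n" "l \<in> D n" for k l n
      using that fC(2) unfolding D_def by (simp add: int_img_add)
    have Dneg: "- k \<in> D n" if "k \<in> D n" for k n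
      using that fC(3) unfolding D_def by (simp add: int_img_neg)
    have Dmono: "D n \<subseteq> D (Suc n)" for n using CC unfolding D_def by blast
    have Dnat: "int j * k \<in> D n" if "k \<in> D n" for j k n
      by (induction j) (use that D0 Dadd in \<open>auto simp: algebra_simps\<close>)
    have Dmult: "j * k \<in> D n" if "k \<in> D n" for j k n
      using Dnat[OF that, of "nat j"] Dnat[OF Dneg[OF that], of "nat (- j)"]
      by (cases "j \<ge> 0") auto
    show ?thesis
    proof (cases "\<forall>n. D n \<subseteq> {0}")
      case True
      then have "D n = {0}" for n using D0 by blast
      then show ?thesis by (simp add: CD)
    next
      case False
      then obtain n0 k where "k \<in> D n0" "k \<noteq> 0" by blast
      then obtain m where m: "m \<in> D n0" "m > 0"
        using Dneg by (metis neg_0_less_iff_less linorder_neqE)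
      have mD: "m \<in> D n" if "n \<ge> n0" for n
        using m lift_Suc_mono_le[of D, OF Dmono that] by blast
      define E where "E n = D n \<inter> {0..<m}" for n
      have "range E \<subseteq> Pow {0..<m}" unfolding E_def by auto
      then have "finite (range E)" by (rule finite_subset) simp
      moreover have "E n \<subseteq> E (Suc n)" for n using Dmono unfolding E_def by blast
      ultimately obtain n1 where n1: "\<And>j. j \<ge> n1 \<Longrightarrow> E j = E n1"
        using ascending_chain_stabilises[of E] by blast
      have iff: "k \<in> D n \<longleftrightarrow> k mod m \<in> E n" if "n \<ge> n0" for k n
      proof -
        have "(k div m) * m \<in> D n" using Dmult mD[OF that] by blast
        moreover have "k = (k mod m) + (k div m) * m" "k mod m = k + - ((k div m) * m)"
          by (auto simp: minus_div_mult_eq_mod)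
        ultimately have "k \<in> D n \<longleftrightarrow> k mod m \<in> D n" using Dadd Dneg by metis
        then show ?thesis using m(2) unfolding E_def by simp
      qed
      have "D j = D (max n0 n1)" if "j \<ge> max n0 n1" for j
        using that iff[of j] iff[of "max n0 n1"] n1[of j] n1[of "max n0 n1"] by auto
      then show ?thesis using CD by (metis (no_types))
    qed
  qed
  with subring_additive_subgroup[OF subring_int_img] show ?thesis
    unfolding noetherian_sg_def by (rule conjI[OF _ allI[OF impI]])
qed

end

section \<open>Integrality through spans of powers, and the ring of algebraic integers\<close>

context cring
begin

lemma evalsI: "set p \<subseteq> B \<Longrightarrow> length p = n \<Longrightarrow> eval p y = x \<Longrightarrow> x \<in> evals B y n"
  unfolding evals_def by blast

lemma additive_subgroup_evals':
  "subring B R \<Longrightarrow> y \<in> carrier R \<Longrightarrow> additive_subgroup (evals B y n) R"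
  by (intro additive_subgroup_evals subring_additive_subgroup)

text \<open>Splitting the head 1 off the coefficient list turns a monic equation into a membership
  in the span of the lower powers; integrality is handled in this module form from here on.\<close>

lemma integral_over_iff_evals:
  assumes B: "subring B R"
  shows "integral_over R B x \<longleftrightarrow> x \<in> carrier R \<and> (\<exists>n. x [^] n \<in> evals B x n)"
proof (intro iffI conjI)
  assume I: "integral_over R B x"
  then show x: "x \<in> carrier R" by (simp add: integral_over_def)
  from I obtain p where p: "p \<in> lists B" "p \<noteq> []" "hd p = \<one>" "eval p x = \<zero>"
    unfolding integral_over_def by blast
  then obtain q where q: "p = \<one> # q" "set q \<subseteq> B" by (cases p) auto
  have qc: "eval q x \<in> carrier R"
    using q x eval_in_carrier subringE(1)[OF B] by (meson order_trans)
  have "x [^] length q \<oplus> eval q x = \<zero>" using p q x by simp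
  then have "x [^] length q = \<ominus> eval q x" using qc x by (simp add: minus_equality)
  moreover have "eval q x \<in> evals B x (length q)" using q unfolding evals_def by blast
  ultimately have "x [^] length q \<in> evals B x (length q)"
    using additive_subgroup_neg[OF additive_subgroup_evals'[OF B x]] by simp
  then show "\<exists>n. x [^] n \<in> evals B x n" by blast
next
  assume "x \<in> carrier R \<and> (\<exists>n. x [^] n \<in> evals B x n)"
  then obtain n where x: "x \<in> carrier R" and n: "x [^] n \<in> evals B x n" by blast
  have "\<ominus> (x [^] n) \<in> evals B x n"
    using additive_subgroup_neg[OF additive_subgroup_evals'[OF B x] n] .
  then obtain q where q: "set q \<subseteq> B" "length q = n" "eval q x = \<ominus> (x [^] n)"
    unfolding evals_def by (smt (verit) mem_Collect_eq)
  then have "eval (\<one> # q) x = \<zero>" using x by (simp add: r_neg)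
  moreover have "\<one> # q \<in> lists B" using q subringE(3)[OF B] by auto
  ultimately show "integral_over R B x" unfolding integral_over_def using x
    by (intro conjI exI[of _ "\<one> # q"]) auto
qed

lemma integral_over_mono: "integral_over R B x \<Longrightarrow> B \<subseteq> B' \<Longrightarrow> integral_over R B' x"
  unfolding integral_over_def using lists_mono by blast

lemma evals_subset_Suc:
  assumes "subring B R" "y \<in> carrier R"
  shows "evals B y n \<subseteq> evals B y (Suc n)"
proof
  fix x assume x: "x \<in> evals B y n"
  have "x = x \<oplus> y [^] n \<otimes> \<zero>"
    using assms x additive_subgroup_facts(5)[OF additive_subgroup_evals'[OF assms]] by simp
  then show "x \<in> evals B y (Suc n)"
    using x subringE(1,2)[OF assms(1)] assms(2) evals_Suc[of B y n] by blast
qed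

lemma evals_shift:
  assumes "subring B R" "y \<in> carrier R" "x \<in> evals B y n"
  shows "x \<otimes> y \<in> evals B y (Suc n)"
proof -
  obtain p where p: "set p \<subseteq> B" "length p = n" "x = eval p y"
    using assms(3) unfolding evals_def by blast
  have c: "set p \<subseteq> carrier R" using p subringE(1)[OF assms(1)] by blast
  then have "eval (p @ [\<zero>]) y = x \<otimes> y"
    using p assms eval_append_aux[of p \<zero> y] eval_in_carrier[of p y] by simp
  moreover have "set (p @ [\<zero>]) \<subseteq> B" using p subringE(2)[OF assms(1)] by auto
  ultimately show ?thesis using p by (intro evalsI[of "p @ [\<zero>]"]) auto
qed

lemma evals_smult:
  assumes B: "subring B R" and y: "y \<in> carrier R" and b: "b \<in> B" and x: "x \<in> evals B y n"
  shows "x \<otimes> b \<in> evals B y n"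
proof -
  have "evals B y n \<subseteq> {x \<in> carrier R. x \<otimes> b \<in> evals B y n}"
  proof (induction n)
    case 0
    then show ?case using b subringE(1)[OF B] by (auto simp: evals_0)
  next
    case (Suc n)
    show ?case
    proof
      fix z assume "z \<in> evals B y (Suc n)"
      then obtain a c where z: "a \<in> evals B y n" "c \<in> B" "z = a \<oplus> y [^] n \<otimes> c"
        using evals_Suc[OF subringE(1)[OF B] y] by blast
      have c: "a \<in> carrier R" "a \<otimes> b \<in> evals B y n" "b \<in> carrier R" "c \<in> carrier R"
        using Suc z b subringE(1)[OF B] by auto
      have "z \<otimes> b = a \<otimes> b \<oplus> y [^] n \<otimes> (c \<otimes> b)"
        using z(3) c y by (simp add: l_distr m_assoc)
      then have "z \<otimes> b \<in> evals B y (Suc n)"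
        using evals_Suc[OF subringE(1)[OF B] y] c(2) subringE(6)[OF B z(2) b] by blast
      then show "z \<in> {x \<in> carrier R. x \<otimes> b \<in> evals B y (Suc n)}" using z c y by simp
    qed
  qed
  then show ?thesis using x by blast
qed

text \<open>If \<open>y\<close> satisfies a monic equation of degree \<open>n\<close> over \<open>B\<close>, then the \<open>B\<close>-combinations of
  \<open>1, \<dots>, y\<^sup>n\<^sup>-\<^sup>1\<close> form a ring.\<close>

lemma evals_subring:
  assumes B: "subring B R" and y: "y \<in> carrier R" and n: "y [^] n \<in> evals B y n"
    and "n > 0"
  shows "subring (evals B y n) R" "B \<subseteq> evals B y n" "y \<in> evals B y n"
proof -
  note s = additive_subgroup_evals'[OF B y]
  note f = additive_subgroup_facts[OF s]
  note B' = subringE(1)[OF B]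
  \<comment> \<open>The monic equation absorbs the top power, so multiplication by y, which a priori
    raises the length by one, stays in the span.\<close>
  have "evals B y (Suc n) \<subseteq> evals B y n"
    using evals_smult[OF B y _ n] f(2) by (auto simp: evals_Suc[OF B' y])
  then have shift: "x \<otimes> y \<in> evals B y n" if "x \<in> evals B y n" for x
    using evals_shift[OF B y that] by blast
  have pow: "x \<otimes> y [^] k \<in> evals B y n" if x: "x \<in> evals B y n" for x and k :: nat
  proof (induction k)
    case 0
    then show ?case using x f(5) by simp
  next
    case (Suc k)
    have "x \<otimes> y [^] Suc k = (x \<otimes> y [^] k) \<otimes> y" using f(5)[OF x] y by (simp add: m_assoc)
    then show ?case using shift[OF Suc] by simp
  qed
  have mult: "x \<otimes> z \<in> evals B y n" if x: "x \<in> evals B y n" and z: "z \<in> evals B y k" for x z k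
    using z
  proof (induction k arbitrary: z)
    case 0
    then show ?case using f(1) f(5)[OF x] by (simp add: evals_0)
  next
    case (Suc k)
    then obtain a c where z: "a \<in> evals B y k" "c \<in> B" "z = a \<oplus> y [^] k \<otimes> c"
      using evals_Suc[OF B' y] by blast
    have "x \<otimes> z = x \<otimes> a \<oplus> (x \<otimes> y [^] k) \<otimes> c"
      using z f(5)[OF x] f(5)[OF z(1)] B' y by (auto simp: r_distr m_assoc subsetD)
    then show ?case
      using Suc.IH[OF z(1)] evals_smult[OF B y z(2) pow[OF x]] f(2) by simp
  qed
  have "B \<subseteq> evals B y (Suc 0)"
  proof
    fix b assume b: "b \<in> B"
    then have "eval [b] y = b" using B' y by auto
    then show "b \<in> evals B y (Suc 0)" using b by (intro evalsI[of "[b]"]) auto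
  qed
  then show "B \<subseteq> evals B y n"
    using lift_Suc_mono_le[of "evals B y", OF evals_subset_Suc[OF B y], of "Suc 0" n] assms(4)
    by auto
  then have one: "\<one> \<in> evals B y n" using subringE(3)[OF B] by blast
  show "subring (evals B y n) R"
    by (rule subringI) (use f one mult in auto)
  show "y \<in> evals B y n" using shift[OF one] y by simp
qed

text \<open>The substitute for rings that are finitely generated as abelian groups: the class is
  closed under adjoining an integral element, and all its members consist of integral elements, by
  chain conditions in place of determinants.\<close>

definition noetherian_order :: "'a set \<Rightarrow> bool" where
  "noetherian_order B \<longleftrightarrow> subring B R \<and> noetherian_sg B"

lemma noetherian_order_adjoin:
  assumes B: "noetherian_order B" and y: "integral_over R B y"
  obtains B' where "noetherian_order B'" "B \<subseteq> B'" "y \<in> B'"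
proof -
  have sB: "subring B R" and nB: "noetherian_sg B" using B by (auto simp: noetherian_order_def)
  obtain n where y': "y \<in> carrier R" and n: "y [^] n \<in> evals B y n"
    using y integral_over_iff_evals[OF sB] by blast
  \<comment> \<open>The relation is multiplied by y because n = 0 can occur in the zero ring,
    whereas \<open>evals_subring\<close> needs a positive exponent.\<close>
  have "y [^] Suc n \<in> evals B y (Suc n)" using evals_shift[OF sB y' n] by simp
  from evals_subring[OF sB y' this] noetherian_sg_evals[OF nB y'] that[of "evals B y (Suc n)"]
  show thesis by (simp add: noetherian_order_def)
qed

text \<open>The spans of \<open>1, ..., x^(n-1)\<close> over the integers form an ascending chain
  inside B; where it stops, the next power of x is a combination of the previous ones.\<close>

lemma noetherian_order_integral:
  assumes B: "noetherian_order B" and x: "x \<in> B"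
  shows "integral_over R int_img x"
proof -
  have sB: "subring B R" and nB: "noetherian_sg B" using B by (auto simp: noetherian_order_def)
  have x': "x \<in> carrier R" using x subringE(1)[OF sB] by blast
  note Z = subring_int_img
  note f = additive_subgroup_facts[OF additive_subgroup_evals'[OF sB x']]
  have ZB: "int_img \<subseteq> B" using int_img_subset_subring[OF sB] .
  have pow: "x [^] k \<in> B" for k :: nat
    by (induction k) (use x subringE[OF sB] in auto)
  have "evals int_img x n \<subseteq> B" for n
  proof (induction n)
    case 0 show ?case using subringE(2)[OF sB] by (simp add: evals_0)
  next
    case (Suc n)
    then show ?case
      using ZB pow[of n] subringE(6,7)[OF sB] by (auto simp: evals_Suc[OF subringE(1)[OF Z] x'] subset_iff)
  qed
  from noetherian_sgD[of B "evals int_img x", OF nB additive_subgroup_evals'[OF Z x'] this evals_subset_Suc[OF Z x']]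
  obtain n where n: "evals int_img x (Suc n) = evals int_img x n" by (metis le_SucI order_refl)
  have "\<zero> \<oplus> x [^] n \<otimes> \<one> \<in> evals int_img x (Suc n)"
    using evals_Suc[OF subringE(1)[OF Z] x'] subringE(3)[OF Z]
      additive_subgroup_facts(1)[OF additive_subgroup_evals'[OF Z x']] by blast
  then have "x [^] n \<in> evals int_img x n" using n x' by simp
  then show ?thesis using integral_over_iff_evals[OF Z] x' by blast
qed

definition integers :: "'a set" where
  "integers = {x \<in> carrier R. integral_over R int_img x}"

text \<open>Puts finitely many algebraic integers into one order. Closure under sums and products,
  and transitivity of integrality, then reduce to computations inside that order.\<close>

lemma noetherian_order_adjoin_integers:
  assumes "finite V" "V \<subseteq> integers"
  obtains B where "noetherian_order B" "V \<subseteq> B"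
proof -
  from assms have "\<exists>B. noetherian_order B \<and> V \<subseteq> B"
  proof (induction V)
    case empty
    then show ?case using subring_int_img noetherian_sg_int_img by (auto simp: noetherian_order_def)
  next
    case (insert x V)
    then obtain B where B: "noetherian_order B" "V \<subseteq> B" by auto
    have "int_img \<subseteq> B" using int_img_subset_subring B by (simp add: noetherian_order_def)
    then have "integral_over R B x" using insert integral_over_mono unfolding integers_def by blast
    from noetherian_order_adjoin[OF B(1) this] show ?case using B by (metis insert_subset order_trans)
  qed
  then show thesis using that by blast
qed

lemma subring_integers: "subring integers R"
proof (rule subringI)
  show "integers \<subseteq> carrier R" by (auto simp: integers_def)
  have *: "x \<in> integers" if "noetherian_order B" "x \<in> B" for x B
    using noetherian_order_integral[OF that] unfolding integers_def integral_over_def by blast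
  obtain B where B: "noetherian_order B" using noetherian_order_adjoin_integers[of "{}"] by blast
  then show "\<one> \<in> integers" using * subringE(3) by (auto simp: noetherian_order_def)
  fix x assume x: "x \<in> integers"
  obtain B where B: "noetherian_order B" "{x} \<subseteq> B" 
    using noetherian_order_adjoin_integers[of "{x}"] x by blast
  then have "\<ominus> x \<in> B" using subringE(5)[of B R x] by (auto simp: noetherian_order_def)
  then show "\<ominus> x \<in> integers" using * B by blast
  fix y assume y: "y \<in> integers"
  obtain B where B: "noetherian_order B" "{x, y} \<subseteq> B" 
    using noetherian_order_adjoin_integers[of "{x, y}"] x y by blast
  then have "x \<otimes> y \<in> B" "x \<oplus> y \<in> B"
    using subringE(6,7)[of B R x] by (auto simp: noetherian_order_def)
  then show "x \<otimes> y \<in> integers" "x \<oplus> y \<in> integers" using * B by blast+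
qed

text \<open>Only finitely many coefficients occur in the equation of y; an order containing them
  remains an order after y is adjoined.\<close>

lemma integral_over_integers:
  assumes "integral_over R integers y"
  shows "y \<in> integers"
proof -
  obtain p where p: "p \<in> lists integers" "p \<noteq> []" "hd p = \<one>" "eval p y = \<zero>" "y \<in> carrier R"
    using assms unfolding integral_over_def by blast
  obtain B where B: "noetherian_order B" "set p \<subseteq> B"
    using noetherian_order_adjoin_integers[of "set p"] p by auto
  then have "integral_over R B y" unfolding integral_over_def using p by auto
  from noetherian_order_adjoin[OF B(1) this] noetherian_order_integral p(5)
  show ?thesis unfolding integers_def by (metis (mono_tags, lifting) mem_Collect_eq)
qed

end

section \<open>Finite residue rings of integers in number fields\<close>

text \<open>R plays the part of L and E that of K, so both rings of integers lie in one ambient ring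
  and their elements can be mixed in computations. The choice E = \<open>carrier R\<close> yields
  the same facts for O_L.\<close>

locale number_subfield = field R for R (structure) +
  fixes E :: "'a set"
  assumes char_zero: "inj (\<lambda>n::nat. [n] \<cdot> \<one>)"
    and finite_degree: "finite_dimension (generate_field R {}) (carrier R)"
    and subfield_E: "subfield E R"
begin

definition \<O> :: "'a set" where "\<O> = E \<inter> integers"

lemma int_img_eq_zero_iff: "[(k::int)] \<cdot> \<one> = \<zero> \<longleftrightarrow> k = 0"
proof
  have nat: "j = 0" if "[(int j)] \<cdot> \<one> = \<zero>" for j
  proof -
    have "[j] \<cdot> \<one> = [(0::nat)] \<cdot> \<one>" using that by (simp add: add_pow_def int_pow_int)
    then show ?thesis using injD[OF char_zero] by blast
  qed
  assume k: "[k] \<cdot> \<one> = \<zero>"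
  then have "[(- k)] \<cdot> \<one> = \<zero>" by (simp add: int_img_neg)
  with k nat[of "nat k"] nat[of "nat (- k)"] show "k = 0" by (cases "k \<ge> 0") auto
qed (simp add: int_img_0)

lemma subring_E: "subring E R"
  using subfieldE(1)[OF subfield_E] .

lemma subring_O: "subring \<O> R"
  unfolding \<O>_def
  by (rule subringI) (use subringE[OF subring_E] subringE[OF subring_integers] in auto)

lemmas O_facts = subringE[OF subring_O]

lemma O_carrier: "x \<in> \<O> \<Longrightarrow> x \<in> carrier R"
  using O_facts(1) by blast

lemma O_minus: "x \<in> \<O> \<Longrightarrow> y \<in> \<O> \<Longrightarrow> x \<ominus> y \<in> \<O>"
  by (simp add: a_minus_def O_facts)

lemma int_img_O: "[(k::int)] \<cdot> \<one> \<in> \<O>"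
  using int_img_subset_subring[OF subring_O] by blast

lemma pow_O: "x \<in> \<O> \<Longrightarrow> x [^] (n::nat) \<in> \<O>"
  by (induction n) (auto simp: O_facts)

lemma integral_over_O: "y \<in> E \<Longrightarrow> integral_over R \<O> y \<Longrightarrow> y \<in> \<O>"
  using integral_over_integers[OF integral_over_mono, of \<O> y] unfolding \<O>_def by blast

text \<open>\<open>generate_field R {}\<close> is the copy of \<rat> in R. Denominators multiply
  under sums and products; for an inverse, numerator and denominator are exchanged, and
  characteristic zero keeps the new denominator nonzero.\<close>

lemma prime_field_fraction:
  assumes "z \<in> generate_field R {}"
  shows "\<exists>(a::int) (b::int). b \<noteq> 0 \<and> [b] \<cdot> \<one> \<otimes> z = [a] \<cdot> \<one>"
  using assms
proof (induction rule: generate_field.induct)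
  case one
  then show ?case by (intro exI[of _ "1::int"]) (simp add: int_img_1)
next
  case (incl h)
  then show ?case by simp
next
  case (a_inv h)
  then obtain a b :: int where ab: "b \<noteq> 0" "[b] \<cdot> \<one> \<otimes> h = [a] \<cdot> \<one>" by blast
  have "h \<in> carrier R" using a_inv(1) generate_field_in_carrier[of "{}"] by simp
  then have "[b] \<cdot> \<one> \<otimes> \<ominus> h = [(- a)] \<cdot> \<one>"
    using ab(2) int_img_carrier[of b] by (simp add: r_minus int_img_neg)
  then show ?case using ab(1) by blast
next
  case (m_inv h)
  then obtain a b :: int where ab: "b \<noteq> 0" "[b] \<cdot> \<one> \<otimes> h = [a] \<cdot> \<one>" by blast
  have h: "h \<in> carrier R" using m_inv(1) generate_field_in_carrier[of "{}"] by simp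
  then have hU: "h \<in> Units R" using m_inv by (simp add: field_Units)
  have "a \<noteq> 0"
  proof
    assume "a = 0"
    then have "[b] \<cdot> \<one> \<otimes> h = \<zero>" using ab(2) int_img_0 by simp
    then show False using integral h m_inv(2) int_img_carrier ab(1) int_img_eq_zero_iff by blast
  qed
  moreover have "[a] \<cdot> \<one> \<otimes> inv h = [b] \<cdot> \<one>"
    using ab(2)[symmetric] hU h int_img_carrier[of b] by (simp add: m_assoc)
  ultimately show ?case by blast
next
  case (eng_add h1 h2)
  then obtain a b c d :: int where ab: "b \<noteq> 0" "[b] \<cdot> \<one> \<otimes> h1 = [a] \<cdot> \<one>"
    and cd: "d \<noteq> 0" "[d] \<cdot> \<one> \<otimes> h2 = [c] \<cdot> \<one>" by blast
  have h: "h1 \<in> carrier R" "h2 \<in> carrier R"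
    using eng_add generate_field_in_carrier[of "{}"] by auto
  note c = int_img_carrier[of b] int_img_carrier[of d]
  have "[(b * d)] \<cdot> \<one> \<otimes> (h1 \<oplus> h2)
      = [d] \<cdot> \<one> \<otimes> ([b] \<cdot> \<one> \<otimes> h1) \<oplus> [b] \<cdot> \<one> \<otimes> ([d] \<cdot> \<one> \<otimes> h2)"
    unfolding int_img_mult using h c by algebra
  also have "\<dots> = [(d * a + b * c)] \<cdot> \<one>" unfolding ab(2) cd(2) by (simp only: int_img_mult int_img_add)
  finally show ?case using ab(1) cd(1) by (metis mult_eq_0_iff)
next
  case (eng_mult h1 h2)
  then obtain a b c d :: int where ab: "b \<noteq> 0" "[b] \<cdot> \<one> \<otimes> h1 = [a] \<cdot> \<one>"
    and cd: "d \<noteq> 0" "[d] \<cdot> \<one> \<otimes> h2 = [c] \<cdot> \<one>" by blast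
  have h: "h1 \<in> carrier R" "h2 \<in> carrier R"
    using eng_mult generate_field_in_carrier[of "{}"] by auto
  note c = int_img_carrier[of b] int_img_carrier[of d]
  have "[(b * d)] \<cdot> \<one> \<otimes> (h1 \<otimes> h2) = ([b] \<cdot> \<one> \<otimes> h1) \<otimes> ([d] \<cdot> \<one> \<otimes> h2)"
    using h c by (simp add: int_img_mult m_ac)
  also have "\<dots> = [(a * c)] \<cdot> \<one>" unfolding ab(2) cd(2) by (simp only: int_img_mult)
  finally show ?case using ab(1) cd(1) by (metis mult_eq_0_iff)
qed

definition int_combine :: "int list \<Rightarrow> 'a list \<Rightarrow> 'a" where
  "int_combine ks Us = combine (map (\<lambda>k. [k] \<cdot> \<one>) ks) Us"

lemma int_combine_simps [simp]:
  "int_combine (k # ks) (u # Us) = [k] \<cdot> \<one> \<otimes> u \<oplus> int_combine ks Us"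
  "int_combine [] Us = \<zero>" "int_combine ks [] = \<zero>"
  by (simp_all add: int_combine_def)

lemma int_combine_O: "set Us \<subseteq> \<O> \<Longrightarrow> int_combine ks Us \<in> \<O>"
proof (induction Us arbitrary: ks)
  case (Cons u Us)
  then show ?case by (cases ks) (auto simp: O_facts int_img_O)
qed (simp add: O_facts)

lemma int_combine_carrier: "set Us \<subseteq> carrier R \<Longrightarrow> int_combine ks Us \<in> carrier R"
  unfolding int_combine_def using int_img_carrier by (intro combine_in_carrier) auto

lemma int_combine_scale:
  assumes "set Us \<subseteq> carrier R"
  shows "int_combine (map ((*) c) ks) Us = [c] \<cdot> \<one> \<otimes> int_combine ks Us"
proof -
  have "map (\<lambda>k. [k] \<cdot> \<one>) (map ((*) c) ks) = map ((\<otimes>) ([c] \<cdot> \<one>)) (map (\<lambda>k. [k] \<cdot> \<one>) ks)"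
    by (simp add: int_img_mult)
  then show ?thesis unfolding int_combine_def
    using combine_r_distr[OF _ assms int_img_carrier[of c], of "map (\<lambda>k. [k] \<cdot> \<one>) ks"]
      int_img_carrier by (metis (no_types, lifting) image_subset_iff list.set_map)
qed

lemma int_combine_divmod:
  assumes "set Us \<subseteq> carrier R"
  shows "int_combine ks Us = int_combine (map (\<lambda>k. k mod c) ks) Us
    \<oplus> [c] \<cdot> \<one> \<otimes> int_combine (map (\<lambda>k. k div c) ks) Us"
  using assms
proof (induction Us arbitrary: ks)
  case (Cons u Us)
  show ?case
  proof (cases ks)
    case (Cons k ks')
    have "[k] \<cdot> \<one> = [(k mod c)] \<cdot> \<one> \<oplus> [c] \<cdot> \<one> \<otimes> [(k div c)] \<cdot> \<one>"
      by (simp only: int_img_mult[symmetric] int_img_add[symmetric] mod_mult_div_eq)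
    moreover have "u \<in> carrier R" "set Us \<subseteq> carrier R" using Cons.prems by auto
    moreover note Cons.IH[OF this(2), of ks']
    ultimately show ?thesis
      unfolding Cons using int_img_carrier int_combine_carrier[of Us]
      by (simp add: l_distr r_distr m_assoc a_ac)
  qed (simp add: int_img_carrier)
qed (simp add: int_img_carrier)

lemma common_denominator:
  assumes "set Ks \<subseteq> generate_field R {}"
  shows "\<exists>(b::int) ks. b \<noteq> 0 \<and> map ((\<otimes>) ([b] \<cdot> \<one>)) Ks = map (\<lambda>k::int. [k] \<cdot> \<one>) ks"
  using assms
proof (induction Ks)
  case Nil
  then show ?case by (intro exI[of _ 1] exI[of _ "[]"]) simp
next
  case (Cons K Ks)
  then obtain b :: int and ks :: "int list" where b: "b \<noteq> 0" "map ((\<otimes>) ([b] \<cdot> \<one>)) Ks = map (\<lambda>k. [k] \<cdot> \<one>) ks" by auto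
  obtain c d :: int where d: "d \<noteq> 0" "[d] \<cdot> \<one> \<otimes> K = [c] \<cdot> \<one>"
    using prime_field_fraction Cons.prems by (meson list.set_intros(1) subsetD)
  have K: "K \<in> carrier R" "set Ks \<subseteq> carrier R"
    using Cons.prems generate_field_in_carrier[of "{}"] by auto
  have "[(b * d)] \<cdot> \<one> \<otimes> K = [(b * c)] \<cdot> \<one>"
    using K d(2) int_img_carrier by (simp add: int_img_mult m_assoc)
  moreover have "map ((\<otimes>) ([(b * d)] \<cdot> \<one>)) Ks = map (\<lambda>k. [k] \<cdot> \<one>) (map ((*) d) ks)"
  proof -
    have "map ((\<otimes>) ([(b * d)] \<cdot> \<one>)) Ks = map ((\<otimes>) ([d] \<cdot> \<one>)) (map ((\<otimes>) ([b] \<cdot> \<one>)) Ks)"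
      using K(2) int_img_carrier by (auto simp: int_img_mult m_ac subset_iff)
    then show ?thesis unfolding b(2) by (simp add: int_img_mult)
  qed
  ultimately have "map ((\<otimes>) ([(b * d)] \<cdot> \<one>)) (K # Ks) = map (\<lambda>k. [k] \<cdot> \<one>) ((b * c) # map ((*) d) ks)"
    by simp
  then show ?case using b(1) d(1) by (metis mult_eq_0_iff)
qed

text \<open>A rational dependence is cleared of denominators and divided by the gcd of its
  coefficients. The resulting primitive relation stays nontrivial modulo every prime, which bounds
  dimensions modulo p by the degree.\<close>

lemma integer_dependence_mod_prime:
  assumes dim: "dimension n (generate_field R {}) (carrier R)"
    and Us: "set Us \<subseteq> carrier R" "length Us > n" and p: "Factorial_Ring.prime p"
  shows "\<exists>ks::int list. length ks = length Us \<and> int_combine ks Us = \<zero> \<and> (\<exists>k\<in>set ks. \<not> p dvd k)"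
proof -
  have sf: "subfield (generate_field R {}) R" using generate_field_is_subfield[of "{}"] by simp
  have "dependent (generate_field R {}) Us"
    using independent_length_le_dimension[OF sf dim, of Us] Us by linarith
  from dependent_imp_non_trivial_combine[OF sf Us(1) this] obtain Ks where Ks:
    "length Ks = length Us" "combine Ks Us = \<zero>" "set Ks \<subseteq> generate_field R {}" "set Ks \<noteq> {\<zero>}"
    by metis
  obtain b :: int and ks :: "int list" where b: "b \<noteq> 0" "map ((\<otimes>) ([b] \<cdot> \<one>)) Ks = map (\<lambda>k. [k] \<cdot> \<one>) ks"
    using common_denominator[OF Ks(3)] by (elim exE conjE)
  have Kc: "set Ks \<subseteq> carrier R" using Ks(3) generate_field_in_carrier[of "{}"] by auto
  have len: "length ks = length Us" using b(2) Ks(1) by (metis length_map)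
  have "int_combine ks Us = [b] \<cdot> \<one> \<otimes> combine Ks Us"
    unfolding int_combine_def b(2)[symmetric] using combine_r_distr[OF Kc Us(1) int_img_carrier] by simp
  then have zero: "int_combine ks Us = \<zero>" using Ks(2) int_img_carrier by simp
  have "\<not> set ks \<subseteq> {0}"
  proof
    assume "set ks \<subseteq> {0}"
    then have "set (map (\<lambda>k. [k] \<cdot> \<one>) ks) \<subseteq> {\<zero>}" by (auto simp: int_img_0)
    then have "\<forall>K\<in>set Ks. [b] \<cdot> \<one> \<otimes> K = \<zero>" unfolding b(2)[symmetric] by auto
    then have "set Ks \<subseteq> {\<zero>}"
      using Kc b(1) int_img_carrier integral int_img_eq_zero_iff by (metis insertCI subset_iff)
    moreover have "set Ks \<noteq> {}" using Ks(1) Us(2) by auto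
    ultimately show False using Ks(4) by (simp add: subset_singleton_iff)
  qed
  define g where "g = Gcd (set ks)"
  have g: "g \<noteq> 0" using \<open>\<not> set ks \<subseteq> {0}\<close> unfolding g_def by (simp add: Gcd_0_iff)
  define ls where "ls = map (\<lambda>k. k div g) ks"
  have ks: "ks = map ((*) g) ls"
    unfolding ls_def map_map by (rule map_idI[symmetric]) (auto simp: g_def)
  have "[g] \<cdot> \<one> \<otimes> int_combine ls Us = \<zero>"
    using zero int_combine_scale[OF Us(1), of g ls] ks by simp
  then have "int_combine ls Us = \<zero>"
    using integral int_img_carrier int_combine_carrier[OF Us(1)] g int_img_eq_zero_iff by blast
  moreover have "\<exists>k\<in>set ls. \<not> p dvd k"
  proof (rule ccontr)
    assume "\<not> ?thesis"
    then have "p * g dvd k" if "k \<in> set ks" for k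
      using that unfolding ks by (auto simp: mult.commute intro: mult_dvd_mono)
    then have "p * g dvd 1 * g" unfolding g_def by (simp add: Gcd_greatest)
    then show False using g p by (simp only: dvd_mult_cancel_right) auto
  qed
  ultimately show ?thesis using len unfolding ls_def by (metis length_map)
qed

text \<open>Finiteness of O/cO for O = \<open>\<O>\<close>, expressed by a finite set of
  representatives, so that all computations remain in R.\<close>

definition finite_mod :: "int \<Rightarrow> bool" where
  "finite_mod c \<longleftrightarrow> (\<exists>F. finite F \<and> F \<subseteq> \<O> \<and> (\<forall>r\<in>\<O>. \<exists>f\<in>F. \<exists>s\<in>\<O>. r = f \<oplus> [c] \<cdot> \<one> \<otimes> s))"

text \<open>O/pO is a vector space over the field with p elements whose dimension is at most the
  degree of R. A maximal independent list spans it, and its combinations with coefficients in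
  \<open>{0..<p}\<close> are representatives. This takes the place of an integral basis.\<close>

lemma finite_mod_prime:
  fixes p :: int
  assumes p: "Factorial_Ring.prime p"
  shows "finite_mod p"
proof -
  obtain n where n: "dimension n (generate_field R {}) (carrier R)"
    using finite_degree unfolding finite_dimension_def by blast
  \<comment> \<open>Linear independence of the classes in O/pO over the field with p elements, with
    integers as coefficients.\<close>
  define indep where "indep es \<longleftrightarrow> set es \<subseteq> \<O> \<and>
     (\<forall>ks. length ks = length es \<and> (\<exists>s\<in>\<O>. int_combine ks es = [p] \<cdot> \<one> \<otimes> s) \<longrightarrow>
        (\<forall>k\<in>set ks. p dvd k))" for es
  have "length es \<le> n" if "indep es" for es
  proof (rule ccontr)
    assume "\<not> length es \<le> n"
    then obtain ks where ks: "length ks = length es" "int_combine ks es = \<zero>" "\<exists>k\<in>set ks. \<not> p dvd k"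
      using integer_dependence_mod_prime[OF n _ _ p, of es] \<open>indep es\<close> O_facts(1)
      unfolding indep_def by (meson not_le order_trans)
    moreover have "\<zero> = [p] \<cdot> \<one> \<otimes> \<zero>" using int_img_carrier by simp
    ultimately show False using \<open>indep es\<close> O_facts(2) unfolding indep_def by metis
  qed
  moreover have "indep []" unfolding indep_def by simp
  ultimately obtain es where es: "indep es" and max: "\<And>fs. indep fs \<Longrightarrow> length fs \<le> length es"
    using ex_has_greatest_nat[of indep "[]" length "Suc n"] by (metis less_Suc_eq_le)
  have esO: "set es \<subseteq> \<O>" and esc: "set es \<subseteq> carrier R" using es O_facts(1) unfolding indep_def by auto
  define F where "F = (\<lambda>ks. int_combine ks es) ` {ks. set ks \<subseteq> {0..<p} \<and> length ks = length es}"
  have "finite F" unfolding F_def by (intro finite_imageI finite_lists_length_eq) simp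
  moreover have "F \<subseteq> \<O>" unfolding F_def using int_combine_O[OF esO] by auto
  moreover have "\<exists>f\<in>F. \<exists>s\<in>\<O>. r = f \<oplus> [p] \<cdot> \<one> \<otimes> s" if r: "r \<in> \<O>" for r
  proof -
    have rc: "r \<in> carrier R" using r O_carrier by blast
    have "\<not> indep (r # es)" using max[of "r # es"] by auto
    then obtain ls s where ls: "length ls = length (r # es)" "s \<in> \<O>"
      "int_combine ls (r # es) = [p] \<cdot> \<one> \<otimes> s" "\<exists>k\<in>set ls. \<not> p dvd k"
      using r esO unfolding indep_def by auto
    then obtain k ks where kks: "ls = k # ks" by (cases ls) auto
    have sc: "s \<in> carrier R" using ls O_carrier by blast
    define c where "c = int_combine ks es"
    have cc: "c \<in> carrier R" unfolding c_def by (rule int_combine_carrier[OF esc])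
    have eq: "[k] \<cdot> \<one> \<otimes> r \<oplus> c = [p] \<cdot> \<one> \<otimes> s" using ls kks by (simp add: c_def)
    \<comment> \<open>Were k divisible by p, the term with r could be moved into pO, leaving a
      nontrivial relation modulo p among \<open>es\<close> alone.\<close>
    have "\<not> p dvd k"
    proof
      assume pk: "p dvd k"
      then obtain k' where k': "k = p * k'" by blast
      have "c = [p] \<cdot> \<one> \<otimes> (s \<ominus> [k'] \<cdot> \<one> \<otimes> r)"
      proof -
        have "c = [p] \<cdot> \<one> \<otimes> s \<ominus> [k] \<cdot> \<one> \<otimes> r"
          unfolding eq[symmetric] using cc rc int_img_carrier[of k] by algebra
        also have "\<dots> = [p] \<cdot> \<one> \<otimes> (s \<ominus> [k'] \<cdot> \<one> \<otimes> r)"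
          unfolding k' int_img_mult using sc rc int_img_carrier[of p] int_img_carrier[of k'] by algebra
        finally show ?thesis .
      qed
      moreover have "s \<ominus> [k'] \<cdot> \<one> \<otimes> r \<in> \<O>" using O_minus ls(2) r O_facts int_img_O by auto
      ultimately have "\<forall>k\<in>set ks. p dvd k" using es ls(1) kks unfolding indep_def c_def by auto
      then show False using ls(4) pk kks by auto
    qed
    \<comment> \<open>Since v inverts k modulo p, the relation \<open>k r + c = p s\<close> gives
      that r equals -vc up to pO; this is the element d.\<close>
    then have "coprime p k" using p by (rule prime_imp_coprime[rotated])
    then obtain u v where uv: "u * p + v * k = 1"
      using bezout_int[of p k] by auto
    define d where "d = int_combine (map ((*) (- v)) ks) es"
    have d: "d = \<ominus> ([v] \<cdot> \<one> \<otimes> c)"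
      unfolding d_def int_combine_scale[OF esc] c_def int_img_neg
      using int_img_carrier[of v] cc c_def by (simp add: l_minus)
    have "r = ([u] \<cdot> \<one> \<otimes> [p] \<cdot> \<one> \<oplus> [v] \<cdot> \<one> \<otimes> [k] \<cdot> \<one>) \<otimes> r"
      unfolding int_img_mult[symmetric] int_img_add[symmetric] uv int_img_1 using rc by simp
    also have "\<dots> = d \<oplus> [p] \<cdot> \<one> \<otimes> ([u] \<cdot> \<one> \<otimes> r) \<oplus> [v] \<cdot> \<one> \<otimes> ([k] \<cdot> \<one> \<otimes> r \<oplus> c)"
      unfolding d using rc cc int_img_carrier[of u] int_img_carrier[of p] int_img_carrier[of v]
        int_img_carrier[of k] by algebra
    also have "\<dots> = d \<oplus> [p] \<cdot> \<one> \<otimes> ([u] \<cdot> \<one> \<otimes> r \<oplus> [v] \<cdot> \<one> \<otimes> s)"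
      unfolding eq d using rc cc sc int_img_carrier[of u] int_img_carrier[of p] int_img_carrier[of v]
      by algebra
    finally have r1: "r = d \<oplus> [p] \<cdot> \<one> \<otimes> ([u] \<cdot> \<one> \<otimes> r \<oplus> [v] \<cdot> \<one> \<otimes> s)" .
    \<comment> \<open>Coefficients of d are reduced to \<open>{0..<p}\<close>: f collects the
      remainders and t the quotients.\<close>
    define f where "f = int_combine (map (\<lambda>k. k mod p) (map ((*) (- v)) ks)) es"
    define t where "t = int_combine (map (\<lambda>k. k div p) (map ((*) (- v)) ks)) es"
    have "f \<in> F" unfolding f_def F_def using kks ls(1) prime_gt_0_int[OF p]
      by (intro imageI) auto
    moreover have "d = f \<oplus> [p] \<cdot> \<one> \<otimes> t" unfolding d_def f_def t_def by (rule int_combine_divmod[OF esc])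
    moreover have tO: "t \<in> \<O>" "f \<in> \<O>" unfolding t_def f_def using int_combine_O[OF esO] by auto
    moreover have "r = f \<oplus> [p] \<cdot> \<one> \<otimes> (t \<oplus> ([u] \<cdot> \<one> \<otimes> r \<oplus> [v] \<cdot> \<one> \<otimes> s))"
    proof -
      have c: "t \<in> carrier R" "f \<in> carrier R" using tO O_carrier by auto
      show ?thesis
        by (subst r1, subst \<open>d = f \<oplus> [p] \<cdot> \<one> \<otimes> t\<close>)
          (use c rc sc int_img_carrier[of u] int_img_carrier[of p] int_img_carrier[of v] in algebra)
    qed
    moreover have "t \<oplus> ([u] \<cdot> \<one> \<otimes> r \<oplus> [v] \<cdot> \<one> \<otimes> s) \<in> \<O>" using tO r ls(2) int_img_O O_facts by simp
    ultimately show ?thesis by blast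
  qed
  ultimately show ?thesis unfolding finite_mod_def by blast
qed

text \<open>Representatives modulo cd are the two-digit expansions f + cg, with f a representative
  modulo c and g one modulo d.\<close>

lemma finite_mod_mult:
  assumes "finite_mod c" "finite_mod d"
  shows "finite_mod (c * d)"
proof -
  obtain F where F: "finite F" "F \<subseteq> \<O>" "\<forall>r\<in>\<O>. \<exists>f\<in>F. \<exists>s\<in>\<O>. r = f \<oplus> [c] \<cdot> \<one> \<otimes> s"
    using assms(1) unfolding finite_mod_def by blast
  obtain G where G: "finite G" "G \<subseteq> \<O>" "\<forall>r\<in>\<O>. \<exists>f\<in>G. \<exists>s\<in>\<O>. r = f \<oplus> [d] \<cdot> \<one> \<otimes> s"
    using assms(2) unfolding finite_mod_def by blast
  define H where "H = (\<lambda>(f, g). f \<oplus> [c] \<cdot> \<one> \<otimes> g) ` (F \<times> G)"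
  have "finite H" unfolding H_def using F G by simp
  moreover have "H \<subseteq> \<O>" unfolding H_def using F(2) G(2) int_img_O O_facts(6,7) by (auto simp: subset_iff)
  moreover have "\<exists>f\<in>H. \<exists>s\<in>\<O>. r = f \<oplus> [(c * d)] \<cdot> \<one> \<otimes> s" if r: "r \<in> \<O>" for r
  proof -
    obtain f s where f: "f \<in> F" "s \<in> \<O>" "r = f \<oplus> [c] \<cdot> \<one> \<otimes> s" using bspec[OF F(3) r] by (elim bexE)
    obtain g t where g: "g \<in> G" "t \<in> \<O>" "s = g \<oplus> [d] \<cdot> \<one> \<otimes> t" using bspec[OF G(3) f(2)] by (elim bexE)
    have c: "f \<in> carrier R" "g \<in> carrier R" "t \<in> carrier R" using f g F(2) G(2) O_carrier by auto
    have "r = (f \<oplus> [c] \<cdot> \<one> \<otimes> g) \<oplus> [(c * d)] \<cdot> \<one> \<otimes> t"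
      unfolding f(3) g(3) int_img_mult using c int_img_carrier[of c] int_img_carrier[of d] by algebra
    moreover have "f \<oplus> [c] \<cdot> \<one> \<otimes> g \<in> H" unfolding H_def using f(1) g(1) by auto
    ultimately show ?thesis using g(2) by (intro bexI)
  qed
  ultimately show ?thesis unfolding finite_mod_def by blast
qed

lemma finite_mod_1: "finite_mod 1"
  unfolding finite_mod_def int_img_1
proof (intro exI[of _ "{\<zero>}"] conjI ballI)
  fix r assume "r \<in> \<O>"
  then show "\<exists>f\<in>{\<zero>}. \<exists>s\<in>\<O>. r = f \<oplus> \<one> \<otimes> s" using O_carrier by auto
qed (auto simp: O_facts)

lemma finite_mod_nonzero: "c \<noteq> 0 \<Longrightarrow> finite_mod c"
proof (induction c rule: prime_divisors_induct)
  case zero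
  then show ?case by simp
next
  case (unit c)
  then consider "c = 1" | "c = - 1" by fastforce
  then show ?case
  proof cases
    case 2
    have "\<exists>f\<in>{\<zero>}. \<exists>s\<in>\<O>. r = f \<oplus> [(- 1::int)] \<cdot> \<one> \<otimes> s" if r: "r \<in> \<O>" for r
    proof -
      have "r = \<zero> \<oplus> [(- 1::int)] \<cdot> \<one> \<otimes> (\<ominus> r)"
        unfolding int_img_neg int_img_1 using r O_carrier by (simp add: l_minus)
      then show ?thesis using r O_facts(5) by blast
    qed
    then show ?thesis unfolding 2 finite_mod_def using O_facts(2) by (intro exI[of _ "{\<zero>}"]) auto
  qed (simp add: finite_mod_1)
next
  case (factor p c)
  then show ?case using finite_mod_mult finite_mod_prime by auto
qed

text \<open>The constant coefficient of an integral equation of x is a multiple of x; if it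
  vanishes, x is cancelled and the equation gets shorter. The integer c serves as a substitute for
  the norm of x.\<close>

lemma nonzero_dvd_integer:
  assumes x: "x \<in> \<O>" "x \<noteq> \<zero>"
  shows "\<exists>c::int. c \<noteq> 0 \<and> (\<exists>y\<in>\<O>. [c] \<cdot> \<one> = x \<otimes> y)"
proof -
  have xc: "x \<in> carrier R" using x O_carrier by blast
  have *: "\<exists>c::int. c \<noteq> 0 \<and> (\<exists>y\<in>\<O>. [c] \<cdot> \<one> = x \<otimes> y)"
    if "p \<noteq> []" "hd p = \<one>" "set p \<subseteq> int_img" "eval p x = \<zero>" for p
    using that
  proof (induction p rule: rev_induct)
    case (snoc a p)
    obtain c :: int where c: "a = [c] \<cdot> \<one>" using snoc.prems by auto
    have p: "set p \<subseteq> int_img" "set p \<subseteq> \<O>" "set p \<subseteq> carrier R"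
      using snoc.prems int_img_O int_img_carrier by auto
    have e: "eval p x \<in> \<O>"
      using p(2)
    proof (induction p)
      case (Cons b q)
      then show ?case using x pow_O O_facts by auto
    qed (simp add: O_facts)
    have ec: "eval p x \<in> carrier R" using e O_carrier by blast
    have eq: "eval p x \<otimes> x \<oplus> a = \<zero>"
      using snoc.prems eval_append_aux[OF p(3) _ xc, of a] c int_img_carrier by simp
    show ?case
    proof (cases "p = []")
      case True
      then show ?thesis using snoc.prems xc by simp
    next
      case pn: False
      show ?thesis
      proof (cases "c = 0")
        case True
        then have "eval p x \<otimes> x = \<zero>" using eq c ec xc by (simp add: int_img_0)
        then have "eval p x = \<zero>" using integral ec xc x(2) by blast
        then show ?thesis using snoc pn p by auto
      next
        case False
        have "a = x \<otimes> (\<ominus> eval p x)"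
          using eq ec xc c int_img_carrier[of c] by (simp add: r_minus m_comm a_comm minus_equality)
        then show ?thesis using False e O_facts(5) unfolding c by blast
      qed
    qed
  qed simp
  have "integral_over R int_img x" using x unfolding \<O>_def integers_def by blast
  then show ?thesis unfolding integral_over_def using * by auto
qed

lemma finite_residues:
  assumes x: "x \<in> \<O>" "x \<noteq> \<zero>"
  shows "\<exists>F. finite F \<and> F \<subseteq> \<O> \<and> (\<forall>r\<in>\<O>. \<exists>f\<in>F. \<exists>s\<in>\<O>. r = f \<oplus> x \<otimes> s)"
proof -
  obtain c :: int and y where c: "c \<noteq> 0" "y \<in> \<O>" "[c] \<cdot> \<one> = x \<otimes> y"
    using nonzero_dvd_integer[OF x] by blast
  obtain F where F: "finite F" "F \<subseteq> \<O>" "\<forall>r\<in>\<O>. \<exists>f\<in>F. \<exists>s\<in>\<O>. r = f \<oplus> [c] \<cdot> \<one> \<otimes> s"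
    using finite_mod_nonzero[OF c(1)] unfolding finite_mod_def by blast
  have "\<exists>f\<in>F. \<exists>s\<in>\<O>. r = f \<oplus> x \<otimes> s" if r: "r \<in> \<O>" for r
  proof -
    obtain f s where f: "f \<in> F" "s \<in> \<O>" "r = f \<oplus> [c] \<cdot> \<one> \<otimes> s" using bspec[OF F(3) r] by (elim bexE)
    then have "r = f \<oplus> x \<otimes> (y \<otimes> s)" using c x O_carrier by (simp add: m_assoc)
    then show ?thesis using f c O_facts(6) by blast
  qed
  then show ?thesis using F by blast
qed

text \<open>Ideals of \<open>\<O>\<close> as subsets of R. Arithmetic can then be carried out in the
  field; \<open>ideal_OK_iff\<close> compares this with ideals of the restricted ring.\<close>

definition is_ideal :: "'a set \<Rightarrow> bool" where
  "is_ideal I \<longleftrightarrow> additive_subgroup I R \<and> I \<subseteq> \<O> \<and> (\<forall>r\<in>\<O>. \<forall>i\<in>I. r \<otimes> i \<in> I)"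

text \<open>An ideal containing x is determined by which representatives modulo x it contains. This
  is the finiteness fact behind every choice of a maximal ideal and every induction on ideals
  below.\<close>

lemma finite_ideals_containing:
  assumes x: "x \<in> \<O>" "x \<noteq> \<zero>"
  shows "finite {I. is_ideal I \<and> x \<in> I}"
proof -
  obtain F where F: "finite F" "F \<subseteq> \<O>" "\<forall>r\<in>\<O>. \<exists>f\<in>F. \<exists>s\<in>\<O>. r = f \<oplus> x \<otimes> s"
    using finite_residues[OF x] by blast
  have sub: "I \<subseteq> J" if I: "is_ideal I" "x \<in> I" and J: "is_ideal J" "x \<in> J" and eq: "I \<inter> F = J \<inter> F" for I J
  proof
    fix r assume r: "r \<in> I"
    have sI: "additive_subgroup I R" and sJ: "additive_subgroup J R" using I J by (auto simp: is_ideal_def)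
    have rO: "r \<in> \<O>" using r I unfolding is_ideal_def by blast
    obtain f s where f: "f \<in> F" "s \<in> \<O>" "r = f \<oplus> x \<otimes> s" using bspec[OF F(3) rO] by (elim bexE)
    then have c: "f \<in> carrier R" "s \<in> carrier R" "x \<in> carrier R" using F(2) x O_carrier by auto
    have xs: "x \<otimes> s \<in> I" "x \<otimes> s \<in> J" using I J f(2) c unfolding is_ideal_def by (metis m_comm)+
    have "r \<ominus> x \<otimes> s = f" unfolding f(3) using c by algebra
    then have "f \<in> I" using additive_subgroup_minus[OF sI r xs(1)] by simp
    then have "f \<in> J" using eq f(1) by blast
    then show "r \<in> J" unfolding f(3) using additive_subgroup.a_closed[OF sJ _ xs(2)] by blast
  qed
  have "inj_on (\<lambda>I. I \<inter> F) {I. is_ideal I \<and> x \<in> I}"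
    by (rule inj_onI) (use sub in \<open>auto intro!: equalityI\<close>)
  moreover have "(\<lambda>I. I \<inter> F) ` {I. is_ideal I \<and> x \<in> I} \<subseteq> Pow F" by auto
  ultimately show ?thesis using F(1) by (meson finite_Pow_iff inj_on_finite)
qed

end

section \<open>Prime ideals and factorization\<close>

context number_subfield
begin

lemma is_idealD:
  assumes "is_ideal I"
  shows "additive_subgroup I R" "I \<subseteq> \<O>" "\<And>r i. r \<in> \<O> \<Longrightarrow> i \<in> I \<Longrightarrow> r \<otimes> i \<in> I"
    and "\<And>i. i \<in> I \<Longrightarrow> i \<in> carrier R" "\<zero> \<in> I" "\<And>i j. i \<in> I \<Longrightarrow> j \<in> I \<Longrightarrow> i \<oplus> j \<in> I"
    and "\<And>i j. i \<in> I \<Longrightarrow> j \<in> I \<Longrightarrow> i \<ominus> j \<in> I"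
proof -
  show sub: "additive_subgroup I R" using assms by (simp add: is_ideal_def)
  from additive_subgroup_facts[OF sub] show "\<And>i. i \<in> I \<Longrightarrow> i \<in> carrier R" "\<zero> \<in> I"
    "\<And>i j. i \<in> I \<Longrightarrow> j \<in> I \<Longrightarrow> i \<oplus> j \<in> I" "\<And>i j. i \<in> I \<Longrightarrow> j \<in> I \<Longrightarrow> i \<ominus> j \<in> I"
    by simp_all
qed (use assms in \<open>auto simp: is_ideal_def\<close>)

lemma is_idealI:
  assumes "I \<subseteq> \<O>" "\<zero> \<in> I" "\<And>i j. i \<in> I \<Longrightarrow> j \<in> I \<Longrightarrow> i \<oplus> j \<in> I"
    and "\<And>r i. r \<in> \<O> \<Longrightarrow> i \<in> I \<Longrightarrow> r \<otimes> i \<in> I"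
  shows "is_ideal I"
proof -
  have "\<ominus> i \<in> I" if "i \<in> I" for i
    using assms(4)[of "\<ominus> \<one>" i] that assms(1) O_carrier O_facts by (auto simp: l_minus subset_iff)
  moreover have "I \<subseteq> carrier R" using assms(1) O_facts(1) by blast
  ultimately have "additive_subgroup I R" using assms by (intro additive_subgroupI) auto
  then show ?thesis unfolding is_ideal_def using assms by blast
qed

lemma is_ideal_one: "is_ideal I \<Longrightarrow> \<one> \<in> I \<Longrightarrow> I = \<O>"
  using is_idealD(2,3)[of I] O_carrier by (metis r_one subsetI subset_antisym)

lemma is_ideal_O: "is_ideal \<O>"
  by (rule is_idealI) (auto simp: O_facts)

lemma is_ideal_principal:
  assumes "x \<in> \<O>" shows "is_ideal {x \<otimes> s | s. s \<in> \<O>}"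
proof (rule is_idealI)
  have xc: "x \<in> carrier R" using assms O_carrier by blast
  show "{x \<otimes> s | s. s \<in> \<O>} \<subseteq> \<O>" using assms O_facts(6) by blast
  have "\<zero> = x \<otimes> \<zero>" using xc by simp
  then show "\<zero> \<in> {x \<otimes> s | s. s \<in> \<O>}" using O_facts(2) by blast
  fix i assume "i \<in> {x \<otimes> s | s. s \<in> \<O>}"
  then obtain s where s: "i = x \<otimes> s" "s \<in> \<O>" by blast
  {
    fix j assume "j \<in> {x \<otimes> s | s. s \<in> \<O>}"
    then obtain t where t: "j = x \<otimes> t" "t \<in> \<O>" by blast
    have "i \<oplus> j = x \<otimes> (s \<oplus> t)" using s t xc O_carrier by (simp add: r_distr)
    then show "i \<oplus> j \<in> {x \<otimes> s | s. s \<in> \<O>}" using s t O_facts(7) by blast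
  }
  fix r assume r: "r \<in> \<O>"
  then have "r \<otimes> i = x \<otimes> (r \<otimes> s)" using s xc O_carrier by (simp add: m_lcomm)
  then show "r \<otimes> i \<in> {x \<otimes> s | s. s \<in> \<O>}" using r s O_facts(6) by blast
qed

lemma is_ideal_adjoin:
  assumes I: "is_ideal I" and a: "a \<in> \<O>"
  shows "is_ideal {i \<oplus> a \<otimes> s | i s. i \<in> I \<and> s \<in> \<O>}" (is "is_ideal ?J")
    and "I \<subseteq> {i \<oplus> a \<otimes> s | i s. i \<in> I \<and> s \<in> \<O>}" "a \<in> {i \<oplus> a \<otimes> s | i s. i \<in> I \<and> s \<in> \<O>}"
proof -
  note f = is_idealD[OF I]
  have ac: "a \<in> carrier R" using a O_carrier by blast
  have "?J \<subseteq> \<O>" using f(2) a O_facts(6,7) by (auto simp: subset_iff)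
  moreover have "r \<otimes> j \<in> ?J" if r: "r \<in> \<O>" and j: "j \<in> ?J" for r j
  proof -
    obtain i s where s: "i \<in> I" "s \<in> \<O>" "j = i \<oplus> a \<otimes> s" using j by blast
    have "r \<otimes> j = r \<otimes> i \<oplus> a \<otimes> (r \<otimes> s)"
      using s f(4) r ac O_carrier by (simp add: r_distr m_lcomm)
    then show ?thesis using f(3)[OF r s(1)] O_facts(6)[OF r s(2)] by blast
  qed
  moreover have "additive_subgroup ?J R"
    by (rule additive_subgroup_add_image[OF f(1) subring_additive_subgroup[OF subring_O] ac])
  ultimately show "is_ideal ?J" unfolding is_ideal_def by blast
  have "i = i \<oplus> a \<otimes> \<zero>" if "i \<in> I" for i using that f(4) ac by simp
  then show "I \<subseteq> ?J" using O_facts(2) by blast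
  have "a = \<zero> \<oplus> a \<otimes> \<one>" using ac by simp
  then show "a \<in> ?J" using f(5) O_facts(3) by blast
qed

lemma is_ideal_colon:
  assumes I: "is_ideal I" and c: "c \<in> \<O>"
  shows "is_ideal {y \<in> \<O>. y \<otimes> c \<in> I}" "I \<subseteq> {y \<in> \<O>. y \<otimes> c \<in> I}"
proof -
  note f = is_idealD[OF I]
  have cc: "c \<in> carrier R" using c O_carrier by blast
  show "is_ideal {y \<in> \<O>. y \<otimes> c \<in> I}"
  proof (rule is_idealI)
    fix r i assume ri: "r \<in> \<O>" "i \<in> {y \<in> \<O>. y \<otimes> c \<in> I}"
    then have "r \<otimes> i \<otimes> c = r \<otimes> (i \<otimes> c)" using cc O_carrier by (simp add: m_assoc)
    then show "r \<otimes> i \<in> {y \<in> \<O>. y \<otimes> c \<in> I}" using ri f(3) O_facts(6) by simp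
  qed (use f cc O_carrier O_facts in \<open>auto simp: l_distr\<close>)
  show "I \<subseteq> {y \<in> \<O>. y \<otimes> c \<in> I}"
    using f(2,3) c cc f(4) by (auto simp: m_comm[of _ c])
qed

text \<open>The powers of g have the common denominator x, so the spans of
  \<open>1, ..., g^n\<close> over O, multiplied by x, are ideals of O containing x. There are
  finitely many such ideals, so the ascending chain stops and g satisfies a monic equation.\<close>

lemma almost_integral:
  assumes x: "x \<in> \<O>" "x \<noteq> \<zero>" and g: "g \<in> E" and pow: "\<And>m::nat. x \<otimes> g [^] m \<in> \<O>"
  shows "g \<in> \<O>"
proof -
  have gc: "g \<in> carrier R" using g subringE(1)[OF subring_E] by blast
  have xc: "x \<in> carrier R" using x O_carrier by blast
  note ev = additive_subgroup_evals'[OF subring_O gc]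
  note evf = additive_subgroup_facts[OF ev]
  define I where "I n = (\<otimes>) x ` evals \<O> g (Suc n)" for n
  have IO: "x \<otimes> y \<in> \<O>" if "y \<in> evals \<O> g n" for y n
    using that
  proof (induction n arbitrary: y)
    case 0
    then show ?case using xc O_facts by (simp add: evals_0)
  next
    case (Suc n)
    then obtain a b where y: "a \<in> evals \<O> g n" "b \<in> \<O>" "y = a \<oplus> g [^] n \<otimes> b"
      using evals_Suc[OF O_facts(1) gc] by blast
    have "x \<otimes> y = x \<otimes> a \<oplus> (x \<otimes> g [^] n) \<otimes> b"
      using y evf(5)[OF y(1)] xc gc O_carrier[OF y(2)] by (simp add: r_distr m_assoc)
    then show ?case using Suc.IH[OF y(1)] pow y(2) O_facts(6,7) by simp
  qed
  have I_ideal: "is_ideal (I n)" for n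
  proof (rule is_idealI)
    show "I n \<subseteq> \<O>" unfolding I_def using IO by blast
    have "x \<otimes> \<zero> = \<zero>" using xc by simp
    then show "\<zero> \<in> I n" unfolding I_def using evf(1) by (metis imageI)
    fix i assume "i \<in> I n"
    then obtain y where y: "y \<in> evals \<O> g (Suc n)" "i = x \<otimes> y" unfolding I_def by blast
    {
      fix j assume "j \<in> I n"
      then obtain z where z: "z \<in> evals \<O> g (Suc n)" "j = x \<otimes> z" unfolding I_def by blast
      have "i \<oplus> j = x \<otimes> (y \<oplus> z)" unfolding y z using evf(5)[OF y(1)] evf(5)[OF z(1)] xc by (simp add: r_distr)
      then show "i \<oplus> j \<in> I n" unfolding I_def using evf(2)[OF y(1) z(1)] by simp
    }
    fix r assume r: "r \<in> \<O>"
    then have "r \<otimes> i = x \<otimes> (y \<otimes> r)" unfolding y using evf(5)[OF y(1)] xc O_carrier by (simp add: m_ac)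
    then show "r \<otimes> i \<in> I n" unfolding I_def using evals_smult[OF subring_O gc r y(1)] by simp
  qed
  have one: "\<one> \<in> evals \<O> g (Suc n)" for n
  proof (induction n)
    case 0
    have "eval [\<one>] g = \<one>" using gc by simp
    then show ?case using O_facts(3) by (intro evalsI[of "[\<one>]"]) auto
  next
    case (Suc n)
    then show ?case using evals_subset_Suc[OF subring_O gc] by blast
  qed
  have "x \<in> I n" for n unfolding I_def using one xc by (metis imageI r_one)
  then have "range I \<subseteq> {I. is_ideal I \<and> x \<in> I}" using I_ideal by auto
  then have "finite (range I)" using finite_ideals_containing[OF x] finite_subset by blast
  moreover have "I n \<subseteq> I (Suc n)" for n
    unfolding I_def using evals_subset_Suc[OF subring_O gc] by blast
  ultimately obtain n where n: "I (Suc n) = I n"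
    using ascending_chain_stabilises[of I] by (metis le_SucI order_refl)
  have "\<zero> \<oplus> g [^] Suc n \<otimes> \<one> \<in> evals \<O> g (Suc (Suc n))"
    using evals_Suc[OF O_facts(1) gc, of "Suc n"] evf(1) O_facts(3) by blast
  then have "g [^] Suc n \<in> evals \<O> g (Suc (Suc n))" using gc by simp
  then have "x \<otimes> g [^] Suc n \<in> I n" unfolding n[symmetric] unfolding I_def by blast
  then obtain y where y: "y \<in> evals \<O> g (Suc n)" "x \<otimes> g [^] Suc n = x \<otimes> y" unfolding I_def by blast
  then have "g [^] Suc n = y"
    using m_lcancel[OF x(2) xc _ evf(5)[OF y(1)], of "g [^] Suc n"] gc by simp
  then have "integral_over R \<O> g" using integral_over_iff_evals[OF subring_O] y(1) gc by blast
  then show ?thesis using integral_over_O g by blast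
qed

text \<open>Stability gives that all products \<open>x g^m\<close> lie in I and hence are integral,
  so x is a common denominator of the powers of g. The contrapositive is what is used: a nonintegral
  g moves some element of I out of I.\<close>

lemma stable_imp_integral:
  assumes I: "is_ideal I" "x \<in> I" "x \<noteq> \<zero>" and g: "g \<in> E" and st: "\<And>i. i \<in> I \<Longrightarrow> g \<otimes> i \<in> I"
  shows "g \<in> \<O>"
proof (rule almost_integral[OF _ I(3) g])
  show "x \<in> \<O>" using I is_idealD(2) by blast
  have gc: "g \<in> carrier R" using g subringE(1)[OF subring_E] by blast
  have xc: "x \<in> carrier R" using I is_idealD(4) by blast
  fix m :: nat
  have "x \<otimes> g [^] m \<in> I"
  proof (induction m)
    case (Suc m)
    have "x \<otimes> g [^] Suc m = g \<otimes> (x \<otimes> g [^] m)" using gc xc by (simp add: m_ac)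
    then show ?case using st[OF Suc] by simp
  qed (use I xc in simp)
  then show "x \<otimes> g [^] m \<in> \<O>" using is_idealD(2)[OF I(1)] by blast
qed

definition is_prime :: "'a set \<Rightarrow> bool" where
  "is_prime P \<longleftrightarrow> is_ideal P \<and> P \<noteq> {\<zero>} \<and> \<one> \<notin> P \<and> (\<forall>a\<in>\<O>. \<forall>b\<in>\<O>. a \<otimes> b \<in> P \<longrightarrow> a \<in> P \<or> b \<in> P)"

lemma is_primeD:
  assumes "is_prime P"
  shows "is_ideal P" "P \<noteq> {\<zero>}" "\<one> \<notin> P" "\<And>a b. a \<in> \<O> \<Longrightarrow> b \<in> \<O> \<Longrightarrow> a \<otimes> b \<in> P \<Longrightarrow> a \<in> P \<or> b \<in> P"
  using assms unfolding is_prime_def by auto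

lemma is_ideal_nonzero_element:
  "is_ideal I \<Longrightarrow> I \<noteq> {\<zero>} \<Longrightarrow> \<exists>x\<in>I. x \<noteq> \<zero>"
  using is_idealD(5) by blast

text \<open>The residue ring modulo P is finite, so the powers of an element a of I outside P
  repeat: a^i (1 - a^k) lies in P for some k > 0. Primality leaves 1 - a^k in P, while a^k lies in
  I.\<close>

lemma is_prime_maximal:
  assumes P: "is_prime P" and I: "is_ideal I" "P \<subseteq> I" "I \<noteq> P"
  shows "\<one> \<in> I"
proof -
  note Pi = is_primeD[OF P]
  obtain x where x: "x \<in> P" "x \<noteq> \<zero>" using is_ideal_nonzero_element Pi by blast
  have xO: "x \<in> \<O>" using x is_idealD(2)[OF Pi(1)] by blast
  obtain F where F: "finite F" "F \<subseteq> \<O>" "\<forall>r\<in>\<O>. \<exists>f\<in>F. \<exists>s\<in>\<O>. r = f \<oplus> x \<otimes> s"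
    using finite_residues[OF xO x(2)] by (elim exE conjE)
  obtain a where a: "a \<in> I" "a \<notin> P" using I by blast
  then have aO: "a \<in> \<O>" using is_idealD(2)[OF I(1)] by blast
  \<comment> \<open>Residues are taken modulo a nonzero element x of P, where finiteness is
    available; congruence modulo x implies congruence modulo P.\<close>
  define f where "f i = (SOME f. f \<in> F \<and> (\<exists>s\<in>\<O>. a [^] i = f \<oplus> x \<otimes> s))" for i :: nat
  have "\<exists>f. f \<in> F \<and> (\<exists>s\<in>\<O>. a [^] i = f \<oplus> x \<otimes> s)" for i :: nat
    using bspec[OF F(3) pow_O[OF aO, of i]] by (simp add: Bex_def)
  then have f: "f i \<in> F" "\<exists>s\<in>\<O>. a [^] i = f i \<oplus> x \<otimes> s" for i
    unfolding f_def using someI_ex[of "\<lambda>f. f \<in> F \<and> (\<exists>s\<in>\<O>. a [^] i = f \<oplus> x \<otimes> s)"] by simp_all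
  have "\<not> inj f"
    using f(1) F(1) by (meson finite_subset image_subsetI infinite_UNIV_nat finite_imageD)
  then obtain i j where ij: "f i = f j" "i < j" unfolding inj_def by (metis linorder_neqE_nat)
  obtain s t where s: "s \<in> \<O>" "a [^] i = f i \<oplus> x \<otimes> s" and t: "t \<in> \<O>" "a [^] j = f i \<oplus> x \<otimes> t"
    using f(2)[of i] f(2)[of j] ij(1) by auto
  have c: "s \<in> carrier R" "t \<in> carrier R" "f i \<in> carrier R" "x \<in> carrier R" "a \<in> carrier R"
    using s t f(1) F(2) xO aO O_carrier by auto
  define k where "k = j - i"
  have k: "j = i + k" "k > 0" using ij unfolding k_def by auto
  have "a [^] i \<otimes> (\<one> \<ominus> a [^] k) = a [^] i \<ominus> a [^] j"
  proof -
    have "a [^] j = a [^] i \<otimes> a [^] k" unfolding k(1) using c(5) by (simp add: nat_pow_mult)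
    moreover have "a [^] i \<in> carrier R" "a [^] k \<in> carrier R" using c by auto
    ultimately show ?thesis by algebra
  qed
  also have "\<dots> = (s \<ominus> t) \<otimes> x" unfolding s t using c by algebra
  also have "\<dots> \<in> P" using is_idealD(3)[OF Pi(1) O_minus[OF s(1) t(1)] x(1)] .
  finally have "a [^] i \<otimes> (\<one> \<ominus> a [^] k) \<in> P" .
  moreover have "a [^] m \<notin> P" for m :: nat
  proof (induction m)
    case (Suc m)
    then show ?case using Pi(4)[OF pow_O[OF aO, of m] aO] a by auto
  qed (use Pi in simp)
  ultimately have "\<one> \<ominus> a [^] k \<in> P"
    using Pi(4) pow_O[OF aO] O_minus O_facts(3) by blast
  then have 1: "\<one> \<ominus> a [^] k \<in> I" using I by blast
  have "a [^] k = a [^] (k - 1) \<otimes> a" using k(2) by (metis Suc_diff_1 nat_pow_Suc)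
  then have "a [^] k \<in> I" using is_idealD(3)[OF I(1) pow_O[OF aO] a(1)] by simp
  then have "(\<one> \<ominus> a [^] k) \<oplus> a [^] k \<in> I" using is_idealD(6)[OF I(1) 1] by blast
  moreover have "(\<one> \<ominus> a [^] k) \<oplus> a [^] k = \<one>"
  proof -
    have "a [^] k \<in> carrier R" using c by simp
    then show ?thesis by algebra
  qed
  ultimately show ?thesis by simp
qed

text \<open>A maximal counterexample \<open>I\<close> is not prime, so some colon ideal \<open>I : c\<close> contains \<open>I\<close>
  strictly and is contained in \<open>P\<close>; a witness for it, multiplied by \<open>c\<close>, is a witness for \<open>I\<close>.\<close>

lemma prime_annihilates_class:
  assumes P: "is_prime P" and x: "x \<noteq> \<zero>" and I: "is_ideal I" "x \<in> I" "I \<subseteq> P"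
  shows "\<exists>b\<in>\<O>. b \<notin> I \<and> (\<forall>p\<in>P. b \<otimes> p \<in> I)"
proof (rule ccontr)
  assume contra: "\<not> ?thesis"
  note Pi = is_primeD[OF P]
  define S where "S = {I. is_ideal I \<and> x \<in> I \<and> I \<subseteq> P \<and> \<not> (\<exists>b\<in>\<O>. b \<notin> I \<and> (\<forall>p\<in>P. b \<otimes> p \<in> I))}"
  have xO: "x \<in> \<O>" using I is_idealD(2) by blast
  have "finite S" using finite_ideals_containing[OF xO x] by (rule rev_finite_subset) (auto simp: S_def)
  moreover have "I \<in> S" using I contra unfolding S_def by blast
  ultimately obtain M where M: "M \<in> S" and max: "\<And>N. N \<in> S \<Longrightarrow> M \<subseteq> N \<Longrightarrow> M = N"
    using finite_has_maximal[of S] by auto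
  have Mi: "is_ideal M" "x \<in> M" "M \<subseteq> P"
    and Mn: "\<And>b. b \<in> \<O> \<Longrightarrow> (\<And>p. p \<in> P \<Longrightarrow> b \<otimes> p \<in> M) \<Longrightarrow> b \<in> M"
    using M unfolding S_def by auto
  have colon: "{y \<in> \<O>. y \<otimes> c \<in> M} = M" if c: "c \<in> \<O>" "c \<notin> M" and sub: "{y \<in> \<O>. y \<otimes> c \<in> M} \<subseteq> P" for c
  proof -
    define N where "N = {y \<in> \<O>. y \<otimes> c \<in> M}"
    have N: "is_ideal N" "M \<subseteq> N" using is_ideal_colon[OF Mi(1) c(1)] unfolding N_def by auto
    have "N \<in> S"
    proof (rule ccontr)
      assume "N \<notin> S"
      then obtain b where b: "b \<in> \<O>" "b \<notin> N" "\<forall>p\<in>P. b \<otimes> p \<in> N"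
        using N Mi(2) sub unfolding S_def N_def by auto
      have "b \<otimes> c \<in> M"
      proof (rule Mn)
        show "b \<otimes> c \<in> \<O>" using b(1) c(1) O_facts(6) by blast
        fix p assume p: "p \<in> P"
        then have "b \<otimes> p \<otimes> c \<in> M" using b(3) unfolding N_def by blast
        then show "b \<otimes> c \<otimes> p \<in> M"
          using b(1) c(1) p is_idealD(4)[OF Pi(1)] O_carrier by (simp add: m_ac)
      qed
      then show False using b(1,2) unfolding N_def by blast
    qed
    then show ?thesis using max[OF _ N(2)] unfolding N_def by blast
  qed
  have "\<one> \<notin> M" using Mi(3) Pi(3) by blast
  \<comment> \<open>For M = P the element 1 would be a witness.\<close>
  have "M \<noteq> P"
    using Mn[of \<one>] \<open>\<one> \<notin> M\<close> O_facts(3) is_idealD(4)[OF Pi(1)] by auto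
  have "\<not> is_prime M"
    using is_prime_maximal[OF _ Pi(1) Mi(3)] \<open>M \<noteq> P\<close> Pi(3) by blast
  then obtain a b where ab: "a \<in> \<O>" "b \<in> \<O>" "a \<otimes> b \<in> M" "a \<notin> M" "b \<notin> M"
    using Mi(1,2) x \<open>\<one> \<notin> M\<close> unfolding is_prime_def by blast
  have ba: "b \<otimes> a \<in> M" using ab O_carrier by (simp add: m_comm)
  show False
  \<comment> \<open>If (M : a) lies in P, it equals M and yet contains b. Otherwise some t outside P
    kills a modulo M; primality puts (M : t) inside P, so it equals M and yet contains a.\<close>
  proof (cases "{y \<in> \<O>. y \<otimes> a \<in> M} \<subseteq> P")
    case True
    then show False using colon[OF ab(1,4)] ba ab(2,5) by blast
  next
    case False
    then obtain t where t: "t \<in> \<O>" "t \<otimes> a \<in> M" "t \<notin> P" by blast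
    have "{y \<in> \<O>. y \<otimes> t \<in> M} \<subseteq> P" using Pi(4) t(1,3) Mi(3) by blast
    moreover have "t \<notin> M" using t(3) Mi(3) by blast
    moreover have "a \<otimes> t \<in> M" using t ab(1) O_carrier by (simp add: m_comm)
    ultimately show False using colon[OF t(1)] ab(1,4) by blast
  qed
qed

text \<open>An element of P^-1 outside O, obtained as b/x where x is a nonzero element of P and b is
  not in xO but bP is contained in xO.\<close>

lemma prime_inverse_element:
  assumes P: "is_prime P"
  obtains g where "g \<in> E" "g \<notin> \<O>" "\<And>p. p \<in> P \<Longrightarrow> g \<otimes> p \<in> \<O>"
proof -
  note Pi = is_primeD[OF P]
  obtain x where x: "x \<in> P" "x \<noteq> \<zero>" using is_ideal_nonzero_element Pi by blast
  have xO: "x \<in> \<O>" using x is_idealD(2)[OF Pi(1)] by blast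
  then have xc: "x \<in> carrier R" by (rule O_carrier)
  have xU: "x \<in> Units R" using xc x(2) by (simp add: field_Units)
  let ?I = "{x \<otimes> s | s. s \<in> \<O>}"
  have "x = x \<otimes> \<one>" using xc by simp
  then have "x \<in> ?I" using O_facts(3) by blast
  moreover have "?I \<subseteq> P"
  proof
    fix y assume "y \<in> ?I"
    then obtain s where "s \<in> \<O>" "y = x \<otimes> s" by blast
    then show "y \<in> P" using is_idealD(3)[OF Pi(1) _ x(1), of s] xc O_carrier by (simp add: m_comm)
  qed
  ultimately obtain b where b: "b \<in> \<O>" "b \<notin> ?I" "\<And>p. p \<in> P \<Longrightarrow> b \<otimes> p \<in> ?I"
    using prime_annihilates_class[OF P x(2) is_ideal_principal[OF xO]] by blast
  have bc: "b \<in> carrier R" using b(1) O_carrier by blast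
  have ic: "inv x \<in> carrier R" using xU by simp
  show thesis
  proof (rule that[of "b \<otimes> inv x"])
    have "x \<in> E" "b \<in> E" using xO b(1) by (auto simp: \<O>_def)
    then show "b \<otimes> inv x \<in> E"
      using subfield_m_inv(1)[OF subfield_E, of x] x(2) subringE(6)[OF subring_E] by auto
    have "x \<otimes> (b \<otimes> inv x) = b" using xU bc xc ic by (simp add: m_lcomm)
    then show "b \<otimes> inv x \<notin> \<O>" using b(2) by force
    fix p assume p: "p \<in> P"
    then obtain s where s: "s \<in> \<O>" "b \<otimes> p = x \<otimes> s" using b(3) by blast
    have pc: "p \<in> carrier R" using p is_idealD(4)[OF Pi(1)] by blast
    have "b \<otimes> inv x \<otimes> p = inv x \<otimes> (b \<otimes> p)" using bc pc ic by (simp add: m_ac)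
    also have "\<dots> = s" unfolding s(2) using xU xc ic O_carrier[OF s(1)] by (simp add: m_assoc[symmetric])
    finally show "b \<otimes> inv x \<otimes> p \<in> \<O>" using s(1) by simp
  qed
qed

lemma exists_prime_containing:
  assumes A: "is_ideal A" "A \<noteq> {\<zero>}" "\<one> \<notin> A"
  shows "\<exists>P. is_prime P \<and> A \<subseteq> P"
proof -
  obtain x where x: "x \<in> A" "x \<noteq> \<zero>" using is_ideal_nonzero_element A by blast
  have xO: "x \<in> \<O>" using x is_idealD(2)[OF A(1)] by blast
  define S where "S = {I. is_ideal I \<and> A \<subseteq> I \<and> \<one> \<notin> I}"
  have "finite S" using finite_ideals_containing[OF xO x(2)]
    by (rule rev_finite_subset) (use x(1) in \<open>auto simp: S_def\<close>)
  moreover have "A \<in> S" using A unfolding S_def by blast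
  ultimately obtain P where P: "P \<in> S" and max: "\<And>N. N \<in> S \<Longrightarrow> P \<subseteq> N \<Longrightarrow> P = N"
    using finite_has_maximal[of S] by auto
  have Pi: "is_ideal P" "A \<subseteq> P" "\<one> \<notin> P" using P unfolding S_def by auto
  have "a \<in> P \<or> b \<in> P" if ab: "a \<in> \<O>" "b \<in> \<O>" "a \<otimes> b \<in> P" for a b
  proof (rule ccontr)
    assume n: "\<not> (a \<in> P \<or> b \<in> P)"
    define J where "J = {i \<oplus> a \<otimes> s | i s. i \<in> P \<and> s \<in> \<O>}"
    have J: "is_ideal J" "P \<subseteq> J" "a \<in> J" using is_ideal_adjoin[OF Pi(1) ab(1)] unfolding J_def by auto
    then have "\<one> \<in> J" using max[of J] n Pi(2) unfolding S_def by blast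
    then obtain i s where i: "i \<in> P" "s \<in> \<O>" "\<one> = i \<oplus> a \<otimes> s" unfolding J_def by blast
    have c: "i \<in> carrier R" "s \<in> carrier R" "a \<in> carrier R" "b \<in> carrier R"
      using i ab O_carrier is_idealD(4)[OF Pi(1)] by auto
    have "b = b \<otimes> (i \<oplus> a \<otimes> s)" unfolding i(3)[symmetric] using c by simp
    also have "\<dots> = b \<otimes> i \<oplus> s \<otimes> (a \<otimes> b)" using c by algebra
    also have "\<dots> \<in> P" using is_idealD(3,6)[OF Pi(1)] ab i by blast
    finally show False using n by blast
  qed
  then have "is_prime P" unfolding is_prime_def using Pi x by blast
  then show ?thesis using Pi(2) by blast
qed

text \<open>P is not stable under the nonintegral g in P^-1, so P + gP contains 1; explicitly 1 = u
  + gw with u and w in P. The cofactor B is the colon ideal (A : P). It contains A and gA, so a = ua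
  + w(ga) lies in PB, and it is strictly larger than A because A is not stable under g
  either.\<close>

lemma ideal_factor_prime:
  assumes A: "is_ideal A" "A \<noteq> {\<zero>}" "\<one> \<notin> A"
  shows "\<exists>P B. is_prime P \<and> is_ideal B \<and> A \<subset> B \<and> A = ideal_prod R P B"
proof -
  obtain P where P: "is_prime P" "A \<subseteq> P" using exists_prime_containing[OF A] by blast
  note Pi = is_primeD[OF P(1)]
  obtain x where x: "x \<in> A" "x \<noteq> \<zero>" using is_ideal_nonzero_element A by blast
  obtain g where g: "g \<in> E" "g \<notin> \<O>" "\<And>p. p \<in> P \<Longrightarrow> g \<otimes> p \<in> \<O>"
    using prime_inverse_element[OF P(1)] by blast
  have gc: "g \<in> carrier R" using g subringE(1)[OF subring_E] by blast
  note Pc = is_idealD(4)[OF Pi(1)] and Ac = is_idealD(4)[OF A(1)]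
  \<comment> \<open>A nonzero element of A, which also lies in P, feeds the stability criterion for
    P.\<close>
  obtain w0 where w0: "w0 \<in> P" "g \<otimes> w0 \<notin> P"
    using stable_imp_integral[OF Pi(1) _ x(2) g(1)] x(1) P(2) g(2) by blast
  define J where "J = {i \<oplus> (g \<otimes> w0) \<otimes> s | i s. i \<in> P \<and> s \<in> \<O>}"
  have "is_ideal J" "P \<subseteq> J" "g \<otimes> w0 \<in> J"
    using is_ideal_adjoin[OF Pi(1) g(3)[OF w0(1)]] unfolding J_def by auto
  then have "\<one> \<in> J" using is_prime_maximal[OF P(1), of J] w0(2) by blast
  then obtain u s where u: "u \<in> P" "s \<in> \<O>" "\<one> = u \<oplus> (g \<otimes> w0) \<otimes> s" unfolding J_def by blast
  define w where "w = w0 \<otimes> s"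
  have w: "w \<in> P" unfolding w_def using is_idealD(3)[OF Pi(1) u(2) w0(1)] Pc[OF w0(1)] O_carrier[OF u(2)] by (simp add: m_comm)
  have one: "\<one> = u \<oplus> g \<otimes> w"
    unfolding w_def using u Pc w0(1) gc O_carrier by (simp add: m_assoc)
  define B where "B = {y \<in> \<O>. \<forall>p\<in>P. p \<otimes> y \<in> A}"
  have Bi: "is_ideal B"
  proof (rule is_idealI)
    fix r y assume ry: "r \<in> \<O>" "y \<in> B"
    show "r \<otimes> y \<in> B" unfolding B_def
    proof (intro CollectI conjI ballI)
      show "r \<otimes> y \<in> \<O>" using ry O_facts(6) unfolding B_def by blast
      fix p assume p: "p \<in> P"
      then have "r \<otimes> (p \<otimes> y) \<in> A" using ry is_idealD(3)[OF A(1)] unfolding B_def by blast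
      then show "p \<otimes> (r \<otimes> y) \<in> A" using p Pc ry O_carrier unfolding B_def by (simp add: m_lcomm)
    qed
  qed (use is_idealD(5,6)[OF A(1)] Pc O_carrier O_facts in \<open>auto simp: B_def r_distr\<close>)
  have AB: "A \<subseteq> B"
    unfolding B_def using is_idealD(2,3)[OF A(1)] is_idealD(2)[OF Pi(1)] by blast
  have gA: "g \<otimes> a \<in> B" if a: "a \<in> A" for a unfolding B_def
  proof (intro CollectI conjI ballI)
    show "g \<otimes> a \<in> \<O>" using g(3) P(2) a by blast
    fix p assume p: "p \<in> P"
    then have "g \<otimes> p \<otimes> a \<in> A" using is_idealD(3)[OF A(1) g(3)] a by blast
    then show "p \<otimes> (g \<otimes> a) \<in> A" using Pc[OF p] Ac[OF a] gc by (simp add: m_ac)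
  qed
  have "A \<noteq> B" using stable_imp_integral[OF A(1) x g(1)] gA g(2) by blast
  moreover have "A = ideal_prod R P B"
  proof
    show "ideal_prod R P B \<subseteq> A"
    proof
      fix y assume "y \<in> ideal_prod R P B"
      then show "y \<in> A"
        by (induction rule: ideal_prod.induct) (use is_idealD(6)[OF A(1)] in \<open>auto simp: B_def\<close>)
    qed
    show "A \<subseteq> ideal_prod R P B"
    proof
      fix a assume a: "a \<in> A"
      have "a = (u \<oplus> g \<otimes> w) \<otimes> a" unfolding one[symmetric] using Ac[OF a] by simp
      also have "\<dots> = u \<otimes> a \<oplus> w \<otimes> (g \<otimes> a)" using Pc[OF u(1)] Pc[OF w] gc Ac[OF a] by algebra
      also have "\<dots> \<in> ideal_prod R P B"
        using ideal_prod.prod[OF u(1), of a B R] ideal_prod.prod[OF w, of "g \<otimes> a" B R]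
          AB a gA[OF a] by (auto intro: ideal_prod.sum)
      finally show "a \<in> ideal_prod R P B" .
    qed
  qed
  ultimately show ?thesis using P(1) Bi AB by blast
qed

end

section \<open>The ghost ring\<close>

context number_subfield
begin

abbreviation OK where "OK \<equiv> R\<lparr>carrier := \<O>\<rparr>"
abbreviation OL where "OL \<equiv> overring_algebra (R\<lparr>carrier := integers\<rparr>)"
abbreviation ghost where "ghost \<equiv> ghost_algebra OK OL"

definition ideals :: "'a set set" where "ideals = {I. is_ideal I \<and> I \<noteq> {\<zero>}}"

text \<open>Polynomial evaluation and multiples of 1 are the same in E as in R, so integrality over
  the integers does not depend on the field in which it is tested.\<close>

lemma ring_of_integers_subfield: "ring_of_integers (R\<lparr>carrier := E\<rparr>) = OK"
proof -
  let ?E = "R\<lparr>carrier := E\<rparr>"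
  have sub: "subgroup E (add_monoid R)" using subring.axioms(1)[OF subring_E] .
  have "[k] \<cdot>\<^bsub>?E\<^esub> \<one>\<^bsub>?E\<^esub> = [k] \<cdot> \<one>" for k :: int
    using add.int_pow_consistent[OF sub subringE(3)[OF subring_E], of k] by (simp add: add_pow_def)
  then have "{x \<in> carrier ?E. integral_over ?E (range (\<lambda>k::int. [k] \<cdot>\<^bsub>?E\<^esub> \<one>\<^bsub>?E\<^esub>)) x} = \<O>"
    using subringE(1)[OF subring_E]
    unfolding integral_over_def eval_consistent[OF subring_E] \<O>_def integers_def
    by auto
  then show ?thesis unfolding ring_of_integers_def by simp
qed

lemma ring_of_integers_R: "ring_of_integers R = R\<lparr>carrier := integers\<rparr>"
  unfolding ring_of_integers_def integers_def by simp

lemma domain_OK: "domain OK"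
  using subring_is_domain[OF subring_O] .

lemma ideal_OK_iff: "ideal I OK \<longleftrightarrow> is_ideal I"
proof
  assume I: "ideal I OK"
  interpret I: ideal I OK by (rule I)
  show "is_ideal I"
  proof (rule is_idealI)
    show "I \<subseteq> \<O>" using I.a_subset by simp
    show "\<zero> \<in> I" using additive_subgroup.zero_closed[OF I.is_additive_subgroup] by simp
    show "\<And>i j. i \<in> I \<Longrightarrow> j \<in> I \<Longrightarrow> i \<oplus> j \<in> I" using additive_subgroup.a_closed[OF I.is_additive_subgroup] by simp
    show "\<And>r i. r \<in> \<O> \<Longrightarrow> i \<in> I \<Longrightarrow> r \<otimes> i \<in> I" using I.I_l_closed by simp
  qed
next
  assume I: "is_ideal I"
  interpret OK: domain OK by (rule domain_OK)
  note f = is_idealD[OF I]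
  show "ideal I OK"
  proof (rule idealI)
    have "\<ominus>\<^bsub>OK\<^esub> i \<in> I" if i: "i \<in> I" for i
    proof -
      have n: "\<ominus> i \<in> I" using additive_subgroup_neg[OF f(1) i] .
      have "\<ominus>\<^bsub>OK\<^esub> i = \<ominus> i"
        using OK.minus_equality[of "\<ominus> i" i] l_neg[OF f(4)[OF i]] subsetD[OF f(2) n] subsetD[OF f(2) i]
        by simp
      then show ?thesis using n by simp
    qed
    then show "subgroup I (add_monoid OK)"
      using f by (intro OK.add.subgroupI) auto
  next
    fix a x assume ax: "a \<in> I" "x \<in> carrier OK"
    then show 1: "x \<otimes>\<^bsub>OK\<^esub> a \<in> I" using f(3) by simp
    have "a \<otimes> x = x \<otimes> a" using ax f(4) O_carrier by (simp add: m_comm)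
    then show "a \<otimes>\<^bsub>OK\<^esub> x \<in> I" using 1 by simp
  qed (rule OK.ring_axioms)
qed

lemma nonzero_ideals_OK: "nonzero_ideals OK = ideals"
  unfolding nonzero_ideals_def ideals_def ideal_OK_iff by simp

lemma nonzero_primes_OK: "nonzero_primes OK = {P. is_prime P}"
proof -
  interpret OK: domain OK by (rule domain_OK)
  have "primeideal P OK \<longleftrightarrow> is_ideal P \<and> \<one> \<notin> P \<and> (\<forall>a\<in>\<O>. \<forall>b\<in>\<O>. a \<otimes> b \<in> P \<longrightarrow> a \<in> P \<or> b \<in> P)" for P
  proof -
    have "is_ideal P \<Longrightarrow> \<O> \<noteq> P \<longleftrightarrow> \<one> \<notin> P" using is_ideal_one O_facts(3) by blast
    then show ?thesis
      using ideal_OK_iff[of P] OK.is_cring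
      unfolding primeideal_def primeideal_axioms_def by auto
  qed
  then show ?thesis unfolding nonzero_primes_def is_prime_def by auto
qed

lemma ideal_prod_OK: "ideal_prod OK I J = ideal_prod R I J"
proof
  show "ideal_prod OK I J \<subseteq> ideal_prod R I J"
  proof
    fix x assume "x \<in> ideal_prod OK I J"
    then show "x \<in> ideal_prod R I J"
      by (induction rule: ideal_prod.induct) (auto intro: ideal_prod.intros)
  qed
  show "ideal_prod R I J \<subseteq> ideal_prod OK I J"
  proof
    fix x assume "x \<in> ideal_prod R I J"
    then show "x \<in> ideal_prod OK I J"
    proof (induction rule: ideal_prod.induct)
      case (prod i j)
      then show ?case using ideal_prod.prod[of i I j J OK] by simp
    next
      case (sum s t)
      then show ?case using ideal_prod.sum[of s OK I J t] by simp
    qed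
  qed
qed

lemma O_mem_ideals: "\<O> \<in> ideals"
  unfolding ideals_def using is_ideal_O O_facts(3) by auto

lemma is_ideal_prod: "is_ideal I \<Longrightarrow> is_ideal J \<Longrightarrow> is_ideal (ideal_prod R I J)"
  using ring.ideal_prod_is_ideal[of OK I J] cring.axioms(1)[OF domain.axioms(1)[OF domain_OK]]
  by (simp add: ideal_OK_iff ideal_prod_OK)

lemma ideal_prod_mem_ideals:
  assumes "I \<in> ideals" "J \<in> ideals"
  shows "ideal_prod R I J \<in> ideals"
proof -
  have IJ: "is_ideal I" "is_ideal J" using assms unfolding ideals_def by auto
  obtain x y where xy: "x \<in> I" "x \<noteq> \<zero>" "y \<in> J" "y \<noteq> \<zero>"
    using is_ideal_nonzero_element assms unfolding ideals_def by blast
  then have "x \<otimes> y \<noteq> \<zero>" using integral is_idealD(4) IJ by blast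
  moreover have "x \<otimes> y \<in> ideal_prod R I J" using xy by (intro ideal_prod.prod)
  ultimately show ?thesis using is_ideal_prod[OF IJ] unfolding ideals_def by blast
qed

lemma is_prime_mem_ideals: "is_prime P \<Longrightarrow> P \<in> ideals"
  unfolding ideals_def is_prime_def by blast

lemma ideal_prod_left_commute:
  assumes "is_ideal I" "is_ideal J" "is_ideal A"
  shows "ideal_prod R I (ideal_prod R J A) = ideal_prod R J (ideal_prod R I A)"
proof -
  interpret OK: domain OK by (rule domain_OK)
  note assms' = assms[folded ideal_OK_iff]
  show ?thesis
    using OK.ideal_prod_assoc[OF assms'] OK.ideal_prod_assoc[OF assms'(2,1,3)]
      OK.ideal_prod_commute[OF assms'(1,2)]
    by (simp add: ideal_prod_OK)
qed

text \<open>Splitting off a prime enlarges the ideal. All ideals in question contain a fixed nonzero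
  x, so the number of ideals strictly above decreases and the process ends at the unit
  ideal.\<close>

lemma ideal_prime_factorization:
  assumes "A \<in> ideals"
  shows "\<exists>w. set w \<subseteq> {P. is_prime P} \<and> A = word_ideal OK w"
proof -
  have A: "is_ideal A" "A \<noteq> {\<zero>}" using assms unfolding ideals_def by auto
  then obtain x where x: "x \<in> A" "x \<noteq> \<zero>" using is_ideal_nonzero_element by blast
  have xO: "x \<in> \<O>" using x is_idealD(2)[OF A(1)] by blast
  let ?S = "\<lambda>A. {I. is_ideal I \<and> A \<subset> I}"
  have fin: "finite (?S A)" if "x \<in> A" for A
    by (rule rev_finite_subset[OF finite_ideals_containing[OF xO x(2)]]) (use that in blast)
  have "\<exists>w. set w \<subseteq> {P. is_prime P} \<and> A = word_ideal OK w" if "is_ideal A" "x \<in> A" for A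
    using that
  proof (induction "card (?S A)" arbitrary: A rule: less_induct)
    case less
    show ?case
    proof (cases "\<one> \<in> A")
      case True
      then have "A = \<O>" using less is_ideal_one by blast
      then show ?thesis by (intro exI[of _ "[]"]) (simp add: word_ideal_def)
    next
      case False
      moreover have "A \<noteq> {\<zero>}" using less.prems(2) x(2) by blast
      ultimately obtain P B where B: "is_prime P" "is_ideal B" "A \<subset> B" "A = ideal_prod R P B"
        using ideal_factor_prime[OF less.prems(1)] by blast
      have "?S B \<subset> ?S A" using B by blast
      then have "card (?S B) < card (?S A)" by (rule psubset_card_mono[OF fin[OF less.prems(2)]])
      then obtain w where w: "set w \<subseteq> {P. is_prime P}" "B = word_ideal OK w"
        using less.hyps[of B] B less.prems by blast
      then have "A = word_ideal OK (P # w)" using B(4) by (simp add: word_ideal_def ideal_prod_OK)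
      then show ?thesis using w(1) B(1) by (intro exI[of _ "P # w"]) simp
    qed
  qed
  then show ?thesis using A(1) x(1) by blast
qed

section \<open>Componentwise computation in the ghost ring, and integrality of vectors\<close>

lemma ghost_simps:
  "carrier ghost = ideals \<rightarrow>\<^sub>E integers"
  "x \<otimes>\<^bsub>ghost\<^esub> y = (\<lambda>i\<in>ideals. x i \<otimes> y i)"
  "\<one>\<^bsub>ghost\<^esub> = (\<lambda>i\<in>ideals. \<one>)" "\<zero>\<^bsub>ghost\<^esub> = (\<lambda>i\<in>ideals. \<zero>)"
  "x \<oplus>\<^bsub>ghost\<^esub> y = (\<lambda>i\<in>ideals. x i \<oplus> y i)"
  "r \<odot>\<^bsub>ghost\<^esub> x = (\<lambda>i\<in>ideals. r \<otimes> x i)"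
  unfolding ghost_algebra_def nonzero_ideals_OK power_algebra_def overring_algebra_def by simp_all

lemmas integers_facts = subringE[OF subring_integers]

lemma integers_carrier: "x \<in> integers \<Longrightarrow> x \<in> carrier R"
  using integers_facts(1) by blast

lemma ghost_ring: "ring ghost"
proof (rule ringI)
  have mem: "x i \<in> carrier R" if "x \<in> ideals \<rightarrow>\<^sub>E integers" "i \<in> ideals" for x i
    using that integers_carrier by blast
  have memi: "x i \<in> integers" if "x \<in> ideals \<rightarrow>\<^sub>E integers" "i \<in> ideals" for x i
    using that by blast
  show "abelian_group ghost"
  proof (rule abelian_groupI, unfold ghost_simps)
    fix x assume x: "x \<in> ideals \<rightarrow>\<^sub>E integers"
    have "(\<lambda>i\<in>ideals. \<ominus> x i) \<in> ideals \<rightarrow>\<^sub>E integers" using x integers_facts(5) by auto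
    moreover have "(\<lambda>i\<in>ideals. (\<lambda>i\<in>ideals. \<ominus> x i) i \<oplus> x i) = (\<lambda>i\<in>ideals. \<zero>)"
      using mem[OF x] by (intro restrict_ext) (simp add: l_neg)
    ultimately show "\<exists>y\<in>ideals \<rightarrow>\<^sub>E integers. (\<lambda>i\<in>ideals. y i \<oplus> x i) = (\<lambda>i\<in>ideals. \<zero>)" by blast
    show "(\<lambda>i\<in>ideals. (\<lambda>i\<in>ideals. \<zero>) i \<oplus> x i) = x"
      using x mem[OF x] by (intro extensionalityI[of _ ideals]) (auto simp: PiE_def)
  qed (use mem memi integers_facts(2,7) in \<open>auto intro!: restrict_ext simp: a_ac restrict_PiE_iff\<close>)
  show "monoid ghost"
  proof (rule monoidI, unfold ghost_simps)
    fix x assume x: "x \<in> ideals \<rightarrow>\<^sub>E integers"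
    show "(\<lambda>i\<in>ideals. (\<lambda>i\<in>ideals. \<one>) i \<otimes> x i) = x" "(\<lambda>i\<in>ideals. x i \<otimes> (\<lambda>i\<in>ideals. \<one>) i) = x"
      using x mem[OF x] by (intro extensionalityI[of _ ideals]; auto simp: PiE_def)+
  qed (use mem memi integers_facts(3,6) in \<open>auto intro!: restrict_ext simp: m_assoc restrict_PiE_iff\<close>)
  fix x y z assume "x \<in> carrier ghost" "y \<in> carrier ghost" "z \<in> carrier ghost"
  then have "x \<in> ideals \<rightarrow>\<^sub>E integers" "y \<in> ideals \<rightarrow>\<^sub>E integers" "z \<in> ideals \<rightarrow>\<^sub>E integers"
    by (simp_all only: ghost_simps)
  note c = mem[OF this(1)] mem[OF this(2)] mem[OF this(3)]
  show "(x \<oplus>\<^bsub>ghost\<^esub> y) \<otimes>\<^bsub>ghost\<^esub> z = x \<otimes>\<^bsub>ghost\<^esub> z \<oplus>\<^bsub>ghost\<^esub> y \<otimes>\<^bsub>ghost\<^esub> z"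
    unfolding ghost_simps using c by (intro restrict_ext) (simp add: l_distr)
  show "z \<otimes>\<^bsub>ghost\<^esub> (x \<oplus>\<^bsub>ghost\<^esub> y) = z \<otimes>\<^bsub>ghost\<^esub> x \<oplus>\<^bsub>ghost\<^esub> z \<otimes>\<^bsub>ghost\<^esub> y"
    unfolding ghost_simps using c by (intro restrict_ext) (simp add: r_distr)
qed

lemma ghost_mem: "x \<in> carrier ghost \<Longrightarrow> i \<in> ideals \<Longrightarrow> x i \<in> integers"
  by (auto simp: ghost_simps)

lemma ghost_mem_carrier: "x \<in> carrier ghost \<Longrightarrow> i \<in> ideals \<Longrightarrow> x i \<in> carrier R"
  using ghost_mem integers_carrier by blast

lemma ghost_pow: "x \<in> carrier ghost \<Longrightarrow> i \<in> ideals \<Longrightarrow> (x [^]\<^bsub>ghost\<^esub> (n::nat)) i = x i [^] n"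
  by (induction n) (simp_all add: ghost_simps nat_pow_def)

lemma ghost_minus:
  assumes "x \<in> carrier ghost" "y \<in> carrier ghost" "i \<in> ideals"
  shows "(x \<ominus>\<^bsub>ghost\<^esub> y) i = x i \<ominus> y i"
proof -
  interpret G: ring ghost by (rule ghost_ring)
  have "(\<lambda>i\<in>ideals. \<ominus> y i) \<in> carrier ghost"
    using assms(2) integers_facts(5) by (auto simp: ghost_simps)
  moreover have "(\<lambda>i\<in>ideals. \<ominus> y i) \<oplus>\<^bsub>ghost\<^esub> y = \<zero>\<^bsub>ghost\<^esub>"
    unfolding ghost_simps using ghost_mem_carrier[OF assms(2)] by (intro restrict_ext) (simp add: l_neg)
  ultimately have "\<ominus>\<^bsub>ghost\<^esub> y = (\<lambda>i\<in>ideals. \<ominus> y i)"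
    using G.minus_equality assms(2) by blast
  then show ?thesis using assms(3) by (simp add: G.minus_eq ghost_simps a_minus_def)
qed

lemma ghost_eval:
  assumes "set p \<subseteq> carrier ghost" "x \<in> carrier ghost" "i \<in> ideals"
  shows "ring.eval ghost p x i = eval (map (\<lambda>a. a i) p) (x i)"
  using assms(1)
proof (induction p)
  case Nil
  then show ?case using assms(3) by (simp add: ring.eval.simps(1)[OF ghost_ring] ghost_simps)
next
  case (Cons a p)
  then show ?case
    using assms(2,3) ghost_pow[OF assms(2,3)]
    by (simp add: ring.eval.simps(2)[OF ghost_ring] ghost_simps(2,5))
qed

lemma ghost_scalars:
  "(\<lambda>r. r \<odot>\<^bsub>ghost\<^esub> \<one>\<^bsub>ghost\<^esub>) ` carrier OK = (\<lambda>r. \<lambda>i\<in>ideals. r) ` \<O>"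
proof -
  have "r \<odot>\<^bsub>ghost\<^esub> \<one>\<^bsub>ghost\<^esub> = (\<lambda>i\<in>ideals. r)" if "r \<in> \<O>" for r
    unfolding ghost_simps using that O_carrier by (intro restrict_ext) simp
  then show ?thesis by auto
qed

lemma ghost_const: "r \<in> \<O> \<Longrightarrow> (\<lambda>i\<in>ideals. r) \<in> carrier ghost"
  unfolding ghost_simps by (simp add: \<O>_def restrict_PiE_iff)

text \<open>Scalars are constant vectors, so an integral equation of a vector amounts to a single
  monic polynomial over O that vanishes at every component.\<close>

lemma integral_element_ghost_iff:
  assumes x: "x \<in> carrier ghost"
  shows "integral_element OK ghost x \<longleftrightarrow>
    (\<exists>p. set p \<subseteq> \<O> \<and> p \<noteq> [] \<and> hd p = \<one> \<and> (\<forall>i\<in>ideals. eval p (x i) = \<zero>))"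
proof
  assume "integral_element OK ghost x"
  then obtain p where p: "p \<in> lists ((\<lambda>r. \<lambda>i\<in>ideals. r) ` \<O>)" "p \<noteq> []" "hd p = \<one>\<^bsub>ghost\<^esub>"
    "ring.eval ghost p x = \<zero>\<^bsub>ghost\<^esub>"
    unfolding integral_element_def ghost_scalars integral_over_def by blast
  \<comment> \<open>The coefficients are constant vectors and are read off at the unit ideal, which
    is one of the indices.\<close>
  define q where "q = map (\<lambda>a. a \<O>) p"
  have const: "map (\<lambda>a. a i) p = q" if "i \<in> ideals" for i
    unfolding q_def using p(1) that O_mem_ideals by auto
  have pG: "set p \<subseteq> carrier ghost"
    using p(1) ghost_const by auto
  have "eval q (x i) = \<zero>" if "i \<in> ideals" for i
    using ghost_eval[OF pG x that] p(4) that unfolding const[OF that] by (simp add: ghost_simps)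
  moreover have "set q \<subseteq> \<O>" unfolding q_def using p(1) O_mem_ideals by auto
  moreover have "hd q = \<one>" unfolding q_def using p(2,3) O_mem_ideals by (simp add: hd_map ghost_simps)
  ultimately show "\<exists>p. set p \<subseteq> \<O> \<and> p \<noteq> [] \<and> hd p = \<one> \<and> (\<forall>i\<in>ideals. eval p (x i) = \<zero>)"
    using p(2) unfolding q_def by blast
next
  assume "\<exists>p. set p \<subseteq> \<O> \<and> p \<noteq> [] \<and> hd p = \<one> \<and> (\<forall>i\<in>ideals. eval p (x i) = \<zero>)"
  then obtain p where p: "set p \<subseteq> \<O>" "p \<noteq> []" "hd p = \<one>" "\<And>i. i \<in> ideals \<Longrightarrow> eval p (x i) = \<zero>" by blast
  define q where "q = map (\<lambda>r. \<lambda>i\<in>ideals. r) p"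
  have "q \<in> lists ((\<lambda>r. \<lambda>i\<in>ideals. r) ` \<O>)" unfolding q_def using p(1) by (auto simp: subset_iff)
  moreover have "q \<noteq> []" "hd q = \<one>\<^bsub>ghost\<^esub>" unfolding q_def using p(2,3) by (simp_all add: hd_map ghost_simps)
  moreover have "ring.eval ghost q x = \<zero>\<^bsub>ghost\<^esub>"
  proof (rule extensionalityI[of _ ideals])
    interpret G: ring ghost by (rule ghost_ring)
    have qG: "set q \<subseteq> carrier ghost" unfolding q_def using p(1) ghost_const by auto
    show "ring.eval ghost q x \<in> extensional ideals"
      using G.eval_in_carrier[OF qG x] by (simp add: ghost_simps PiE_def)
    fix i assume i: "i \<in> ideals"
    have "map (\<lambda>a. a i) q = p" unfolding q_def using i by (simp add: map_idI)
    then show "ring.eval ghost q x i = \<zero>\<^bsub>ghost\<^esub> i"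
      using ghost_eval[OF qG x i] p(4)[OF i] i by (simp add: ghost_simps)
  qed (simp add: ghost_simps)
  ultimately show "integral_element OK ghost x"
    unfolding integral_element_def ghost_scalars integral_over_def using x by blast
qed

text \<open>The product of monic integral equations of the single elements; its coefficients are
  integers, which lie in every subring.\<close>

lemma common_monic_annihilator:
  assumes "finite V" "V \<subseteq> integers"
  shows "\<exists>p. set p \<subseteq> int_img \<and> p \<noteq> [] \<and> hd p = \<one> \<and> (\<forall>v\<in>V. eval p v = \<zero>)"
  using assms
proof (induction V)
  case empty
  then show ?case using subringE(3)[OF subring_int_img] by (intro exI[of _ "[\<one>]"]) simp
next
  case (insert v V)
  then obtain p where p: "set p \<subseteq> int_img" "p \<noteq> []" "hd p = \<one>" "\<forall>v\<in>V. eval p v = \<zero>" by auto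
  have "\<exists>q. set q \<subseteq> int_img \<and> q \<noteq> [] \<and> hd q = \<one> \<and> eval q v = \<zero>"
    using insert.prems unfolding integers_def integral_over_def lists_eq_set by blast
  then obtain q where q: "set q \<subseteq> int_img" "q \<noteq> []" "hd q = \<one>" "eval q v = \<zero>"
    by (elim exE conjE)
  have c: "int_img \<subseteq> carrier R" using subringE(1)[OF subring_int_img] .
  have pq: "polynomial int_img p" "polynomial int_img q" using p q by (auto simp: polynomial_def)
  have "poly_mult p q \<noteq> []"
    using poly_mult_integral[OF subring_int_img pq] p(2) q(2) by blast
  moreover have "hd (poly_mult p q) = \<one>"
    using poly_mult_lead_coeff[OF subring_int_img pq p(2) q(2)] p(3) q(3) by simp
  moreover have "set (poly_mult p q) \<subseteq> int_img"
    using poly_mult_is_polynomial[OF subring_int_img] pq p(1) q(1) polynomial_incl by blast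
  moreover have "eval (poly_mult p q) u = \<zero>" if u: "u \<in> insert v V" for u
  proof -
    have uc: "u \<in> carrier R" using u insert.prems integers_carrier by blast
    have "set p \<subseteq> carrier R" "set q \<subseteq> carrier R" using p(1) q(1) c by auto
    moreover from this have "eval p u \<in> carrier R" "eval q u \<in> carrier R" using eval_in_carrier uc by auto
    ultimately show ?thesis using eval_poly_mult[of p q u] uc u p(4) q(4) by auto
  qed
  ultimately show ?case by blast
qed

lemma finitely_many_values_imp_integral:
  assumes x: "x \<in> carrier ghost" and fin: "finite (x ` ideals)"
  shows "integral_element OK ghost x"
proof -
  have "x ` ideals \<subseteq> integers" using ghost_mem[OF x] by blast
  then obtain p where p: "set p \<subseteq> int_img" "p \<noteq> []" "hd p = \<one>" "\<forall>v\<in>x ` ideals. eval p v = \<zero>"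
    using common_monic_annihilator[OF fin] by blast
  then show ?thesis unfolding integral_element_ghost_iff[OF x]
    using int_img_subset_subring[OF subring_O] by blast
qed

lemma integral_imp_finitely_many_values:
  assumes x: "x \<in> carrier ghost" and int: "integral_element OK ghost x"
  shows "finite (x ` ideals)"
proof -
  obtain p where p: "set p \<subseteq> \<O>" "p \<noteq> []" "hd p = \<one>" "\<And>i. i \<in> ideals \<Longrightarrow> eval p (x i) = \<zero>"
    using int integral_element_ghost_iff[OF x] by blast
  have "p \<in> carrier (poly_ring R)"
    using p O_facts(1) by (auto simp: univ_poly_carrier[symmetric] polynomial_def)
  then have "finite {v. is_root p v}" by (rule finite_number_of_roots)
  moreover have "x ` ideals \<subseteq> {v. is_root p v}"
    unfolding is_root_def using p(2,4) ghost_mem_carrier[OF x] by blast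
  ultimately show ?thesis by (rule finite_subset[rotated])
qed

lemma automatic_imp_integral:
  assumes x: "x \<in> carrier ghost" and aut: "automatic OK OL x"
  shows "integral_element OK ghost x"
proof (rule finitely_many_values_imp_integral[OF x])
  obtain S \<delta> s0 and \<tau> :: "nat \<Rightarrow> 'a" where d: "dfao (nonzero_primes OK) (carrier OL) S \<delta> s0 \<tau>"
    and out: "\<forall>w\<in>lists (nonzero_primes OK). x (word_ideal OK w) = \<tau> (foldl \<delta> s0 w)"
    using aut unfolding automatic_def by blast
  interpret dfao "nonzero_primes OK" "carrier OL" S \<delta> s0 \<tau> by (rule d)
  have "foldl \<delta> s w \<in> S" if "s \<in> S" "set w \<subseteq> nonzero_primes OK" for s w
    using that by (induction w arbitrary: s) (auto intro: trans_closed)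
  moreover have "\<exists>w. set w \<subseteq> nonzero_primes OK \<and> i = word_ideal OK w" if "i \<in> ideals" for i
    using ideal_prime_factorization[OF that] unfolding nonzero_primes_OK .
  ultimately have "x ` ideals \<subseteq> \<tau> ` S" using out init_state by (fastforce simp: in_lists_conv_set)
  then show "finite (x ` ideals)" using finite_states finite_surj by blast
qed

end

section \<open>Eventual periodicity of shifts\<close>

text \<open>The cycle length is at most \<open>card Q\<close> and therefore divides
  \<open>fact (card Q)\<close>. Preperiod and period thus depend on Q only, and one choice serves a
  whole family of sequences.\<close>

lemma deterministic_sequence_periodic:
  fixes z :: "nat \<Rightarrow> 'b"
  assumes fin: "finite Q" and z: "\<And>n. z n \<in> Q"
    and det: "\<And>i j. z i = z j \<Longrightarrow> z (Suc i) = z (Suc j)"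
    and k: "card Q \<le> k"
  shows "z (k + fact (card Q)) = z k"
proof -
  have "\<not> inj_on z {0..card Q}"
    using card_inj_on_le[of z "{0..card Q}" Q] fin z by auto
  then obtain i j where ij: "i < j" "j \<le> card Q" "z i = z j"
    unfolding inj_on_def by (metis atLeastAtMost_iff linorder_neqE_nat)
  define p where "p = j - i"
  have j: "j = i + p" "p > 0" using ij unfolding p_def by auto
  have "z (i + t) = z (j + t)" for t
  proof (induction t)
    case (Suc t)
    then show ?case using det[OF Suc] by simp
  qed (use ij(3) in simp)
  note shift = this
  have step: "z (m + p) = z m" if m: "m \<ge> i" for m
  proof -
    obtain t where "m = i + t" using le_Suc_ex[OF m] by blast
    then show ?thesis using shift[of t] j(1) by (simp add: ac_simps)
  qed
  have mult: "z (m + c * p) = z m" if "m \<ge> i" for m c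
  proof (induction c)
    case (Suc c)
    have "z (m + Suc c * p) = z ((m + c * p) + p)" by (simp add: algebra_simps)
    then show ?case using step[of "m + c * p"] that Suc by simp
  qed simp
  have "p dvd fact (card Q)" using dvd_fact[of p "card Q"] j ij by simp
  then obtain c where "fact (card Q) = p * c" by (rule dvdE)
  then show ?thesis using mult[of k c] k ij by (simp add: mult.commute)
qed

text \<open>By commutation a word in the maps can be sorted as a power of \<open>f p\<close> times a
  word in the others. Periodicity is assumed at x alone: the power is moved inside to act on x,
  shortened there, and moved out again.\<close>

lemma finite_commuting_orbit:
  assumes fin: "finite A"
    and comm: "\<And>p q x. p \<in> A \<Longrightarrow> q \<in> A \<Longrightarrow> f p (f q x) = f q (f p x)"
    and per: "\<And>p. p \<in> A \<Longrightarrow> \<exists>N T. T > 0 \<and> (f p ^^ (N + T)) x = (f p ^^ N) x"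
  shows "finite {foldr f w x | w. set w \<subseteq> A}"
  using assms
proof (induction A)
  case empty
  then show ?case by simp
next
  case (insert p A)
  let ?O = "{foldr f w x | w. set w \<subseteq> A}"
  have pow_comm: "(f p ^^ n) (f q y) = f q ((f p ^^ n) y)" if "q \<in> A" for q n y
    using that insert.prems(1) by (induction n) auto
  have word: "\<exists>n v. set v \<subseteq> A \<and> foldr f w x = (f p ^^ n) (foldr f v x)" if "set w \<subseteq> insert p A" for w
    using that
  proof (induction w)
    case Nil
    then show ?case by (intro exI[of _ 0] exI[of _ "[]"]) simp
  next
    case (Cons q w)
    then obtain n v where v: "set v \<subseteq> A" "foldr f w x = (f p ^^ n) (foldr f v x)" by auto
    show ?case
    proof (cases "q = p")
      case True
      then have "foldr f (q # w) x = (f p ^^ Suc n) (foldr f v x)" using v by simp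
      then show ?thesis using v(1) by blast
    next
      case False
      then have q: "q \<in> A" using Cons.prems by simp
      then have "foldr f (q # w) x = (f p ^^ n) (foldr f (q # v) x)" using v pow_comm by simp
      moreover have "set (q # v) \<subseteq> A" using q v by simp
      ultimately show ?thesis by blast
    qed
  qed
  obtain N T where T: "T > 0" "(f p ^^ (N + T)) x = (f p ^^ N) x" using insert.prems(2) by blast
  have red: "\<exists>m<N + T. (f p ^^ n) x = (f p ^^ m) x" for n
  proof (induction n rule: less_induct)
    case (less n)
    show ?case
    proof (cases "n < N + T")
      case False
      then have n: "n = (n - (N + T)) + (N + T)" "n - T = (n - (N + T)) + N" by auto
      have "(f p ^^ n) x = (f p ^^ (n - (N + T))) ((f p ^^ (N + T)) x)"
        by (subst n(1)) (simp only: funpow_add o_apply)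
      also have "\<dots> = (f p ^^ (n - T)) x" unfolding T(2) n(2) by (simp only: funpow_add o_apply)
      finally show ?thesis using less[of "n - T"] T(1) False by auto
    qed auto
  qed
  have foldr_comm: "(f p ^^ n) (foldr f v y) = foldr f v ((f p ^^ n) y)" if "set v \<subseteq> A" for v n y
    using that by (induction v) (auto simp: pow_comm)
  have "{foldr f w x | w. set w \<subseteq> insert p A} \<subseteq> (\<Union>m<N + T. (f p ^^ m) ` ?O)"
  proof
    fix y assume "y \<in> {foldr f w x | w. set w \<subseteq> insert p A}"
    then obtain n v where v: "set v \<subseteq> A" "y = (f p ^^ n) (foldr f v x)" using word by blast
    obtain m where m: "m < N + T" "(f p ^^ n) x = (f p ^^ m) x" using red by blast
    have "y = (f p ^^ m) (foldr f v x)" using v m foldr_comm by simp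
    then show "y \<in> (\<Union>m<N + T. (f p ^^ m) ` ?O)" using v m by blast
  qed
  moreover have "finite ?O" using insert by simp
  ultimately show ?case by (meson finite_UN_I finite_imageI finite_lessThan finite_subset)
qed

section \<open>Congruences in O_L and periodicity along iteration of an index map\<close>

context number_subfield
begin

text \<open>The index ideals belong to O_K, but the components of a vector lie in O_L. Taking the
  whole field as subfield makes the facts about \<open>\<O>\<close> available for
  \<open>integers\<close>.\<close>

interpretation TOP: number_subfield R "carrier R"
  by (rule number_subfield.intro[OF field_axioms
        number_subfield_axioms.intro[OF char_zero finite_degree carrier_is_subfield]])

lemma TOP_O: "TOP.\<O> = integers"
  unfolding TOP.\<O>_def integers_def by auto

lemmas TOP_ideal_facts = TOP.is_idealD[unfolded TOP_O]

lemma cong_mod_ideal: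
  assumes J: "TOP.is_ideal J"
  shows "u \<in> carrier R \<Longrightarrow> u \<ominus> u \<in> J"
    and "\<lbrakk>u \<in> carrier R; v \<in> carrier R; u \<ominus> v \<in> J\<rbrakk> \<Longrightarrow> v \<ominus> u \<in> J"
    and "\<lbrakk>u \<in> carrier R; v \<in> carrier R; w \<in> carrier R; u \<ominus> v \<in> J; v \<ominus> w \<in> J\<rbrakk> \<Longrightarrow> u \<ominus> w \<in> J"
    and "\<lbrakk>u \<in> carrier R; v \<in> carrier R; u' \<in> carrier R; v' \<in> carrier R; u \<ominus> v \<in> J; u' \<ominus> v' \<in> J\<rbrakk>
      \<Longrightarrow> (u \<oplus> u') \<ominus> (v \<oplus> v') \<in> J"
    and "\<lbrakk>u \<in> integers; v \<in> integers; u \<ominus> v \<in> J\<rbrakk> \<Longrightarrow> u [^] (q::nat) \<ominus> v [^] q \<in> J"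
proof -
  note f = TOP_ideal_facts[OF J]
  show "u \<in> carrier R \<Longrightarrow> u \<ominus> u \<in> J" using f(5) by (simp add: a_minus_def r_neg)
  show "v \<ominus> u \<in> J" if "u \<in> carrier R" "v \<in> carrier R" "u \<ominus> v \<in> J"
  proof -
    have "v \<ominus> u = \<zero> \<ominus> (u \<ominus> v)" using that(1,2) by algebra
    then show ?thesis using f(5,7) that by simp
  qed
  show "u \<ominus> w \<in> J" if "u \<in> carrier R" "v \<in> carrier R" "w \<in> carrier R" "u \<ominus> v \<in> J" "v \<ominus> w \<in> J"
  proof -
    have "u \<ominus> w = (u \<ominus> v) \<oplus> (v \<ominus> w)" using that(1-3) by algebra
    then show ?thesis using f(6) that by simp
  qed
  show "(u \<oplus> u') \<ominus> (v \<oplus> v') \<in> J"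
    if "u \<in> carrier R" "v \<in> carrier R" "u' \<in> carrier R" "v' \<in> carrier R" "u \<ominus> v \<in> J" "u' \<ominus> v' \<in> J"
  proof -
    have "(u \<oplus> u') \<ominus> (v \<oplus> v') = (u \<ominus> v) \<oplus> (u' \<ominus> v')" using that(1-4) by algebra
    then show ?thesis using f(6) that by simp
  qed
  show "u [^] q \<ominus> v [^] q \<in> J" if uv: "u \<in> integers" "v \<in> integers" "u \<ominus> v \<in> J"
  proof (induction q)
    case 0
    then show ?case using f(5) by (simp add: a_minus_def r_neg)
  next
    case (Suc q)
    have c: "u \<in> carrier R" "v \<in> carrier R" "u [^] q \<in> carrier R" "v [^] q \<in> carrier R"
      using uv integers_carrier by auto
    have "u [^] Suc q \<ominus> v [^] Suc q = u \<otimes> (u [^] q \<ominus> v [^] q) \<oplus> v [^] q \<otimes> (u \<ominus> v)"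
      unfolding nat_pow_Suc using c by algebra
    moreover have "v [^] q \<in> integers" using TOP.pow_O[unfolded TOP_O] uv by blast
    ultimately show ?case using f(3,6) Suc uv by simp
  qed
qed

lemma finite_residue_classes:
  assumes J: "TOP.is_ideal J" "x \<in> J" "x \<noteq> \<zero>"
  shows "finite ((\<lambda>u. {v \<in> integers. u \<ominus> v \<in> J}) ` integers)"
proof -
  note f = TOP_ideal_facts[OF J(1)] and cg = cong_mod_ideal[OF J(1)]
  have x: "x \<in> integers" using J f(2) by blast
  obtain F where F: "finite F" "F \<subseteq> integers" "\<forall>r\<in>integers. \<exists>f\<in>F. \<exists>s\<in>integers. r = f \<oplus> x \<otimes> s"
    using TOP.finite_residues[unfolded TOP_O, OF x J(3)] by (elim exE conjE)
  have "(\<lambda>u. {v \<in> integers. u \<ominus> v \<in> J}) ` integers \<subseteq> (\<lambda>u. {v \<in> integers. u \<ominus> v \<in> J}) ` F"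
  proof (rule image_subsetI)
    fix u assume u: "u \<in> integers"
    obtain e s where e: "e \<in> F" "s \<in> integers" "u = e \<oplus> x \<otimes> s" using bspec[OF F(3) u] by (elim bexE)
    have c: "e \<in> carrier R" "s \<in> carrier R" "x \<in> carrier R" "u \<in> carrier R"
      using e F(2) x u integers_carrier by auto
    have "u \<ominus> e = s \<otimes> x" unfolding e(3) using c by algebra
    then have ue: "u \<ominus> e \<in> J" using f(3)[OF e(2) J(2)] by simp
    have "{v \<in> integers. u \<ominus> v \<in> J} = {v \<in> integers. e \<ominus> v \<in> J}"
      using cg(3)[of u e] cg(3)[of e u] ue cg(2)[OF c(4,1) ue] c integers_carrier by blast
    then show "{v \<in> integers. u \<ominus> v \<in> J} \<in> (\<lambda>u. {v \<in> integers. u \<ominus> v \<in> J}) ` F" using e(1) by blast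
  qed
  then show ?thesis using F(1) finite_surj by blast
qed

text \<open>N and T are chosen before i: this uniformity later turns congruences of components into
  equality of shifted vectors. The map \<open>\<pi>\<close> will be multiplication of index ideals
  by a prime.\<close>

definition eventually_periodic :: "'a set \<Rightarrow> ('i \<Rightarrow> 'i) \<Rightarrow> 'i set \<Rightarrow> ('i \<Rightarrow> 'a) \<Rightarrow> bool" where
  "eventually_periodic J \<pi> A d \<longleftrightarrow>
     (\<exists>N T. T > 0 \<and> (\<forall>n\<ge>N. \<forall>i\<in>A. d ((\<pi> ^^ (n + T)) i) \<ominus> d ((\<pi> ^^ n) i) \<in> J))"

lemma funpow_mem: "(\<And>i. i \<in> A \<Longrightarrow> \<pi> i \<in> A) \<Longrightarrow> i \<in> A \<Longrightarrow> (\<pi> ^^ n) i \<in> A"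
  by (induction n) auto

lemma period_multiple:
  assumes J: "TOP.is_ideal J" and \<pi>: "\<And>i. i \<in> A \<Longrightarrow> \<pi> i \<in> A" and d: "\<And>i. i \<in> A \<Longrightarrow> d i \<in> carrier R"
    and T: "\<And>n i. n \<ge> N \<Longrightarrow> i \<in> A \<Longrightarrow> d ((\<pi> ^^ (n + T)) i) \<ominus> d ((\<pi> ^^ n) i) \<in> J"
    and n: "n \<ge> N" and i: "i \<in> A"
  shows "d ((\<pi> ^^ (n + T * c)) i) \<ominus> d ((\<pi> ^^ n) i) \<in> J"
proof (induction c)
  case 0
  then show ?case using cong_mod_ideal(1)[OF J] d funpow_mem[of A \<pi>, OF \<pi> i] by simp
next
  case (Suc c)
  have "d ((\<pi> ^^ (n + T * Suc c)) i) \<ominus> d ((\<pi> ^^ (n + T * c)) i) \<in> J"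
    using T[OF _ i, of "n + T * c"] n by (simp add: algebra_simps)
  then show ?case using cong_mod_ideal(3)[OF J _ _ _ _ Suc] d funpow_mem[of A \<pi>, OF \<pi> i] by blast
qed

lemma eventually_periodic_add:
  assumes J: "TOP.is_ideal J" and \<pi>: "\<And>i. i \<in> A \<Longrightarrow> \<pi> i \<in> A"
    and d: "\<And>i. i \<in> A \<Longrightarrow> d i \<in> carrier R" "\<And>i. i \<in> A \<Longrightarrow> e i \<in> carrier R"
    and p: "eventually_periodic J \<pi> A d" "eventually_periodic J \<pi> A e"
    and s: "\<And>i. i \<in> A \<Longrightarrow> s i = d i \<oplus> e i"
  shows "eventually_periodic J \<pi> A s"
proof -
  obtain N T where T: "T > 0" "\<And>n i. n \<ge> N \<Longrightarrow> i \<in> A \<Longrightarrow> d ((\<pi> ^^ (n + T)) i) \<ominus> d ((\<pi> ^^ n) i) \<in> J"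
    using p(1) unfolding eventually_periodic_def by blast
  obtain M U where U: "U > 0" "\<And>n i. n \<ge> M \<Longrightarrow> i \<in> A \<Longrightarrow> e ((\<pi> ^^ (n + U)) i) \<ominus> e ((\<pi> ^^ n) i) \<in> J"
    using p(2) unfolding eventually_periodic_def by blast
  have "s ((\<pi> ^^ (n + T * U)) i) \<ominus> s ((\<pi> ^^ n) i) \<in> J" if n: "n \<ge> max N M" and i: "i \<in> A" for n i
  proof -
    note m = funpow_mem[of A \<pi>, OF \<pi> i]
    have "d ((\<pi> ^^ (n + T * U)) i) \<ominus> d ((\<pi> ^^ n) i) \<in> J"
      using period_multiple[of J A \<pi> d N T n i U, OF J \<pi> d(1) T(2)] n i by simp
    moreover have "e ((\<pi> ^^ (n + T * U)) i) \<ominus> e ((\<pi> ^^ n) i) \<in> J"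
      using period_multiple[of J A \<pi> e M U n i T, OF J \<pi> d(2) U(2)] n i by (simp add: mult.commute)
    ultimately show ?thesis using cong_mod_ideal(4)[OF J] d m by (simp add: s)
  qed
  moreover have "T * U > 0" using T U by simp
  ultimately show ?thesis unfolding eventually_periodic_def by blast
qed

text \<open>The two ideals are kept separate because multiplication by an element of P improves a
  congruence by one level.\<close>

lemma eventually_periodic_smult:
  assumes \<pi>: "\<And>i. i \<in> A \<Longrightarrow> \<pi> i \<in> A"
    and d: "\<And>i. i \<in> A \<Longrightarrow> d i \<in> carrier R" and r: "r \<in> carrier R"
    and p: "eventually_periodic J \<pi> A d" and J: "\<And>x. x \<in> J \<Longrightarrow> r \<otimes> x \<in> J'"
    and s: "\<And>i. i \<in> A \<Longrightarrow> s i = r \<otimes> d i"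
  shows "eventually_periodic J' \<pi> A s"
proof -
  obtain N T where T: "T > 0" "\<And>n i. n \<ge> N \<Longrightarrow> i \<in> A \<Longrightarrow> d ((\<pi> ^^ (n + T)) i) \<ominus> d ((\<pi> ^^ n) i) \<in> J"
    using p unfolding eventually_periodic_def by blast
  have "s ((\<pi> ^^ (n + T)) i) \<ominus> s ((\<pi> ^^ n) i) \<in> J'" if n: "n \<ge> N" and i: "i \<in> A" for n i
  proof -
    note m = funpow_mem[of A \<pi>, OF \<pi> i]
    have "s ((\<pi> ^^ (n + T)) i) \<ominus> s ((\<pi> ^^ n) i) = r \<otimes> (d ((\<pi> ^^ (n + T)) i) \<ominus> d ((\<pi> ^^ n) i))"
    proof -
      have "s ((\<pi> ^^ (n + T)) i) = r \<otimes> d ((\<pi> ^^ (n + T)) i)" "s ((\<pi> ^^ n) i) = r \<otimes> d ((\<pi> ^^ n) i)"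
        using s m by blast+
      moreover have "d ((\<pi> ^^ (n + T)) i) \<in> carrier R" "d ((\<pi> ^^ n) i) \<in> carrier R" using d m by blast+
      ultimately show ?thesis using r by algebra
    qed
    then show ?thesis using J T(2)[OF n i] by simp
  qed
  then show ?thesis using T(1) unfolding eventually_periodic_def by blast
qed

text \<open>Modulo an ideal of finite index, a recursion \<open>x\<^sub>n\<^sub>+\<^sub>1 = x\<^sub>n\<^sup>q + d\<^sub>n\<close> with \<open>d\<close> of period \<open>T\<close> is a
  deterministic dynamical system on finitely many classes when sampled with step \<open>T\<close>; preperiod
  and period are bounded by the number of classes only, hence uniformly in the index \<open>i\<close>.\<close>

lemma eventually_periodic_power_recursion:
  assumes J: "TOP.is_ideal J" "y \<in> J" "y \<noteq> \<zero>" and \<pi>: "\<And>i. i \<in> A \<Longrightarrow> \<pi> i \<in> A"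
    and d: "\<And>i. i \<in> A \<Longrightarrow> d i \<in> integers" and x: "\<And>i. i \<in> A \<Longrightarrow> x i \<in> integers"
    and rec: "\<And>i. i \<in> A \<Longrightarrow> x (\<pi> i) = x i [^] (q::nat) \<oplus> d i"
    and p: "eventually_periodic J \<pi> A d"
  shows "eventually_periodic J \<pi> A x"
proof -
  obtain N T where T: "T > 0" "\<And>n i. n \<ge> N \<Longrightarrow> i \<in> A \<Longrightarrow> d ((\<pi> ^^ (n + T)) i) \<ominus> d ((\<pi> ^^ n) i) \<in> J"
    using p unfolding eventually_periodic_def by blast
  note cg = cong_mod_ideal[OF J(1)]
  define cl where "cl u = {v \<in> integers. u \<ominus> v \<in> J}" for u
  have fin: "finite (cl ` integers)" unfolding cl_def by (rule finite_residue_classes[OF J])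
  define s where "s = card (cl ` integers)"
  have cl_eq: "cl u = cl v \<longleftrightarrow> u \<ominus> v \<in> J" if "u \<in> integers" "v \<in> integers" for u v
  proof -
    have c: "u \<in> carrier R" "v \<in> carrier R" using that integers_carrier by auto
    have "v \<in> cl v" unfolding cl_def using cg(1) c that by blast
    then have "cl u = cl v \<Longrightarrow> u \<ominus> v \<in> J" unfolding cl_def by blast
    moreover have "cl u = cl v" if uv: "u \<ominus> v \<in> J"
      unfolding cl_def using cg(3)[of u v] cg(3)[of v u] uv cg(2)[OF c uv] c integers_carrier by blast
    ultimately show ?thesis by blast
  qed
  have "x ((\<pi> ^^ (n + T * fact s)) i) \<ominus> x ((\<pi> ^^ n) i) \<in> J"
    if n: "n \<ge> N + T * s" and i: "i \<in> A" for n i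
  proof -
    \<comment> \<open>Sampling starts at m, so that n is the sample of index s; by then the
      preperiod is over, since there are only s classes.\<close>
    define m where "m = n - T * s"
    have m: "m \<ge> N" "n = m + T * s" using n unfolding m_def by auto
    note mem = funpow_mem[of A \<pi>, OF \<pi> i]
    have dc: "d j \<in> carrier R" if "j \<in> A" for j using d that integers_carrier by blast
    define z where "z k = cl (x ((\<pi> ^^ (m + T * k)) i))" for k
    have "z (Suc k) = z (Suc l)" if kl: "z k = z l" for k l
    proof -
      \<comment> \<open>From congruent starting values the recursion runs in parallel: the driving
        terms at both places are congruent to the one at m + t.\<close>
      have "x ((\<pi> ^^ (m + T * k + t)) i) \<ominus> x ((\<pi> ^^ (m + T * l + t)) i) \<in> J" for t
      proof (induction t)
        case 0
        then show ?case using kl cl_eq x[OF mem] unfolding z_def by simp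
      next
        case (Suc t)
        have dd: "d ((\<pi> ^^ (m + T * c + t)) i) \<ominus> d ((\<pi> ^^ (m + t)) i) \<in> J" for c
          using period_multiple[of J A \<pi> d N T "m + t" i c, OF J(1) \<pi> dc T(2)] m i
          by (simp add: ac_simps)
        have "d ((\<pi> ^^ (m + T * k + t)) i) \<ominus> d ((\<pi> ^^ (m + T * l + t)) i) \<in> J"
          using cg(3)[OF _ _ _ dd[of k] cg(2)[OF _ _ dd[of l]]] dc[OF mem] by blast
        moreover have "x ((\<pi> ^^ (m + T * k + t)) i) [^] q \<ominus> x ((\<pi> ^^ (m + T * l + t)) i) [^] q \<in> J"
          using cg(5)[OF x[OF mem] x[OF mem] Suc] .
        moreover have "x ((\<pi> ^^ (a + Suc t)) i) = x ((\<pi> ^^ (a + t)) i) [^] q \<oplus> d ((\<pi> ^^ (a + t)) i)" for a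
          using rec[OF mem, of "a + t"] by simp
        ultimately show ?case
          using cg(4) dc[OF mem] integers_carrier[OF x[OF mem]] by simp
      qed
      from this[of T] have "cl (x ((\<pi> ^^ (m + T * k + T)) i)) = cl (x ((\<pi> ^^ (m + T * l + T)) i))"
        using cl_eq x[OF mem] by blast
      moreover have "m + T * Suc j = m + T * j + T" for j by simp
      ultimately show ?thesis unfolding z_def by (simp only:)
    qed
    moreover have "z k \<in> cl ` integers" for k unfolding z_def using x[OF mem] by blast
    ultimately have "z (s + fact s) = z s"
      using deterministic_sequence_periodic[OF fin, of z s] unfolding s_def by blast
    then show ?thesis using cl_eq x[OF mem] m(2) unfolding z_def by (simp add: algebra_simps)
  qed
  moreover have "T * fact s > 0" using T(1) by simp
  ultimately show ?thesis unfolding eventually_periodic_def by blast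
qed

text \<open>A replacement for \<open>P\<^sup>m O\<^sub>L\<close>, where \<open>g\<close> is a nonintegral element of \<open>P\<^sup>-\<^sup>1\<close>: no knowledge of
  the powers of \<open>P\<close> is needed to see that these ideals are of finite index and intersect in \<open>0\<close>.\<close>

definition level :: "'a \<Rightarrow> nat \<Rightarrow> 'a set" where
  "level g m = {x \<in> integers. \<forall>j\<le>m. g [^] j \<otimes> x \<in> integers}"

lemma is_ideal_level:
  assumes g: "g \<in> carrier R"
  shows "TOP.is_ideal (level g m)"
proof (rule TOP.is_idealI, unfold TOP_O)
  note c = integers_carrier
  fix r x assume r: "r \<in> integers" and x: "x \<in> level g m"
  have "g [^] j \<otimes> (r \<otimes> x) = r \<otimes> (g [^] j \<otimes> x)" for j :: nat
    using g r x c unfolding level_def by (simp add: m_lcomm)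
  then show "r \<otimes> x \<in> level g m" using r x integers_facts(6) unfolding level_def by simp
qed (use g integers_carrier integers_facts in \<open>auto simp: level_def r_distr\<close>)

lemma level_0: "level g 0 = integers"
  unfolding level_def using integers_carrier by auto

lemma level_antimono: "m \<le> n \<Longrightarrow> level g n \<subseteq> level g m"
  unfolding level_def by auto

lemma O_subset_integers: "x \<in> \<O> \<Longrightarrow> x \<in> integers"
  unfolding \<O>_def by blast

lemma shift_apply: "i \<in> ideals \<Longrightarrow> shift OK P x i = x (ideal_prod R P i)"
  unfolding shift_def nonzero_ideals_OK ideal_prod_OK by simp

lemma ideal_prod_prime_mem: "is_prime P \<Longrightarrow> i \<in> ideals \<Longrightarrow> ideal_prod R P i \<in> ideals"
  using ideal_prod_mem_ideals is_prime_mem_ideals by blast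

lemma shift_carrier: "is_prime P \<Longrightarrow> x \<in> carrier ghost \<Longrightarrow> shift OK P x \<in> carrier ghost"
  unfolding ghost_simps shift_def nonzero_ideals_OK ideal_prod_OK using ideal_prod_prime_mem by auto

lemma ghost_submoduleI:
  assumes "H \<subseteq> carrier ghost" "\<zero>\<^bsub>ghost\<^esub> \<in> H"
    and "\<And>x y. x \<in> H \<Longrightarrow> y \<in> H \<Longrightarrow> x \<oplus>\<^bsub>ghost\<^esub> y \<in> H"
    and "\<And>r x. r \<in> \<O> \<Longrightarrow> x \<in> H \<Longrightarrow> r \<odot>\<^bsub>ghost\<^esub> x \<in> H"
  shows "submodule H OK ghost"
proof -
  interpret G: ring ghost by (rule ghost_ring)
  have "\<ominus>\<^bsub>ghost\<^esub> x \<in> H" if x: "x \<in> H" for x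
  proof -
    have xc: "x \<in> carrier ghost" using x assms(1) by blast
    have n: "(\<ominus> \<one>) \<odot>\<^bsub>ghost\<^esub> x \<in> H" using assms(4) x O_facts(3,5) by blast
    have "((\<ominus> \<one>) \<odot>\<^bsub>ghost\<^esub> x) \<oplus>\<^bsub>ghost\<^esub> x = \<zero>\<^bsub>ghost\<^esub>"
      unfolding ghost_simps using ghost_mem_carrier[OF xc] by (intro restrict_ext) (simp add: l_minus l_neg)
    then have "\<ominus>\<^bsub>ghost\<^esub> x = (\<ominus> \<one>) \<odot>\<^bsub>ghost\<^esub> x"
      by (rule G.minus_equality[OF _ xc subsetD[OF assms(1) n]])
    then show ?thesis using n by (simp only:)
  qed
  then have "subgroup H (add_monoid ghost)"
    using assms by (intro G.add.subgroupI) (auto simp: a_inv_def)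
  then show ?thesis using assms(4) by (simp add: submodule_def submodule_axioms_def)
qed

lemma witt_stage_carrier: "witt_stage OK OL n \<subseteq> carrier ghost"
  by (induction n) auto

section \<open>Witt stages at a fixed prime P, with g a nonintegral element of P^-1\<close>

context
  fixes P g
  assumes P: "is_prime P" and g: "g \<in> E" "g \<notin> \<O>" and gP: "\<And>p. p \<in> P \<Longrightarrow> g \<otimes> p \<in> \<O>"
begin

lemma g_carrier: "g \<in> carrier R"
  using g subringE(1)[OF subring_E] by blast

lemma P_integers: "p \<in> P \<Longrightarrow> p \<in> integers"
  using is_idealD(2)[OF is_primeD(1)[OF P]] O_subset_integers by blast

text \<open>One of the factors g is spent on making gr integral; the remaining ones are covered by
  the level of x.\<close>

lemma level_smult:
  assumes r: "r \<in> P" and x: "x \<in> level g m"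
  shows "r \<otimes> x \<in> level g (Suc m)"
proof -
  have ri: "r \<in> integers" using P_integers r .
  have c: "r \<in> carrier R" "x \<in> carrier R" using ri x integers_carrier unfolding level_def by auto
  have "g [^] j \<otimes> (r \<otimes> x) \<in> integers" if "j \<le> Suc m" for j
  proof (cases j)
    case 0
    then show ?thesis using ri x c integers_facts(6) unfolding level_def by simp
  next
    case (Suc k)
    have "g [^] j \<otimes> (r \<otimes> x) = (g \<otimes> r) \<otimes> (g [^] k \<otimes> x)"
      unfolding Suc using c g_carrier by (simp add: m_ac)
    moreover have "g [^] k \<otimes> x \<in> integers" using x Suc that unfolding level_def by auto
    ultimately show ?thesis using integers_facts(6) O_subset_integers[OF gP[OF r]] by simp
  qed
  then show ?thesis using ri x integers_facts(6) unfolding level_def by simp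
qed

text \<open>Repeated multiplication by a nonzero element of P produces nonzero elements of every
  level; this is what gives finitely many residue classes modulo \<open>level g m\<close>.\<close>

lemma level_nonzero: "\<exists>y\<in>level g m. y \<noteq> \<zero>"
proof (induction m)
  case 0
  then show ?case using integers_facts(3) one_not_zero
    by (intro bexI[of _ "\<one>"]) (auto simp: level_0)
next
  case (Suc m)
  then obtain y where y: "y \<in> level g m" "y \<noteq> \<zero>" by blast
  obtain x where x: "x \<in> P" "x \<noteq> \<zero>" using is_ideal_nonzero_element is_primeD[OF P] by blast
  have "x \<otimes> y \<noteq> \<zero>"
    using integral[of x y] x y P_integers integers_carrier unfolding level_def by blast
  then show ?case using level_smult[OF x(1) y(1)] by blast
qed

text \<open>An element of all levels would be a common denominator of the powers of g in O_L, making
  g integral; as g lies in E, it would belong to O.\<close>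

lemma level_separates:
  assumes "x \<in> integers" "x \<noteq> \<zero>"
  shows "\<exists>m. x \<notin> level g m"
proof (rule ccontr)
  assume "\<not> ?thesis"
  then have "x \<otimes> g [^] m \<in> integers" for m :: nat
    using assms(1) g_carrier integers_carrier unfolding level_def by (auto simp: m_comm)
  then have "g \<in> integers" using TOP.almost_integral[unfolded TOP_O, OF assms g_carrier] by blast
  then show False using g unfolding \<O>_def by blast
qed

lemma level_separates_finite:
  assumes "finite V" "V \<subseteq> integers"
  shows "\<exists>m. \<forall>u\<in>V. \<forall>v\<in>V. u \<ominus> v \<in> level g m \<longrightarrow> u = v"
proof -
  have "\<forall>uv\<in>V \<times> V. \<exists>m. fst uv \<ominus> snd uv \<in> level g m \<longrightarrow> fst uv = snd uv"
  proof
    fix uv assume "uv \<in> V \<times> V"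
    then have i: "fst uv \<in> integers" "snd uv \<in> integers" using assms by auto
    show "\<exists>m. fst uv \<ominus> snd uv \<in> level g m \<longrightarrow> fst uv = snd uv"
      using level_separates[of "fst uv \<ominus> snd uv"] TOP.O_minus[unfolded TOP_O, OF i] i integers_carrier
      by (metis r_right_minus_eq)
  qed
  then obtain m where m: "\<forall>uv\<in>V \<times> V. fst uv \<ominus> snd uv \<in> level g (m uv) \<longrightarrow> fst uv = snd uv"
    using bchoice[of "V \<times> V" "\<lambda>uv m. fst uv \<ominus> snd uv \<in> level g m \<longrightarrow> fst uv = snd uv"]
    by blast
  define M where "M = Max (insert 0 (m ` (V \<times> V)))"
  have "u = v" if uv: "u \<in> V" "v \<in> V" "u \<ominus> v \<in> level g M" for u v
  proof -
    have "m (u, v) \<le> M" unfolding M_def using assms(1) uv by (intro Max_ge) auto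
    then have "u \<ominus> v \<in> level g (m (u, v))" using level_antimono uv(3) by blast
    then show ?thesis using bspec[OF m, of "(u, v)"] uv(1,2) by simp
  qed
  then show ?thesis by blast
qed

text \<open>The elements of O that g multiplies into O form a proper ideal containing P, hence P
  itself. In this way a congruence in O_L yields membership in a prime of O_K.\<close>

lemma integer_in_level_1:
  assumes c: "c \<in> \<O>" "c \<in> level g 1"
  shows "c \<in> P"
proof -
  define Q where "Q = {y \<in> \<O>. g \<otimes> y \<in> \<O>}"
  have "is_ideal Q"
  proof (rule is_idealI)
    fix r y assume ry: "r \<in> \<O>" "y \<in> Q"
    then have "g \<otimes> (r \<otimes> y) = r \<otimes> (g \<otimes> y)" using g_carrier O_carrier unfolding Q_def by (simp add: m_lcomm)
    then show "r \<otimes> y \<in> Q" using ry O_facts(6) unfolding Q_def by simp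
  qed (use g_carrier O_carrier O_facts in \<open>auto simp: Q_def r_distr\<close>)
  moreover have "P \<subseteq> Q" unfolding Q_def using gP is_idealD(2)[OF is_primeD(1)[OF P]] by blast
  moreover have "\<one> \<notin> Q" unfolding Q_def using g g_carrier by simp
  ultimately have "Q = P" using is_prime_maximal[OF P] by blast
  moreover have "g \<otimes> c \<in> \<O>"
  proof -
    have "g [^] (1::nat) \<otimes> c \<in> integers" using c(2) unfolding level_def by blast
    moreover have "g \<otimes> c \<in> E" using g c subringE(6)[OF subring_E] unfolding \<O>_def by blast
    ultimately show ?thesis using g_carrier unfolding \<O>_def by simp
  qed
  ultimately show ?thesis using c unfolding Q_def by blast
qed

text \<open>The span is an intersection of submodules, so it is contained in any property that cuts
  out a submodule through the generators.\<close>

lemma ideal_span_induct: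
  assumes d: "d \<in> ideal_span OK ghost P Z" and Z: "Z \<subseteq> carrier ghost"
    and zero: "H (\<zero>\<^bsub>ghost\<^esub>)"
    and gen: "\<And>r z. r \<in> P \<Longrightarrow> z \<in> Z \<Longrightarrow> H (r \<odot>\<^bsub>ghost\<^esub> z)"
    and add: "\<And>x y. x \<in> carrier ghost \<Longrightarrow> y \<in> carrier ghost \<Longrightarrow> H x \<Longrightarrow> H y \<Longrightarrow> H (x \<oplus>\<^bsub>ghost\<^esub> y)"
    and smult: "\<And>r x. r \<in> \<O> \<Longrightarrow> x \<in> carrier ghost \<Longrightarrow> H x \<Longrightarrow> H (r \<odot>\<^bsub>ghost\<^esub> x)"
  shows "d \<in> carrier ghost \<and> H d"
proof -
  interpret G: ring ghost by (rule ghost_ring)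
  have smult_closed: "r \<odot>\<^bsub>ghost\<^esub> x \<in> carrier ghost" if "r \<in> integers" "x \<in> carrier ghost" for r x
    using that(1) ghost_mem[OF that(2)] integers_facts(6) unfolding ghost_simps
    by (simp add: restrict_PiE_iff)
  have "submodule {x \<in> carrier ghost. H x} OK ghost"
    by (rule ghost_submoduleI) (use zero add smult smult_closed O_subset_integers in auto)
  moreover have "{r \<odot>\<^bsub>ghost\<^esub> z | r z. r \<in> P \<and> z \<in> Z} \<subseteq> {x \<in> carrier ghost. H x}"
    using gen smult_closed P_integers Z by blast
  ultimately have "d \<in> {x \<in> carrier ghost. H x}" using d unfolding ideal_span_def by blast
  then show ?thesis by blast
qed

text \<open>Reads the defining condition of a stage as a recursion along the index map I \<mapsto>
  PI, with a driving term in the P-span of the previous stage.\<close>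

lemma witt_stage_recursion:
  assumes x: "x \<in> witt_stage OK OL (Suc m)"
  obtains d and q :: nat where "d \<in> ideal_span OK ghost P (witt_stage OK OL m)"
    "\<And>i. i \<in> ideals \<Longrightarrow> d i = x (ideal_prod R P i) \<ominus> x i [^] q"
proof -
  interpret G: ring ghost by (rule ghost_ring)
  have xc: "x \<in> carrier ghost" using x witt_stage_carrier by blast
  define q where "q = card (carrier (OK Quot P))"
  have "P \<in> nonzero_primes OK" using P unfolding nonzero_primes_OK by simp
  then have "shift OK P x \<ominus>\<^bsub>ghost\<^esub> x [^]\<^bsub>ghost\<^esub> q \<in> ideal_span OK ghost P (witt_stage OK OL m)"
    using x unfolding q_def by simp
  then show thesis
    by (rule that[of _ q])
      (simp add: ghost_minus[OF shift_carrier[OF P xc] G.nat_pow_closed[OF xc]] shift_apply ghost_pow[OF xc])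
qed

text \<open>The driving term is built from products rz with r in P, and \<open>level_smult\<close>
  makes up for the level by which the induction hypothesis on z falls short. At level 0 any two
  integers are congruent.\<close>

lemma witt_stage_eventually_periodic:
  assumes "x \<in> witt_stage OK OL m"
  shows "eventually_periodic (level g m) (ideal_prod R P) ideals x"
  using assms
proof (induction m arbitrary: x)
  case 0
  then have "x \<in> carrier ghost" using witt_stage_carrier by blast
  then show ?case
    unfolding eventually_periodic_def level_0
    using ghost_mem TOP.O_minus[unfolded TOP_O] funpow_mem[of ideals "ideal_prod R P", OF ideal_prod_prime_mem[OF P]] ideal_prod_prime_mem[OF P]
    by - (rule exI[of _ 0], rule exI[of _ 1], auto)
next
  case (Suc m)
  have xc: "x \<in> carrier ghost" using Suc.prems witt_stage_carrier by blast
  obtain d and q :: nat where d: "d \<in> ideal_span OK ghost P (witt_stage OK OL m)"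
    "\<And>i. i \<in> ideals \<Longrightarrow> d i = x (ideal_prod R P i) \<ominus> x i [^] q"
    using witt_stage_recursion[OF Suc.prems] by blast
  obtain y where y: "y \<in> level g (Suc m)" "y \<noteq> \<zero>" using level_nonzero by blast
  note J = is_ideal_level[OF g_carrier, of "Suc m"] and \<pi> = ideal_prod_prime_mem[OF P]
  note f = TOP_ideal_facts[OF J]
  have dd: "d \<in> carrier ghost \<and> eventually_periodic (level g (Suc m)) (ideal_prod R P) ideals d"
  proof (rule ideal_span_induct[OF d(1) witt_stage_carrier, where H =
        "eventually_periodic (level g (Suc m)) (ideal_prod R P) ideals"])
    show "eventually_periodic (level g (Suc m)) (ideal_prod R P) ideals \<zero>\<^bsub>ghost\<^esub>"
      unfolding eventually_periodic_def ghost_simps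
      using f(5) funpow_mem[of ideals "ideal_prod R P", OF \<pi>] \<pi>
      by - (rule exI[of _ 0], rule exI[of _ 1], auto simp: a_minus_def)
    show "eventually_periodic (level g (Suc m)) (ideal_prod R P) ideals (r \<odot>\<^bsub>ghost\<^esub> z)"
      if r: "r \<in> P" and z: "z \<in> witt_stage OK OL m" for r z
    proof (rule eventually_periodic_smult[OF \<pi> _ _ Suc.IH[OF z] level_smult[OF r]])
      have "z \<in> carrier ghost" using z witt_stage_carrier by blast
      then show "i \<in> ideals \<Longrightarrow> z i \<in> carrier R" for i using ghost_mem_carrier by blast
    qed (use r P_integers integers_carrier in \<open>auto simp: ghost_simps\<close>)
    show "eventually_periodic (level g (Suc m)) (ideal_prod R P) ideals (u \<oplus>\<^bsub>ghost\<^esub> v)"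
      if "u \<in> carrier ghost" "v \<in> carrier ghost"
        "eventually_periodic (level g (Suc m)) (ideal_prod R P) ideals u"
        "eventually_periodic (level g (Suc m)) (ideal_prod R P) ideals v" for u v
      by (rule eventually_periodic_add[OF J \<pi> _ _ that(3,4)])
        (use ghost_mem_carrier that(1,2) in \<open>auto simp: ghost_simps(5)\<close>)
    show "eventually_periodic (level g (Suc m)) (ideal_prod R P) ideals (r \<odot>\<^bsub>ghost\<^esub> z)"
      if r: "r \<in> \<O>" "z \<in> carrier ghost" "eventually_periodic (level g (Suc m)) (ideal_prod R P) ideals z" for r z
      by (rule eventually_periodic_smult[OF \<pi> _ _ r(3) f(3)])
        (use r O_carrier O_subset_integers ghost_mem_carrier in \<open>auto simp: ghost_simps(6)\<close>)
  qed
  show ?case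
  proof (rule eventually_periodic_power_recursion[OF J y \<pi> _ _ _ conjunct2[OF dd]])
    fix i assume i: "i \<in> ideals"
    have c: "x (ideal_prod R P i) \<in> carrier R" "x i [^] q \<in> carrier R"
      using ghost_mem_carrier[OF xc] i \<pi> by auto
    show "x (ideal_prod R P i) = x i [^] q \<oplus> d i" unfolding d(2)[OF i] using c by algebra
  qed (use ghost_mem xc dd in auto)
qed

lemma witt_vector_frobenius_congruence:
  assumes x: "x \<in> witt_stage OK OL 1"
  obtains q :: nat where "\<And>i. i \<in> ideals \<Longrightarrow> x (ideal_prod R P i) \<ominus> x i [^] q \<in> level g 1"
proof -
  obtain d and q :: nat where d: "d \<in> ideal_span OK ghost P (witt_stage OK OL 0)"
    "\<And>i. i \<in> ideals \<Longrightarrow> d i = x (ideal_prod R P i) \<ominus> x i [^] q"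
    using witt_stage_recursion[of x 0] x by auto
  note f = TOP_ideal_facts[OF is_ideal_level[OF g_carrier, of 1]]
  have "\<forall>i\<in>ideals. d i \<in> level g 1"
  proof (rule conjunct2[OF ideal_span_induct[OF d(1) witt_stage_carrier]])
    fix r z assume r: "r \<in> P" and z: "z \<in> witt_stage OK OL 0"
    have "z i \<in> level g 0" if "i \<in> ideals" for i
      using ghost_mem[of z] z that by (simp add: level_0)
    then show "\<forall>i\<in>ideals. (r \<odot>\<^bsub>ghost\<^esub> z) i \<in> level g 1"
      using level_smult[OF r] by (simp add: ghost_simps(6))
  qed (use f O_subset_integers in \<open>auto simp: ghost_simps(4,5,6)\<close>)
  then show thesis using d(2) by (intro that[of q]) (metis)
qed

end

section \<open>The automaton\<close>

lemma witt_vector_eventually_periodic: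
  assumes x: "x \<in> witt_vectors OK OL" and fin: "finite (x ` ideals)" and P: "is_prime P"
  shows "\<exists>N T. T > 0 \<and> (\<forall>i\<in>ideals. x ((ideal_prod R P ^^ (N + T)) i) = x ((ideal_prod R P ^^ N) i))"
proof -
  obtain g where g: "g \<in> E" "g \<notin> \<O>" "\<And>p. p \<in> P \<Longrightarrow> g \<otimes> p \<in> \<O>"
    using prime_inverse_element[OF P] by blast
  have st: "x \<in> witt_stage OK OL m" for m using x unfolding witt_vectors_def by blast
  have V: "x ` ideals \<subseteq> integers" using ghost_mem st witt_stage_carrier by blast
  obtain m where m: "\<forall>u\<in>x ` ideals. \<forall>v\<in>x ` ideals. u \<ominus> v \<in> level g m \<longrightarrow> u = v"
    using level_separates_finite[OF P g fin V] by blast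
  obtain N T where T: "T > 0"
    "\<forall>n\<ge>N. \<forall>i\<in>ideals. x ((ideal_prod R P ^^ (n + T)) i) \<ominus> x ((ideal_prod R P ^^ n) i) \<in> level g m"
    using witt_stage_eventually_periodic[OF P g st, of m] unfolding eventually_periodic_def by blast
  have mem: "(ideal_prod R P ^^ n) i \<in> ideals" if "i \<in> ideals" for n i
    using funpow_mem[of ideals "ideal_prod R P" i n] that ideal_prod_prime_mem[OF P] by blast
  have "x ((ideal_prod R P ^^ (N + T)) i) = x ((ideal_prod R P ^^ N) i)" if i: "i \<in> ideals" for i
  proof -
    have "x ((ideal_prod R P ^^ (N + T)) i) \<ominus> x ((ideal_prod R P ^^ N) i) \<in> level g m"
      using T(2) i by blast
    then show ?thesis using m mem[OF i] by blast
  qed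
  then show ?thesis using T(1) by blast
qed

lemma shift_funpow:
  assumes "is_prime P" "i \<in> ideals"
  shows "(shift OK P ^^ n) x i = x ((ideal_prod R P ^^ n) i)"
  using assms(2)
proof (induction n arbitrary: i)
  case (Suc n)
  have "(shift OK P ^^ Suc n) x i = (shift OK P ^^ n) x (ideal_prod R P i)"
    using shift_apply[OF Suc.prems] by simp
  also have "\<dots> = x ((ideal_prod R P ^^ Suc n) i)"
    using Suc.IH[OF ideal_prod_prime_mem[OF assms(1) Suc.prems]] by (simp add: funpow_swap1)
  finally show ?case .
qed simp

text \<open>A prime without a map F has indices i, j with x_i = x_j but x_(Pi) and x_(Pj) different.
  Both are congruent to x_i^q modulo \<open>level g 1\<close>, so a nonzero integer divisible by
  their difference lies in P. Finitely many differences give finitely many integers, each contained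
  in finitely many ideals.\<close>

lemma finite_non_frobenius_primes:
  assumes x: "x \<in> witt_vectors OK OL" and fin: "finite (x ` ideals)"
  shows "finite {P. is_prime P \<and> \<not> (\<exists>F. \<forall>i\<in>ideals. x (ideal_prod R P i) = F (x i))}"
    (is "finite ?B")
proof -
  let ?V = "x ` ideals"
  have st: "x \<in> witt_stage OK OL m" for m using x unfolding witt_vectors_def by blast
  have V: "?V \<subseteq> integers" using ghost_mem st witt_stage_carrier by blast
  let ?D = "{uv \<in> ?V \<times> ?V. fst uv \<noteq> snd uv}"
  \<comment> \<open>The difference itself lies in O_L; its integer multiple c lies in O_K, where
    membership in P can be tested.\<close>
  have "\<exists>c::int. c \<noteq> 0 \<and> (\<exists>y\<in>integers. [c] \<cdot> \<one> = (fst uv \<ominus> snd uv) \<otimes> y)" if "uv \<in> ?D" for uv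
  proof (rule TOP.nonzero_dvd_integer[unfolded TOP_O])
    have i: "fst uv \<in> integers" "snd uv \<in> integers" using that V by auto
    then show "fst uv \<ominus> snd uv \<in> integers" using TOP.O_minus[unfolded TOP_O] by blast
    show "fst uv \<ominus> snd uv \<noteq> \<zero>" using that i integers_carrier r_right_minus_eq by blast
  qed
  then obtain c :: "'a \<times> 'a \<Rightarrow> int" where
    "\<forall>uv\<in>?D. c uv \<noteq> 0 \<and> (\<exists>y\<in>integers. [c uv] \<cdot> \<one> = (fst uv \<ominus> snd uv) \<otimes> y)"
    using bchoice[of ?D "\<lambda>uv c. c \<noteq> 0 \<and> (\<exists>y\<in>integers. [(c::int)] \<cdot> \<one> = (fst uv \<ominus> snd uv) \<otimes> y)"]
    by (metis (no_types, lifting))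
  then have c: "\<And>uv. uv \<in> ?D \<Longrightarrow> c uv \<noteq> 0"
    "\<And>uv. uv \<in> ?D \<Longrightarrow> \<exists>y\<in>integers. [c uv] \<cdot> \<one> = (fst uv \<ominus> snd uv) \<otimes> y"
    by blast+
  have "?B \<subseteq> (\<Union>uv\<in>?D. {I. is_ideal I \<and> [c uv] \<cdot> \<one> \<in> I})"
  proof
    fix P assume "P \<in> ?B"
    then have P: "is_prime P" and bad: "\<not> (\<exists>F. \<forall>i\<in>ideals. x (ideal_prod R P i) = F (x i))" by auto
    obtain g where g: "g \<in> E" "g \<notin> \<O>" "\<And>p. p \<in> P \<Longrightarrow> g \<otimes> p \<in> \<O>"
      using prime_inverse_element[OF P] by blast
    have gc: "g \<in> carrier R" using g subringE(1)[OF subring_E] by blast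
    note J = is_ideal_level[OF gc, of 1] and mem = ideal_prod_prime_mem[OF P]
    note cg = cong_mod_ideal[OF J]
    obtain q :: nat where q: "\<And>i. i \<in> ideals \<Longrightarrow> x (ideal_prod R P i) \<ominus> x i [^] q \<in> level g 1"
      using witt_vector_frobenius_congruence[OF P g st] by blast
    have "\<exists>i\<in>ideals. \<exists>j\<in>ideals. x i = x j \<and> x (ideal_prod R P i) \<noteq> x (ideal_prod R P j)"
    proof (rule ccontr)
      assume "\<not> ?thesis"
      then have eq: "x (ideal_prod R P i) = x (ideal_prod R P j)"
        if "i \<in> ideals" "j \<in> ideals" "x i = x j" for i j using that by blast
      \<comment> \<open>A representative index is chosen for each value; the choice is harmless
        because, by \<open>eq\<close>, equal values have equal successors.\<close>
      define F where "F v = x (ideal_prod R P (SOME j. j \<in> ideals \<and> x j = v))" for v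
      have "x (ideal_prod R P i) = F (x i)" if i: "i \<in> ideals" for i
      proof -
        have "(SOME j. j \<in> ideals \<and> x j = x i) \<in> ideals \<and> x (SOME j. j \<in> ideals \<and> x j = x i) = x i"
          by (rule someI[of "\<lambda>j. j \<in> ideals \<and> x j = x i" i]) (use i in simp)
        then show ?thesis unfolding F_def using eq i by metis
      qed
      then show False using bad by blast
    qed
    then obtain i j where ij: "i \<in> ideals" "j \<in> ideals" "x i = x j"
      "x (ideal_prod R P i) \<noteq> x (ideal_prod R P j)" by blast
    define uv where "uv = (x (ideal_prod R P i), x (ideal_prod R P j))"
    have uvD: "uv \<in> ?D" unfolding uv_def using ij mem by auto
    have ci: "x k \<in> carrier R" if "k \<in> ideals" for k using V integers_carrier that by blast
    have "fst uv \<ominus> snd uv \<in> level g 1"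
      unfolding uv_def using cg(3)[OF _ _ _ q[OF ij(1)] cg(2)[OF _ _ q[OF ij(2), folded ij(3)]]] ci mem ij
      by simp
    moreover obtain y where y: "y \<in> integers" "[c uv] \<cdot> \<one> = (fst uv \<ominus> snd uv) \<otimes> y" using c(2)[OF uvD] by blast
    moreover have "fst uv \<ominus> snd uv \<in> carrier R" unfolding uv_def using ci mem ij by simp
    ultimately have "[c uv] \<cdot> \<one> \<in> level g 1"
      using TOP_ideal_facts(3)[OF J y(1)] integers_carrier[OF y(1)] by (simp add: m_comm)
    then have "[c uv] \<cdot> \<one> \<in> P" using integer_in_level_1[OF P g int_img_O] by simp
    then show "P \<in> (\<Union>uv\<in>?D. {I. is_ideal I \<and> [c uv] \<cdot> \<one> \<in> I})"
      using uvD is_primeD(1)[OF P] by blast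
  qed
  moreover have "finite (\<Union>uv\<in>?D. {I. is_ideal I \<and> [c uv] \<cdot> \<one> \<in> I})"
  proof (rule finite_UN_I)
    show "finite ?D" using fin by simp
    fix uv assume "uv \<in> ?D"
    then have "[c uv] \<cdot> \<one> \<noteq> \<zero>" using c(1) int_img_eq_zero_iff by blast
    then show "finite {I. is_ideal I \<and> [c uv] \<cdot> \<one> \<in> I}" by (rule finite_ideals_containing[OF int_img_O])
  qed
  ultimately show ?thesis by (rule finite_subset)
qed

lemma shift_commute:
  assumes P: "is_prime P" and Q: "is_prime Q"
  shows "shift OK P (shift OK Q x) = shift OK Q (shift OK P x)"
proof -
  have "shift OK Q x (ideal_prod R P i) = shift OK P x (ideal_prod R Q i)" if i: "i \<in> ideals" for i
  proof -
    have "is_ideal i" using i unfolding ideals_def by blast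
    then show ?thesis
      using ideal_prod_left_commute[OF is_primeD(1)[OF Q] is_primeD(1)[OF P]]
        ideal_prod_prime_mem[OF P i] ideal_prod_prime_mem[OF Q i] by (simp add: shift_apply)
  qed
  then show ?thesis
    unfolding shift_def[of OK P "shift OK Q x"] shift_def[of OK Q "shift OK P x"]
      nonzero_ideals_OK ideal_prod_OK by (intro restrict_ext)
qed

lemma shift_extensional: "shift OK P x \<in> extensional ideals"
  unfolding shift_def nonzero_ideals_OK by simp

text \<open>The states are \<open>G \<circ> \<beta>\<close>, where \<open>\<beta>\<close> runs through the finitely many shifts by products of bad
  primes and \<open>G\<close> through the self-maps of the value set, which absorb the good primes.\<close>

lemma finite_shift_closed_set:
  assumes x: "x \<in> witt_vectors OK OL" and fin: "finite (x ` ideals)"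
  obtains S where "finite S" "x \<in> S" "\<And>P s. is_prime P \<Longrightarrow> s \<in> S \<Longrightarrow> shift OK P s \<in> S"
    "\<And>s i. s \<in> S \<Longrightarrow> i \<in> ideals \<Longrightarrow> s i \<in> integers"
proof -
  define V where "V = x ` ideals"
  have st: "x \<in> witt_stage OK OL m" for m using x unfolding witt_vectors_def by blast
  then have xc: "x \<in> carrier ghost" using witt_stage_carrier by blast
  have Vi: "V \<subseteq> integers" unfolding V_def using ghost_mem[OF xc] by blast
  have xe: "x \<in> extensional ideals" using xc by (simp add: ghost_simps PiE_def)
  define bad where "bad = {P. is_prime P \<and> \<not> (\<exists>F. \<forall>i\<in>ideals. x (ideal_prod R P i) = F (x i))}"
  define B where "B = {foldr (shift OK) w x | w. set w \<subseteq> bad}"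
  have finB: "finite B" unfolding B_def
  proof (rule finite_commuting_orbit)
    show "finite bad" unfolding bad_def by (rule finite_non_frobenius_primes[OF x fin])
    show "\<And>P Q y. P \<in> bad \<Longrightarrow> Q \<in> bad \<Longrightarrow> shift OK P (shift OK Q y) = shift OK Q (shift OK P y)"
      using shift_commute unfolding bad_def by blast
    fix P assume "P \<in> bad"
    then have P: "is_prime P" unfolding bad_def by blast
    obtain N T where T: "T > 0" "\<And>i. i \<in> ideals \<Longrightarrow>
        x ((ideal_prod R P ^^ (N + T)) i) = x ((ideal_prod R P ^^ N) i)"
      using witt_vector_eventually_periodic[OF x fin P] by blast
    \<comment> \<open>Agreement on all index ideals gives equality of functions only because the
      shifted vectors are undefined outside \<open>ideals\<close> in the same way.\<close>
    have ext: "(shift OK P ^^ n) x \<in> extensional ideals" for n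
      by (cases n) (simp_all add: xe shift_extensional)
    have "(shift OK P ^^ (N + T)) x = (shift OK P ^^ N) x"
      by (rule extensionalityI[OF ext ext]) (simp only: shift_funpow[OF P] T(2))
    then show "\<exists>N T. T > 0 \<and> (shift OK P ^^ (N + T)) x = (shift OK P ^^ N) x" using T(1) by blast
  qed
  have "\<exists>F. \<forall>i\<in>ideals. x (ideal_prod R P i) = F (x i)" if "is_prime P" "P \<notin> bad" for P
    using that unfolding bad_def by blast
  then obtain F where F: "\<And>P i. is_prime P \<Longrightarrow> P \<notin> bad \<Longrightarrow> i \<in> ideals \<Longrightarrow> x (ideal_prod R P i) = F P (x i)"
    by metis
  \<comment> \<open>Shifts commute, so every shift of x by bad primes takes its values in V and
    follows the same map \<open>F P\<close> at a good prime.\<close>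
  have BV: "\<beta> i \<in> V" and BF: "is_prime P \<Longrightarrow> P \<notin> bad \<Longrightarrow> \<beta> (ideal_prod R P i) = F P (\<beta> i)"
    if \<beta>: "\<beta> \<in> B" and i: "i \<in> ideals" for \<beta> i P
  proof -
    obtain w where w: "set w \<subseteq> bad" "\<beta> = foldr (shift OK) w x" using \<beta> unfolding B_def by blast
    have "foldr (shift OK) w x i \<in> V \<and> (is_prime P \<and> P \<notin> bad \<longrightarrow>
        foldr (shift OK) w x (ideal_prod R P i) = F P (foldr (shift OK) w x i))"
      using w(1) i
    proof (induction w arbitrary: i)
      case Nil
      then show ?case using F unfolding V_def by simp
    next
      case (Cons Q w)
      then have Q: "is_prime Q" unfolding bad_def by auto
      have Qi: "ideal_prod R Q i \<in> ideals" and ii: "is_ideal i"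
        using ideal_prod_prime_mem[OF Q] Cons.prems(2) unfolding ideals_def by auto
      have "foldr (shift OK) w x (ideal_prod R Q (ideal_prod R P i)) = F P (foldr (shift OK) w x (ideal_prod R Q i))"
        if P: "is_prime P" "P \<notin> bad"
        using Cons.IH[OF _ Qi] Cons.prems(1) P
          ideal_prod_left_commute[OF is_primeD(1)[OF Q] is_primeD(1)[OF P(1)] ii] by simp
      then show ?case
        using Cons.IH[OF _ Qi] Cons.prems ideal_prod_prime_mem by (simp add: shift_apply)
    qed
    then show "\<beta> i \<in> V" "is_prime P \<Longrightarrow> P \<notin> bad \<Longrightarrow> \<beta> (ideal_prod R P i) = F P (\<beta> i)"
      unfolding w(2) by blast+
  qed
  define S where "S = (\<lambda>(G, \<beta>). \<lambda>i\<in>ideals. G (\<beta> i)) ` ((V \<rightarrow>\<^sub>E V) \<times> B)"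
  have xB: "x \<in> B" unfolding B_def by (intro CollectI exI[of _ "[]"]) simp
  show thesis
  proof (rule that[of S])
    have "finite V" unfolding V_def using fin .
    then show "finite S" unfolding S_def using finB by (intro finite_imageI finite_cartesian_product finite_PiE)
    \<comment> \<open>The initial state x has G equal to the identity of V and \<beta> equal to
      x.\<close>
    have "x = (\<lambda>i\<in>ideals. (\<lambda>v\<in>V. v) (x i))"
      using xe by (intro extensionalityI[of _ ideals]) (auto simp: V_def)
    then show "x \<in> S" unfolding S_def using xB by (intro image_eqI[of _ _ "(\<lambda>v\<in>V. v, x)"]) auto
    fix s assume "s \<in> S"
    then obtain G \<beta> where s: "G \<in> V \<rightarrow>\<^sub>E V" "\<beta> \<in> B" "s = (\<lambda>i\<in>ideals. G (\<beta> i))"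
      unfolding S_def by auto
    show "s i \<in> integers" if "i \<in> ideals" for i
      using that s(1,3) BV[OF s(2) that] Vi by auto
    fix P assume P: "is_prime P"
    have sh: "shift OK P s = (\<lambda>i\<in>ideals. G (\<beta> (ideal_prod R P i)))"
      unfolding shift_def nonzero_ideals_OK ideal_prod_OK s(3)
      using ideal_prod_prime_mem[OF P] by (intro restrict_ext) simp
    show "shift OK P s \<in> S"
    proof (cases "P \<in> bad")
      case True
      obtain w where w: "set w \<subseteq> bad" "\<beta> = foldr (shift OK) w x" using s(2) unfolding B_def by blast
      have "shift OK P \<beta> \<in> B" unfolding B_def w(2)
        using w(1) True by (intro CollectI exI[of _ "P # w"]) simp
      moreover have "shift OK P s = (\<lambda>i\<in>ideals. G (shift OK P \<beta> i))"
        unfolding sh by (intro restrict_ext) (simp add: shift_apply)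
      ultimately show ?thesis unfolding S_def using s(1)
        by (intro image_eqI[of _ _ "(G, shift OK P \<beta>)"]) auto
    next
      case False
      \<comment> \<open>A good prime changes only the self-map: G is replaced by its composition
        with \<open>F P\<close>, and \<beta> stays.\<close>
      define H where "H = (\<lambda>v\<in>V. G (F P v))"
      have FV: "F P v \<in> V" if v: "v \<in> V" for v
      proof -
        obtain i where "i \<in> ideals" "v = x i" using v unfolding V_def by blast
        then show ?thesis using F[OF P False] ideal_prod_prime_mem[OF P] unfolding V_def by (metis imageI)
      qed
      have "H \<in> V \<rightarrow>\<^sub>E V" unfolding H_def using FV s(1) by auto
      moreover have "shift OK P s = (\<lambda>i\<in>ideals. H (\<beta> i))"
        unfolding sh H_def using BV[OF s(2)] BF[OF s(2) _ P False] by (intro restrict_ext) simp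
      ultimately show ?thesis unfolding S_def using s(2)
        by (intro image_eqI[of _ _ "(H, \<beta>)"]) auto
    qed
  qed
qed

text \<open>The state reached after reading w is the vector shifted by the letters of w, and its
  component at the unit ideal is the component of x at the product of those letters.\<close>

lemma foldl_shift_apply:
  assumes "set w \<subseteq> {P. is_prime P}"
  shows "foldl (\<lambda>s P. shift OK P s) x w \<O> = x (word_ideal OK w)"
proof -
  have "foldr (ideal_prod OK) w \<O> \<in> ideals \<and> foldl (\<lambda>s P. shift OK P s) x w \<O> = x (foldr (ideal_prod OK) w \<O>)"
    using assms
  proof (induction w arbitrary: x)
    case (Cons P w)
    then show ?case using ideal_prod_prime_mem by (simp add: ideal_prod_OK shift_apply)
  qed (simp add: O_mem_ideals)
  then show ?thesis by (simp add: word_ideal_def)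
qed

text \<open>The Myhill-Nerode automaton: states are vectors in a finite set closed under shifts, a
  letter acts by its shift, and the output is the component at the unit ideal. An injection into
  \<nat> numbers the states.\<close>

lemma integral_imp_automatic:
  assumes x: "x \<in> witt_vectors OK OL" and int: "integral_element OK ghost x"
  shows "automatic OK OL x"
proof -
  have "x \<in> witt_stage OK OL 0" using x unfolding witt_vectors_def by blast
  then have xc: "x \<in> carrier ghost" by simp
  obtain S where S: "finite S" "x \<in> S" "\<And>P s. is_prime P \<Longrightarrow> s \<in> S \<Longrightarrow> shift OK P s \<in> S"
    "\<And>s i. s \<in> S \<Longrightarrow> i \<in> ideals \<Longrightarrow> s i \<in> integers"
    using finite_shift_closed_set[OF x integral_imp_finitely_many_values[OF xc int]] by blast
  obtain h :: "('a set \<Rightarrow> 'a) \<Rightarrow> nat" where h: "inj_on h S"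
    using finite_imp_inj_to_nat_seg[OF S(1)] by blast
  define \<delta> where "\<delta> k P = h (shift OK P (inv_into S h k))" for k P
  define \<tau> where "\<tau> k = inv_into S h k \<O>" for k
  have "dfao (nonzero_primes OK) (carrier OL) (h ` S) \<delta> (h x) \<tau>"
  proof
    show "finite (h ` S)" "h x \<in> h ` S" using S by auto
    show "\<delta> s P \<in> h ` S" if "s \<in> h ` S" "P \<in> nonzero_primes OK" for s P
      using that S(3) unfolding \<delta>_def nonzero_primes_OK by (auto simp: inv_into_f_f[OF h])
    show "\<tau> s \<in> carrier OL" if "s \<in> h ` S" for s
      using that S(4) O_mem_ideals unfolding \<tau>_def by (auto simp: inv_into_f_f[OF h] overring_algebra_def)
  qed
  moreover have "x (word_ideal OK w) = \<tau> (foldl \<delta> (h x) w)" if w: "w \<in> lists (nonzero_primes OK)" for w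
  proof -
    have wp: "set w \<subseteq> {P. is_prime P}" using w unfolding nonzero_primes_OK by auto
    have "foldl (\<lambda>s P. shift OK P s) s w \<in> S \<and> foldl \<delta> (h s) w = h (foldl (\<lambda>s P. shift OK P s) s w)"
      if "s \<in> S" for s
      using wp that
    proof (induction w arbitrary: s)
      case (Cons P w)
      then have "shift OK P s \<in> S" "\<delta> (h s) P = h (shift OK P s)"
        using S(3) by (auto simp: \<delta>_def inv_into_f_f[OF h])
      then show ?case using Cons by simp
    qed simp
    from this[OF S(2)] show ?thesis
      using foldl_shift_apply[OF wp, of x] by (simp add: \<tau>_def inv_into_f_f[OF h])
  qed
  ultimately show ?thesis unfolding automatic_def by blast
qed

end

theorem mainTheorem6:
  fixes L :: "('a, 'm) ring_scheme" and K :: "'a set" and OK :: "('a, 'm) ring_scheme"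
    and OL :: "('a, 'a) module" and \<xi> :: "'a set \<Rightarrow> 'a"
  assumes "number_field L"
    and "subfield K L"
    and "number_field (L\<lparr>carrier := K\<rparr>)"
    and "ring.finite_dimension L K (carrier L)"
    and "OK = ring_of_integers (L\<lparr>carrier := K\<rparr>)"
    and "OL = overring_algebra (ring_of_integers L)"
    and "\<xi> \<in> witt_vectors OK OL"
  shows "integral_element OK (ghost_algebra OK OL) \<xi> \<longleftrightarrow> automatic OK OL \<xi>"
proof -
  interpret number_subfield L K
    using assms(1,2) unfolding number_field_def
    by (intro number_subfield.intro number_subfield_axioms.intro) auto
  have OK: "OK = L\<lparr>carrier := \<O>\<rparr>"
    using assms(5) ring_of_integers_subfield by simp
  have OL: "OL = overring_algebra (L\<lparr>carrier := integers\<rparr>)"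
    using assms(6) ring_of_integers_R by simp
  have "\<xi> \<in> witt_stage OK OL 0" using assms(7) unfolding witt_vectors_def by blast
  then show ?thesis
    using automatic_imp_integral[of \<xi>] integral_imp_automatic[of \<xi>] assms(7) unfolding OK OL by auto
qed

end
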